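(* Let $\mathcal{E}$ be a category with finite limits. The operation $\frown$ is an indexed left-coclosure for $\triangleleft$, in the sense that for polynomials $p,q,r$ in $\mathcal{E}$ there is a bijection $$\mathrm{Hom}_{\mathbf{Poly}_{\mathcal{E}}}(p,\,q\triangleleft r)\cong\coprod_{f\colon P\to Q}\mathrm{Hom}_{\mathbf{Poly}_{\mathcal{E}}}\bigl(p\overset{f}{\frown}q,\,r\bigr),$$ where the coproduct is over morphisms $f\colon P\to Q$ in $\mathcal{E}$, natural over all maps in $p$ and $r$ and over cartesian maps in $q$.
   Context: For $f\colon B\to A$ in $\mathcal{E}$, $\Delta_f\colon\mathcal{E}/A\to\mathcal{E}/B$ denotes pullback along $f$; $f$ is exponentiable if $\Delta_f$ has a right adjoint $\Pi_f$. A polynomial in $\mathcal{E}$ is an exponentiable morphism $p\colon P_*\to P$. A morphism of polynomials $\phi\colon p\to q$ is a pair $\phi_1\colon P\to Q$, $\phi^\sharp\colon P\times_Q Q_*\to P_*$ with $p\circ\phi^\sharp$ the projection to $P$, up to isomorphism of the choice of pullback; it is cartesian if $\phi^\sharp$ is an isomorphism. Composition is $(\psi\circ\phi)_1=\psi_1\circ\phi_1$, $(\psi\circ\phi)^\sharp=\phi^\sharp\circ(P\times_Q\psi^\sharp)$ (using $P\times_R R_*\cong P\times_Q(Q\times_R R_* )$). This gives the category $\mathbf{Poly}_{\mathcal{E}}$. Composition product: $p\triangleleft q$ is the composite of projections $(\Pi_p(Q\times P_* )\times_P P_* )\times_Q Q_*\to\Pi_p(Q\times P_* )\times_P P_*\to\Pi_p(Q\times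 P_* )$, where $\Pi_p(Q\times P_* )\times_P P_*\to Q$ is the counit of $\Delta_p\dashv\Pi_p$ followed by projection. In terms of generalized elements, positions are pairs $(x\colon X\to P,\ f\colon X\times_PP_*\to Q)$ and a direction at $(x,f)$ is a pair $(y,z)$ with $y$ in $P_*$ over $x$ and $z$ in $Q_*$ over $f(y)$. On morphisms, $\phi\triangleleft\psi$ sends $(x,f)$ to $(\phi_1x,\psi_1\circ f\circ\phi^\sharp(x,-))$ and a direction $(y',z')$ there to $(\phi^\sharp(x,y'),\psi^\sharp(f(\phi^\sharp(x,y')),z'))$. For polynomials $p,q$ and a morphism $f\colon P\to Q$ in $\mathcal{E}$, the polynomial $p\overset{f}{\frown}q$ is the morphism $P_*\times_Q Q_*\to P\times_Q Q_*$ obtained by pulling back $p$ along the projection $P\times_QQ_*\to P$, where $P\times_Q Q_*$ is the pullback of $q$ along $f$. For $\gamma\colon p'\to p$ there is an induced morphism $p'\overset{f\circ\gamma_1}{\frown}q\to p\overset{f}{\frown}q$ given on positions by $\gamma_1\times_Q\mathrm{id}_{Q_*}$ and on directions by $\gamma^\sharp\times_Q\mathrm{id}_{Q_*}\colon(P'\times_PP_* )\times_QQ_*\to P'_*\times_QQ_*$. For $\phi\colon q\to q'$ cartesian there is a canonical isomorphism $p\overset{f}{\frown}q\cong p\overset{\phi_1\circ f}{\frown}q'$. *)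

theory Defs
  imports "HOL-Library.FuncSet"
begin

section \<open>Categories, functors, adjunctions\<close>

record ('o, 'm) cat =
  Obj :: "'o set"
  Arr :: "'m set"
  Dom :: "'m \<Rightarrow> 'o"
  Cod :: "'m \<Rightarrow> 'o"
  Idn :: "'o \<Rightarrow> 'm"
  Cmp :: "'m \<Rightarrow> 'm \<Rightarrow> 'm"  (infixr "\<cdot>\<index>" 70)

definition Hom :: "('o, 'm) cat \<Rightarrow> 'o \<Rightarrow> 'o \<Rightarrow> 'm set" where
  "Hom C A B = {f \<in> Arr C. Dom C f = A \<and> Cod C f = B}"

locale category =
  fixes C :: "('o, 'm) cat" (structure)
  assumes Dom_Obj: "f \<in> Arr C \<Longrightarrow> Dom C f \<in> Obj C"
    and Cod_Obj: "f \<in> Arr C \<Longrightarrow> Cod C f \<in> Obj C"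
    and Idn_Hom: "A \<in> Obj C \<Longrightarrow> Idn C A \<in> Hom C A A"
    and Cmp_Hom: "\<lbrakk>f \<in> Hom C A B; g \<in> Hom C B D\<rbrakk> \<Longrightarrow> g \<cdot> f \<in> Hom C A D"
    and Cmp_Idn: "f \<in> Hom C A B \<Longrightarrow> f \<cdot> Idn C A = f"
    and Idn_Cmp: "f \<in> Hom C A B \<Longrightarrow> Idn C B \<cdot> f = f"
    and Cmp_assoc: "\<lbrakk>f \<in> Hom C A B; g \<in> Hom C B D; h \<in> Hom C D E\<rbrakk>
      \<Longrightarrow> (h \<cdot> g) \<cdot> f = h \<cdot> (g \<cdot> f)"

definition inverse_arrows :: "('o, 'm) cat \<Rightarrow> 'm \<Rightarrow> 'm \<Rightarrow> bool" where
  "inverse_arrows C f g \<longleftrightarrow>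
     f \<in> Arr C \<and> g \<in> Hom C (Cod C f) (Dom C f) \<and>
     g \<cdot>\<^bsub>C\<^esub> f = Idn C (Dom C f) \<and> f \<cdot>\<^bsub>C\<^esub> g = Idn C (Cod C f)"

definition is_iso :: "('o, 'm) cat \<Rightarrow> 'm \<Rightarrow> bool" where
  "is_iso C f \<longleftrightarrow> (\<exists>g. inverse_arrows C f g)"

definition inv_arr :: "('o, 'm) cat \<Rightarrow> 'm \<Rightarrow> 'm" where
  "inv_arr C f = (THE g. inverse_arrows C f g)"

record ('o1, 'm1, 'o2, 'm2) ftor =
  FObj :: "'o1 \<Rightarrow> 'o2"
  FArr :: "'m1 \<Rightarrow> 'm2"

definition is_functor ::
  "('o1, 'm1) cat \<Rightarrow> ('o2, 'm2) cat \<Rightarrow> ('o1, 'm1, 'o2, 'm2) ftor \<Rightarrow> bool" where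
  "is_functor C D F \<longleftrightarrow>
     (\<forall>A \<in> Obj C. FObj F A \<in> Obj D) \<and>
     (\<forall>f \<in> Arr C. FArr F f \<in> Hom D (FObj F (Dom C f)) (FObj F (Cod C f))) \<and>
     (\<forall>A \<in> Obj C. FArr F (Idn C A) = Idn D (FObj F A)) \<and>
     (\<forall>f \<in> Arr C. \<forall>g \<in> Arr C. Cod C f = Dom C g \<longrightarrow>
        FArr F (g \<cdot>\<^bsub>C\<^esub> f) = FArr F g \<cdot>\<^bsub>D\<^esub> FArr F f)"

text \<open>\<open>F : C \<rightarrow> D\<close> is left adjoint to \<open>G : D \<rightarrow> C\<close> with unit \<open>\<eta> : 1 \<rightarrow> G F\<close> and
  counit \<open>\<epsilon> : F G \<rightarrow> 1\<close>.\<close>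

definition adjunction ::
  "('o1, 'm1) cat \<Rightarrow> ('o2, 'm2) cat \<Rightarrow> ('o1, 'm1, 'o2, 'm2) ftor \<Rightarrow> ('o2, 'm2, 'o1, 'm1) ftor \<Rightarrow>
   ('o1 \<Rightarrow> 'm1) \<Rightarrow> ('o2 \<Rightarrow> 'm2) \<Rightarrow> bool" where
  "adjunction C D F G \<eta> \<epsilon> \<longleftrightarrow>
     is_functor C D F \<and> is_functor D C G \<and>
     (\<forall>A \<in> Obj C. \<eta> A \<in> Hom C A (FObj G (FObj F A))) \<and>
     (\<forall>f \<in> Arr C. FArr G (FArr F f) \<cdot>\<^bsub>C\<^esub> \<eta> (Dom C f) = \<eta> (Cod C f) \<cdot>\<^bsub>C\<^esub> f) \<and>
     (\<forall>B \<in> Obj D. \<epsilon> B \<in> Hom D (FObj F (FObj G B)) B) \<and>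
     (\<forall>g \<in> Arr D. \<epsilon> (Cod D g) \<cdot>\<^bsub>D\<^esub> FArr F (FArr G g) = g \<cdot>\<^bsub>D\<^esub> \<epsilon> (Dom D g)) \<and>
     (\<forall>A \<in> Obj C. \<epsilon> (FObj F A) \<cdot>\<^bsub>D\<^esub> FArr F (\<eta> A) = Idn D (FObj F A)) \<and>
     (\<forall>B \<in> Obj D. FArr G (\<epsilon> B) \<cdot>\<^bsub>C\<^esub> \<eta> (FObj G B) = Idn C (FObj G B))"


section \<open>Finite limits, chosen products and pullbacks\<close>

definition is_cone ::
  "('j, 'k) cat \<Rightarrow> ('o, 'm) cat \<Rightarrow> ('j, 'k, 'o, 'm) ftor \<Rightarrow> 'o \<Rightarrow> ('j \<Rightarrow> 'm) \<Rightarrow> bool" where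
  "is_cone J C F X l \<longleftrightarrow>
     X \<in> Obj C \<and> (\<forall>j \<in> Obj J. l j \<in> Hom C X (FObj F j)) \<and>
     (\<forall>u \<in> Arr J. FArr F u \<cdot>\<^bsub>C\<^esub> l (Dom J u) = l (Cod J u))"

definition is_limit ::
  "('j, 'k) cat \<Rightarrow> ('o, 'm) cat \<Rightarrow> ('j, 'k, 'o, 'm) ftor \<Rightarrow> 'o \<Rightarrow> ('j \<Rightarrow> 'm) \<Rightarrow> bool" where
  "is_limit J C F X l \<longleftrightarrow>
     is_cone J C F X l \<and>
     (\<forall>Y l'. is_cone J C F Y l' \<longrightarrow>
        (\<exists>!h. h \<in> Hom C Y X \<and> (\<forall>j \<in> Obj J. l j \<cdot>\<^bsub>C\<^esub> h = l' j)))"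

text \<open>Every finite category is isomorphic to one whose objects and arrows are natural numbers,
  so it suffices to quantify over those.\<close>

definition has_finite_limits :: "('o, 'm) cat \<Rightarrow> bool" where
  "has_finite_limits C \<longleftrightarrow>
     (\<forall>(J :: (nat, nat) cat) F. category J \<longrightarrow> finite (Obj J) \<longrightarrow> finite (Arr J) \<longrightarrow>
        is_functor J C F \<longrightarrow> (\<exists>X l. is_limit J C F X l))"

definition is_product :: "('o, 'm) cat \<Rightarrow> 'o \<Rightarrow> 'o \<Rightarrow> 'm \<Rightarrow> 'm \<Rightarrow> bool" where
  "is_product C A B a b \<longleftrightarrow>
     a \<in> Hom C (Dom C a) A \<and> b \<in> Hom C (Dom C a) B \<and>
     (\<forall>u \<in> Arr C. \<forall>v \<in> Arr C. Dom C u = Dom C v \<and> Cod C u = A \<and> Cod C v = B \<longrightarrow>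
        (\<exists>!h. h \<in> Hom C (Dom C u) (Dom C a) \<and> a \<cdot>\<^bsub>C\<^esub> h = u \<and> b \<cdot>\<^bsub>C\<^esub> h = v))"

definition prod_fst :: "('o, 'm) cat \<Rightarrow> 'o \<Rightarrow> 'o \<Rightarrow> 'm" where
  "prod_fst C A B = fst (SOME ab. is_product C A B (fst ab) (snd ab))"

definition prod_snd :: "('o, 'm) cat \<Rightarrow> 'o \<Rightarrow> 'o \<Rightarrow> 'm" where
  "prod_snd C A B = snd (SOME ab. is_product C A B (fst ab) (snd ab))"

definition is_pullback :: "('o, 'm) cat \<Rightarrow> 'm \<Rightarrow> 'm \<Rightarrow> 'm \<Rightarrow> 'm \<Rightarrow> bool" where
  "is_pullback C f g a b \<longleftrightarrow>
     f \<in> Arr C \<and> g \<in> Arr C \<and> Cod C f = Cod C g \<and>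
     a \<in> Hom C (Dom C a) (Dom C f) \<and> b \<in> Hom C (Dom C a) (Dom C g) \<and>
     f \<cdot>\<^bsub>C\<^esub> a = g \<cdot>\<^bsub>C\<^esub> b \<and>
     (\<forall>u \<in> Arr C. \<forall>v \<in> Arr C.
        Dom C u = Dom C v \<and> Cod C u = Dom C f \<and> Cod C v = Dom C g \<and>
        f \<cdot>\<^bsub>C\<^esub> u = g \<cdot>\<^bsub>C\<^esub> v \<longrightarrow>
        (\<exists>!h. h \<in> Hom C (Dom C u) (Dom C a) \<and> a \<cdot>\<^bsub>C\<^esub> h = u \<and> b \<cdot>\<^bsub>C\<^esub> h = v))"

text \<open>For \<open>f : X \<rightarrow> A\<close> and \<open>g : Y \<rightarrow> A\<close>, the chosen pullback \<open>X \<times>\<^sub>A Y\<close> is given by its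
  projections \<open>pr1 C f g\<close> to \<open>X\<close> and \<open>pr2 C f g\<close> to \<open>Y\<close>; \<open>pair C f g u v\<close> is the arrow
  \<open>\<langle>u, v\<rangle>\<close> into it.\<close>

definition pr1 :: "('o, 'm) cat \<Rightarrow> 'm \<Rightarrow> 'm \<Rightarrow> 'm" where
  "pr1 C f g = fst (SOME ab. is_pullback C f g (fst ab) (snd ab))"

definition pr2 :: "('o, 'm) cat \<Rightarrow> 'm \<Rightarrow> 'm \<Rightarrow> 'm" where
  "pr2 C f g = snd (SOME ab. is_pullback C f g (fst ab) (snd ab))"

definition pair :: "('o, 'm) cat \<Rightarrow> 'm \<Rightarrow> 'm \<Rightarrow> 'm \<Rightarrow> 'm \<Rightarrow> 'm" where
  "pair C f g u v =
     (THE h. h \<in> Hom C (Dom C u) (Dom C (pr1 C f g)) \<and>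
        pr1 C f g \<cdot>\<^bsub>C\<^esub> h = u \<and> pr2 C f g \<cdot>\<^bsub>C\<^esub> h = v)"


section \<open>Slices and exponentiable arrows\<close>

text \<open>An arrow of the slice from \<open>x\<close> to \<open>y\<close> is a triple \<open>(x, y, h)\<close> with \<open>y \<cdot> h = x\<close>.\<close>

definition slice :: "('o, 'm) cat \<Rightarrow> 'o \<Rightarrow> ('m, 'm \<times> 'm \<times> 'm) cat" where
  "slice C A =
     \<lparr>Obj = {x \<in> Arr C. Cod C x = A},
      Arr = {(x, y, h). x \<in> Arr C \<and> Cod C x = A \<and> y \<in> Arr C \<and> Cod C y = A \<and>
               h \<in> Hom C (Dom C x) (Dom C y) \<and> y \<cdot>\<^bsub>C\<^esub> h = x},
      Dom = (\<lambda>(x, y, h). x),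
      Cod = (\<lambda>(x, y, h). y),
      Idn = (\<lambda>x. (x, x, Idn C (Dom C x))),
      Cmp = (\<lambda>(y, z, k) (x, y', h). (x, z, k \<cdot>\<^bsub>C\<^esub> h))\<rparr>"

text \<open>\<open>base_change C f x x' m\<close> is \<open>m \<times>\<^sub>A B : X \<times>\<^sub>A B \<rightarrow> X' \<times>\<^sub>A B\<close> for \<open>f : B \<rightarrow> A\<close> and an
  arrow \<open>m\<close> from \<open>x : X \<rightarrow> A\<close> to \<open>x' : X' \<rightarrow> A\<close> over \<open>A\<close>.\<close>

definition base_change :: "('o, 'm) cat \<Rightarrow> 'm \<Rightarrow> 'm \<Rightarrow> 'm \<Rightarrow> 'm \<Rightarrow> 'm" where
  "base_change C f x x' m = pair C x' f (m \<cdot>\<^bsub>C\<^esub> pr1 C x f) (pr2 C x f)"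

definition pb_functor ::
  "('o, 'm) cat \<Rightarrow> 'm \<Rightarrow> ('m, 'm \<times> 'm \<times> 'm, 'm, 'm \<times> 'm \<times> 'm) ftor" where
  "pb_functor C f =
     \<lparr>FObj = (\<lambda>x. pr2 C x f),
      FArr = (\<lambda>(x, x', m). (pr2 C x f, pr2 C x' f, base_change C f x x' m))\<rparr>"

definition exponentiable :: "('o, 'm) cat \<Rightarrow> 'm \<Rightarrow> bool" where
  "exponentiable C f \<longleftrightarrow>
     f \<in> Arr C \<and>
     (\<exists>G \<eta> \<epsilon>. adjunction (slice C (Cod C f)) (slice C (Dom C f)) (pb_functor C f) G \<eta> \<epsilon>)"

definition dep_prod_data ::
  "('o, 'm) cat \<Rightarrow> 'm \<Rightarrow> ('m, 'm \<times> 'm \<times> 'm, 'm, 'm \<times> 'm \<times> 'm) ftor \<times> ('m \<Rightarrow> 'm \<times> 'm \<times> 'm)" where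
  "dep_prod_data C f =
     (SOME G\<epsilon>. \<exists>\<eta>. adjunction (slice C (Cod C f)) (slice C (Dom C f)) (pb_functor C f)
                       (fst G\<epsilon>) \<eta> (snd G\<epsilon>))"

text \<open>The object part of \<open>\<Pi>\<^sub>f\<close>, and the underlying arrow of the counit
  \<open>\<Delta>\<^sub>f \<Pi>\<^sub>f y \<rightarrow> y\<close>.\<close>

definition dep_prod :: "('o, 'm) cat \<Rightarrow> 'm \<Rightarrow> 'm \<Rightarrow> 'm" where
  "dep_prod C f y = FObj (fst (dep_prod_data C f)) y"

definition dep_counit :: "('o, 'm) cat \<Rightarrow> 'm \<Rightarrow> 'm \<Rightarrow> 'm" where
  "dep_counit C f y = snd (snd (snd (dep_prod_data C f) y))"


section \<open>Polynomials\<close>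

text \<open>A polynomial is an exponentiable arrow \<open>p : P\<^sub>* \<rightarrow> P\<close>, so \<open>P\<close> is \<open>Cod C p\<close> and \<open>P\<^sub>*\<close>
  is \<open>Dom C p\<close>. A morphism \<open>\<phi>\<close> records its source and target, \<open>\<phi>\<^sub>1\<close> (\<open>Pos\<close>) and
  \<open>\<phi>\<^sup>\<sharp>\<close> (\<open>Dir\<close>).\<close>

record 'm pmor =
  Src :: 'm
  Tgt :: 'm
  Pos :: 'm
  Dir :: 'm

definition is_pmor :: "('o, 'm) cat \<Rightarrow> 'm pmor \<Rightarrow> bool" where
  "is_pmor C \<phi> \<longleftrightarrow>
     exponentiable C (Src \<phi>) \<and> exponentiable C (Tgt \<phi>) \<and>
     Pos \<phi> \<in> Hom C (Cod C (Src \<phi>)) (Cod C (Tgt \<phi>)) \<and>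
     Dir \<phi> \<in> Hom C (Dom C (pr1 C (Pos \<phi>) (Tgt \<phi>))) (Dom C (Src \<phi>)) \<and>
     Src \<phi> \<cdot>\<^bsub>C\<^esub> Dir \<phi> = pr1 C (Pos \<phi>) (Tgt \<phi>)"

text \<open>For \<open>\<phi> : p \<rightarrow> q\<close> and \<open>x : X \<rightarrow> P\<close>, the arrow
  \<open>reindex C \<phi> x : X \<times>\<^sub>Q Q\<^sub>* \<rightarrow> X \<times>\<^sub>P P\<^sub>*\<close> (pullbacks along \<open>\<phi>\<^sub>1 x\<close> and \<open>x\<close>) is
  \<open>(a, d) \<mapsto> (a, \<phi>\<^sup>\<sharp>(x a, d))\<close>, that is \<open>X \<times>\<^sub>P \<phi>\<^sup>\<sharp>\<close> up to \<open>X \<times>\<^sub>Q Q\<^sub>* \<cong> X \<times>\<^sub>P (P \<times>\<^sub>Q Q\<^sub>*)\<close>.\<close>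

definition reindex :: "('o, 'm) cat \<Rightarrow> 'm pmor \<Rightarrow> 'm \<Rightarrow> 'm" where
  "reindex C \<phi> x =
     (let y = Pos \<phi> \<cdot>\<^bsub>C\<^esub> x; q = Tgt \<phi> in
      pair C x (Src \<phi>) (pr1 C y q)
        (Dir \<phi> \<cdot>\<^bsub>C\<^esub> pair C (Pos \<phi>) q (x \<cdot>\<^bsub>C\<^esub> pr1 C y q) (pr2 C y q)))"

definition Poly :: "('o, 'm) cat \<Rightarrow> ('m, 'm pmor) cat" where
  "Poly C =
     \<lparr>Obj = {p. exponentiable C p},
      Arr = {\<phi>. is_pmor C \<phi>},
      Dom = Src,
      Cod = Tgt,
      Idn = (\<lambda>p. \<lparr>Src = p, Tgt = p, Pos = Idn C (Cod C p), Dir = pr2 C (Idn C (Cod C p)) p\<rparr>),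
      Cmp = (\<lambda>\<psi> \<phi>. \<lparr>Src = Src \<phi>, Tgt = Tgt \<psi>, Pos = Pos \<psi> \<cdot>\<^bsub>C\<^esub> Pos \<phi>,
                     Dir = Dir \<phi> \<cdot>\<^bsub>C\<^esub> reindex C \<psi> (Pos \<phi>)\<rparr>)\<rparr>"

definition cartesian :: "('o, 'm) cat \<Rightarrow> 'm pmor \<Rightarrow> bool" where
  "cartesian C \<phi> \<longleftrightarrow> is_pmor C \<phi> \<and> is_iso C (Dir \<phi>)"


section \<open>The composition product\<close>

text \<open>\<open>tri_base C p q\<close> is the structure arrow \<open>\<Pi>\<^sub>p(Q \<times> P\<^sub>*) \<rightarrow> P\<close>, and \<open>tri_ev C p q\<close> is the
  evaluation \<open>\<Pi>\<^sub>p(Q \<times> P\<^sub>*) \<times>\<^sub>P P\<^sub>* \<rightarrow> Q\<close>.\<close>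

definition tri_base :: "('o, 'm) cat \<Rightarrow> 'm \<Rightarrow> 'm \<Rightarrow> 'm" where
  "tri_base C p q = dep_prod C p (prod_snd C (Cod C q) (Dom C p))"

definition tri_ev :: "('o, 'm) cat \<Rightarrow> 'm \<Rightarrow> 'm \<Rightarrow> 'm" where
  "tri_ev C p q =
     prod_fst C (Cod C q) (Dom C p) \<cdot>\<^bsub>C\<^esub> dep_counit C p (prod_snd C (Cod C q) (Dom C p))"

definition tri :: "('o, 'm) cat \<Rightarrow> 'm \<Rightarrow> 'm \<Rightarrow> 'm" where
  "tri C p q = pr1 C (tri_base C p q) p \<cdot>\<^bsub>C\<^esub> pr1 C (tri_ev C p q) q"

text \<open>The position of \<open>p \<triangleleft> q\<close>, i.e. the arrow \<open>X \<rightarrow> \<Pi>\<^sub>p(Q \<times> P\<^sub>*)\<close>, corresponding to the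
  generalized element \<open>(x : X \<rightarrow> P, f : X \<times>\<^sub>P P\<^sub>* \<rightarrow> Q)\<close>.\<close>

definition tri_elem :: "('o, 'm) cat \<Rightarrow> 'm \<Rightarrow> 'm \<Rightarrow> 'm \<Rightarrow> 'm \<Rightarrow> 'm" where
  "tri_elem C p q x f =
     (THE m. m \<in> Hom C (Dom C x) (Dom C (tri_base C p q)) \<and>
        tri_base C p q \<cdot>\<^bsub>C\<^esub> m = x \<and>
        tri_ev C p q \<cdot>\<^bsub>C\<^esub> base_change C p x (tri_base C p q) m = f)"

text \<open>The generalized-element formula for \<open>\<phi> \<triangleleft> \<psi> : p \<triangleleft> q \<rightarrow> p' \<triangleleft> q'\<close>, read at the generic
  position \<open>(x, f) = (tri_base C p q, tri_ev C p q)\<close> and the generic direction \<open>(y', z')\<close> at its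
  image \<open>m\<close>. Here \<open>a\<close> is the generic position and \<open>k\<close> is \<open>\<phi>\<^sup>\<sharp>(x, y')\<close> paired with \<open>a\<close>,
  so that \<open>f \<cdot> k\<close> is \<open>f(\<phi>\<^sup>\<sharp>(x, y'))\<close>.\<close>

definition tri_mor :: "('o, 'm) cat \<Rightarrow> 'm pmor \<Rightarrow> 'm pmor \<Rightarrow> 'm pmor" where
  "tri_mor C \<phi> \<psi> =
     (let p = Src \<phi>; p' = Tgt \<phi>; q = Src \<psi>; q' = Tgt \<psi>;
          x = tri_base C p q; f = tri_ev C p q;
          m = tri_elem C p' q' (Pos \<phi> \<cdot>\<^bsub>C\<^esub> x) (Pos \<psi> \<cdot>\<^bsub>C\<^esub> f \<cdot>\<^bsub>C\<^esub> reindex C \<phi> x);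
          a = pr1 C m (tri C p' q');
          d = pr2 C m (tri C p' q');
          y' = pr2 C (tri_base C p' q') p' \<cdot>\<^bsub>C\<^esub> pr1 C (tri_ev C p' q') q' \<cdot>\<^bsub>C\<^esub> d;
          z' = pr2 C (tri_ev C p' q') q' \<cdot>\<^bsub>C\<^esub> d;
          k = reindex C \<phi> x \<cdot>\<^bsub>C\<^esub> pair C (Pos \<phi> \<cdot>\<^bsub>C\<^esub> x) p' a y';
          z = Dir \<psi> \<cdot>\<^bsub>C\<^esub> pair C (Pos \<psi>) q' (f \<cdot>\<^bsub>C\<^esub> k) z'
      in \<lparr>Src = tri C p q, Tgt = tri C p' q', Pos = m, Dir = pair C f q k z\<rparr>)"


section \<open>The operation \<open>\<frown>\<close>\<close>

text \<open>The pullback of \<open>p\<close> along the projection \<open>P \<times>\<^sub>Q Q\<^sub>* \<rightarrow> P\<close>. Its domain is the chosen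
  pullback \<open>(P \<times>\<^sub>Q Q\<^sub>*) \<times>\<^sub>P P\<^sub>*\<close>, which is \<open>P\<^sub>* \<times>\<^sub>Q Q\<^sub>*\<close> up to canonical isomorphism.\<close>

definition frown :: "('o, 'm) cat \<Rightarrow> 'm \<Rightarrow> 'm \<Rightarrow> 'm \<Rightarrow> 'm" where
  "frown C p f q = pr1 C (pr1 C f q) p"

text \<open>For \<open>\<gamma> : p' \<rightarrow> p\<close>, the induced morphism from \<open>frown C p' (f \<gamma>\<^sub>1) q\<close> to \<open>frown C p f q\<close>:
  \<open>(x', z) \<mapsto> (\<gamma>\<^sub>1 x', z)\<close> on positions and \<open>(x', z), y \<mapsto> (x', z), \<gamma>\<^sup>\<sharp>(x', y)\<close> on directions.\<close>

definition frown_map :: "('o, 'm) cat \<Rightarrow> 'm pmor \<Rightarrow> 'm \<Rightarrow> 'm \<Rightarrow> 'm pmor" where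
  "frown_map C \<gamma> f q =
     (let p' = Src \<gamma>; p = Tgt \<gamma>; f' = f \<cdot>\<^bsub>C\<^esub> Pos \<gamma>;
          g = pair C f q (Pos \<gamma> \<cdot>\<^bsub>C\<^esub> pr1 C f' q) (pr2 C f' q);
          a = pr1 C g (frown C p f q);
          y = pr2 C (pr1 C f q) p \<cdot>\<^bsub>C\<^esub> pr2 C g (frown C p f q)
      in \<lparr>Src = frown C p' f' q, Tgt = frown C p f q, Pos = g,
          Dir = pair C (pr1 C f' q) p' a
                  (Dir \<gamma> \<cdot>\<^bsub>C\<^esub> pair C (Pos \<gamma>) p (pr1 C f' q \<cdot>\<^bsub>C\<^esub> a) y)\<rparr>)"

text \<open>For \<open>\<phi> : q \<rightarrow> q'\<close> cartesian, the canonical isomorphism from \<open>frown C p f q\<close> to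
  \<open>frown C p (\<phi>\<^sub>1 f) q'\<close>: it sends a position \<open>(x, z)\<close> to \<open>(x, z')\<close> with
  \<open>\<phi>\<^sup>\<sharp>(f x, z') = z\<close>, and is the identity on the \<open>P\<^sub>*\<close>-component of directions.\<close>

definition frown_can :: "('o, 'm) cat \<Rightarrow> 'm \<Rightarrow> 'm \<Rightarrow> 'm pmor \<Rightarrow> 'm pmor" where
  "frown_can C p f \<phi> =
     (let q = Src \<phi>; q' = Tgt \<phi>; f' = Pos \<phi> \<cdot>\<^bsub>C\<^esub> f;
          g = pair C f' q' (pr1 C f q)
                (pr2 C (Pos \<phi>) q' \<cdot>\<^bsub>C\<^esub> inv_arr C (Dir \<phi>) \<cdot>\<^bsub>C\<^esub> pr2 C f q)
      in \<lparr>Src = frown C p f q, Tgt = frown C p f' q', Pos = g,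
          Dir = pair C (pr1 C f q) p (pr1 C g (frown C p f' q'))
                  (pr2 C (pr1 C f' q') p \<cdot>\<^bsub>C\<^esub> pr2 C g (frown C p f' q'))\<rparr>)"


section \<open>The two sides of the coclosure bijection\<close>

definition tri_hom :: "('o, 'm) cat \<Rightarrow> 'm \<Rightarrow> 'm \<Rightarrow> 'm \<Rightarrow> 'm pmor set" where
  "tri_hom C p q r = Hom (Poly C) p (tri C q r)"

definition frown_hom :: "('o, 'm) cat \<Rightarrow> 'm \<Rightarrow> 'm \<Rightarrow> 'm \<Rightarrow> ('m \<times> 'm pmor) set" where
  "frown_hom C p q r = (SIGMA f : Hom C (Cod C p) (Cod C q). Hom (Poly C) (frown C p f q) r)"

definition square ::
  "'x set \<Rightarrow> 'x set \<Rightarrow> 'y set \<Rightarrow> 'y set \<Rightarrow> ('x \<Rightarrow> 'x) \<Rightarrow> ('y \<Rightarrow> 'y) \<Rightarrow>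
   ('x \<Rightarrow> 'y) \<Rightarrow> ('x \<Rightarrow> 'y) \<Rightarrow> bool" where
  "square S S' T T' u v \<theta> \<theta>' \<longleftrightarrow>
     u \<in> S \<rightarrow> S' \<and> v \<in> T \<rightarrow> T' \<and> (\<forall>s \<in> S. \<theta>' (u s) = v (\<theta> s))"

end

theory Submission
  imports Defs
begin

text \<open>On generalized elements, a morphism \<open>\<phi> : p \<rightarrow> q \<triangleleft> r\<close> consists of \<open>f : P \<rightarrow> Q\<close> and
  \<open>g : P \<times>\<^sub>Q Q\<^sub>* \<rightarrow> R\<close>, together making up \<open>\<phi>\<^sub>1 a = (f a, g (a, -))\<close>, and of an assignment
  \<open>(a, z, w) \<mapsto> \<phi>\<^sup>\<sharp> (a, (z, w))\<close> of directions of \<open>p\<close> at \<open>a\<close>. The pair of \<open>g\<close> and this assignment is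
  exactly a morphism \<open>frown C p f q \<rightarrow> r\<close>. All three naturality squares are then checked on
  generalized elements, which hides the chosen pullbacks; the square for \<open>q\<close> needs in addition
  the explicit inverse of \<^const>\<open>frown_can\<close>. That \<open>q \<triangleleft> r\<close> and \<open>frown C p f q\<close> are polynomials is the closure of
  exponentiable arrows under composition and pullback.\<close>

section \<open>Categories and universal arrows\<close>

text \<open>Chosen products, pullbacks and dependent products come from \<open>SOME\<close>, so only
  their universal properties are available. Each is therefore turned into two rules on generalized
  elements: a computation rule (evaluating the arrow classified by given data returns the data) and
  an extensionality rule (arrows with equal evaluations are equal). For \<Pi> these rules must be
  extracted from an adjunction between slices. Since exponentiability asks for a whole right
  adjoint, closure under composition and pullback would also require building functors; instead it
  is shown equivalent to having one universal arrow for each object of the slice.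

  The bijection is not given by a formula. A relation \<open>corr\<close> is shown to be total and
  single-valued in both directions, and \<open>transpose\<close> is its description. A naturality
  square then reduces to the claim that its two vertical maps preserve \<open>corr\<close>, so that
  no transpose is ever computed.\<close>

context category
begin

lemma HomD: "f \<in> Hom C A B \<Longrightarrow> f \<in> Arr C \<and> Dom C f = A \<and> Cod C f = B"
  by (simp add: Hom_def)

lemma Dom_in_Obj [simp]: "f \<in> Arr C \<Longrightarrow> Dom C f \<in> Obj C"
  and Cod_in_Obj [simp]: "f \<in> Arr C \<Longrightarrow> Cod C f \<in> Obj C"
  by (fact Dom_Obj Cod_Obj)+

lemma Idn_simps [simp]:
  assumes "A \<in> Obj C"
  shows "Idn C A \<in> Arr C" "Dom C (Idn C A) = A" "Cod C (Idn C A) = A"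
  using Idn_Hom [OF assms] by (simp_all add: Hom_def)

lemma Cmp_simps [simp]:
  assumes "f \<in> Arr C" "g \<in> Arr C" "Cod C f = Dom C g"
  shows "g \<cdot> f \<in> Arr C" "Dom C (g \<cdot> f) = Dom C f" "Cod C (g \<cdot> f) = Cod C g"
  using Cmp_Hom [of f "Dom C f" "Cod C f" g "Cod C g"] assms by (simp_all add: Hom_def)

lemma Cmp_Idn_simp [simp]: "\<lbrakk>f \<in> Arr C; Dom C f = A\<rbrakk> \<Longrightarrow> f \<cdot> Idn C A = f"
  using Cmp_Idn by (auto simp: Hom_def)

lemma Idn_Cmp_simp [simp]: "\<lbrakk>f \<in> Arr C; Cod C f = A\<rbrakk> \<Longrightarrow> Idn C A \<cdot> f = f"
  using Idn_Cmp by (auto simp: Hom_def)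

lemma assoc [simp]:
  "\<lbrakk>f \<in> Arr C; g \<in> Arr C; h \<in> Arr C; Cod C f = Dom C g; Cod C g = Dom C h\<rbrakk>
    \<Longrightarrow> (h \<cdot> g) \<cdot> f = h \<cdot> g \<cdot> f"
  using Cmp_assoc [of f "Dom C f" "Cod C f" g "Cod C g" h "Cod C h"] by (simp add: Hom_def)

text \<open>If \<open>g\<close> and \<open>g'\<close> both invert \<open>f\<close>, then
  \<open>g' = (g \<cdot> f) \<cdot> g' = g \<cdot> (f \<cdot> g') = g\<close>. Hence the definite
  description \<open>inv_arr\<close> is settled by exhibiting any inverse.\<close>

lemma inv_arr_eqI:
  assumes "inverse_arrows C f g"
  shows "inv_arr C f = g"
  unfolding inv_arr_def
proof (rule the_equality)
  fix g' assume *: "inverse_arrows C f g'"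
  then have "(g \<cdot> f) \<cdot> g' = g \<cdot> f \<cdot> g'"
    using assms by (intro assoc) (auto simp: inverse_arrows_def Hom_def)
  then show "g' = g"
    using assms * by (auto simp: inverse_arrows_def Hom_def)
qed (fact assms)

end

section \<open>Functors, and right adjoints through universal arrows\<close>

lemma functorD:
  assumes "is_functor C D F"
  shows "A \<in> Obj C \<Longrightarrow> FObj F A \<in> Obj D"
    and "f \<in> Arr C \<Longrightarrow> FArr F f \<in> Arr D"
    and "f \<in> Arr C \<Longrightarrow> Dom D (FArr F f) = FObj F (Dom C f)"
    and "f \<in> Arr C \<Longrightarrow> Cod D (FArr F f) = FObj F (Cod C f)"
    and "A \<in> Obj C \<Longrightarrow> FArr F (Idn C A) = Idn D (FObj F A)"
    and "f \<in> Arr C \<Longrightarrow> g \<in> Arr C \<Longrightarrow> Cod C f = Dom C g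
      \<Longrightarrow> FArr F (g \<cdot>\<^bsub>C\<^esub> f) = FArr F g \<cdot>\<^bsub>D\<^esub> FArr F f"
  using assms by (auto simp: is_functor_def Hom_def)

text \<open>That is, a terminal object of the comma category of \<open>F\<close> over
  \<open>B\<close>. Unlike an adjunction, the notion concerns one object \<open>B\<close> and no
  functor in the other direction.\<close>

definition couniversal ::
  "('o1, 'm1) cat \<Rightarrow> ('o2, 'm2) cat \<Rightarrow> ('o1, 'm1, 'o2, 'm2) ftor \<Rightarrow> 'o2 \<Rightarrow> 'o1 \<Rightarrow> 'm2 \<Rightarrow> bool" where
  "couniversal C D F B Z e \<longleftrightarrow>
     Z \<in> Obj C \<and> e \<in> Hom D (FObj F Z) B \<and>
     (\<forall>A \<in> Obj C. \<forall>k \<in> Hom D (FObj F A) B. \<exists>!m. m \<in> Hom C A Z \<and> e \<cdot>\<^bsub>D\<^esub> FArr F m = k)"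

text \<open>The transpose of \<open>k\<close> is \<open>G k\<close> after \<eta>. It solves the
  equation by naturality of \<epsilon> and the triangle identity at \<open>F A\<close>; it is the
  only solution by naturality of \<eta> and the triangle identity at \<open>G B\<close>.\<close>

lemma couniversal_counit:
  assumes "category C" "category D" and adj: "adjunction C D F G \<eta> \<epsilon>" and B: "B \<in> Obj D"
  shows "couniversal C D F B (FObj G B) (\<epsilon> B)"
  unfolding couniversal_def
proof (intro conjI ballI)
  interpret C: category C by fact
  interpret D: category D by fact
  have F: "is_functor C D F" and G: "is_functor D C G"
    and \<eta>: "\<And>A. A \<in> Obj C \<Longrightarrow> \<eta> A \<in> Hom C A (FObj G (FObj F A))"
    and \<eta>_nat: "\<And>f. f \<in> Arr C \<Longrightarrow>
        FArr G (FArr F f) \<cdot>\<^bsub>C\<^esub> \<eta> (Dom C f) = \<eta> (Cod C f) \<cdot>\<^bsub>C\<^esub> f"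
    and \<epsilon>: "\<And>B. B \<in> Obj D \<Longrightarrow> \<epsilon> B \<in> Hom D (FObj F (FObj G B)) B"
    and \<epsilon>_nat: "\<And>g. g \<in> Arr D \<Longrightarrow>
        \<epsilon> (Cod D g) \<cdot>\<^bsub>D\<^esub> FArr F (FArr G g) = g \<cdot>\<^bsub>D\<^esub> \<epsilon> (Dom D g)"
    and tri1: "\<And>A. A \<in> Obj C \<Longrightarrow> \<epsilon> (FObj F A) \<cdot>\<^bsub>D\<^esub> FArr F (\<eta> A) = Idn D (FObj F A)"
    and tri2: "\<And>B. B \<in> Obj D \<Longrightarrow> FArr G (\<epsilon> B) \<cdot>\<^bsub>C\<^esub> \<eta> (FObj G B) = Idn C (FObj G B)"
    using adj unfolding adjunction_def by blast+
  note [simp] = functorD [OF F] functorD [OF G]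
  note \<eta>' [simp] = \<eta> [THEN C.HomD, THEN conjunct1] \<eta> [THEN C.HomD, THEN conjunct2, THEN conjunct1]
     \<eta> [THEN C.HomD, THEN conjunct2, THEN conjunct2]
  note \<epsilon>' [simp] = \<epsilon> [THEN D.HomD, THEN conjunct1] \<epsilon> [THEN D.HomD, THEN conjunct2, THEN conjunct1]
     \<epsilon> [THEN D.HomD, THEN conjunct2, THEN conjunct2]
  show "FObj G B \<in> Obj C" "\<epsilon> B \<in> Hom D (FObj F (FObj G B)) B"
    using B \<epsilon> by simp_all
  fix A k assume A: "A \<in> Obj C" and "k \<in> Hom D (FObj F A) B"
  then have k [simp]: "k \<in> Arr D" "Dom D k = FObj F A" "Cod D k = B"
    by (simp_all add: Hom_def)
  note [simp] = A B
  show "\<exists>!m. m \<in> Hom C A (FObj G B) \<and> \<epsilon> B \<cdot>\<^bsub>D\<^esub> FArr F m = k"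
  proof (rule ex1I [of _ "FArr G k \<cdot>\<^bsub>C\<^esub> \<eta> A"], intro conjI)
    show "FArr G k \<cdot>\<^bsub>C\<^esub> \<eta> A \<in> Hom C A (FObj G B)" by (simp add: Hom_def)
    have "\<epsilon> B \<cdot>\<^bsub>D\<^esub> FArr F (FArr G k \<cdot>\<^bsub>C\<^esub> \<eta> A)
        = (\<epsilon> (Cod D k) \<cdot>\<^bsub>D\<^esub> FArr F (FArr G k)) \<cdot>\<^bsub>D\<^esub> FArr F (\<eta> A)" by simp
    also have "\<dots> = k \<cdot>\<^bsub>D\<^esub> \<epsilon> (FObj F A) \<cdot>\<^bsub>D\<^esub> FArr F (\<eta> A)"
      by (subst \<epsilon>_nat) simp_all
    also have "\<dots> = k" by (simp add: tri1)
    finally show "\<epsilon> B \<cdot>\<^bsub>D\<^esub> FArr F (FArr G k \<cdot>\<^bsub>C\<^esub> \<eta> A) = k" .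
  next
    fix m assume "m \<in> Hom C A (FObj G B) \<and> \<epsilon> B \<cdot>\<^bsub>D\<^esub> FArr F m = k"
    then have m [simp]: "m \<in> Arr C" "Dom C m = A" "Cod C m = FObj G B"
      and k: "k = \<epsilon> B \<cdot>\<^bsub>D\<^esub> FArr F m" by (auto simp: Hom_def)
    have "FArr G k \<cdot>\<^bsub>C\<^esub> \<eta> A = FArr G (\<epsilon> B) \<cdot>\<^bsub>C\<^esub> FArr G (FArr F m) \<cdot>\<^bsub>C\<^esub> \<eta> A"
      by (simp add: k)
    also have "\<dots> = (FArr G (\<epsilon> B) \<cdot>\<^bsub>C\<^esub> \<eta> (FObj G B)) \<cdot>\<^bsub>C\<^esub> m"
      using \<eta>_nat [of m] by simp
    also have "\<dots> = m" by (simp add: tri2 del: C.assoc)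
    finally show "m = FArr G k \<cdot>\<^bsub>C\<^esub> \<eta> A" by simp
  qed
qed

text \<open>Universal arrows are chosen for all \<open>B\<close> at once. \<open>G\<close> sends an
  arrow \<open>g\<close> to the transpose of \<open>g\<close> after \<epsilon>, and \<eta> is the
  transpose of an identity.\<close>

lemma adjunction_of_couniversal:
  assumes "category C" "category D" and F: "is_functor C D F"
    and univ: "\<And>B. B \<in> Obj D \<Longrightarrow> \<exists>Z e. couniversal C D F B Z e"
  shows "\<exists>G \<eta> \<epsilon>. adjunction C D F G \<eta> \<epsilon>"
proof -
  interpret C: category C by fact
  interpret D: category D by fact
  obtain Z \<epsilon> where univ: "\<And>B. B \<in> Obj D \<Longrightarrow> couniversal C D F B (Z B) (\<epsilon> B)"
    using univ by metis
  define tr where "tr A B k = (THE m. m \<in> Hom C A (Z B) \<and> \<epsilon> B \<cdot>\<^bsub>D\<^esub> FArr F m = k)" for A B k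
  have tr: "tr A B k \<in> Hom C A (Z B) \<and> \<epsilon> B \<cdot>\<^bsub>D\<^esub> FArr F (tr A B k) = k"
    if "A \<in> Obj C" "B \<in> Obj D" "k \<in> Arr D" "Dom D k = FObj F A" "Cod D k = B" for A B k
    unfolding tr_def by (rule theI') (use univ [OF that(2)] that in \<open>auto simp: couniversal_def Hom_def\<close>)
  note tr' = tr [THEN conjunct1, THEN C.HomD, THEN conjunct1]
    tr [THEN conjunct1, THEN C.HomD, THEN conjunct2, THEN conjunct1]
    tr [THEN conjunct1, THEN C.HomD, THEN conjunct2, THEN conjunct2]
    tr [THEN conjunct2]
  note [simp] = functorD [OF F] tr'
  have \<epsilon> [simp]: "Z B \<in> Obj C" "\<epsilon> B \<in> Arr D" "Dom D (\<epsilon> B) = FObj F (Z B)" "Cod D (\<epsilon> B) = B"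
    if "B \<in> Obj D" for B using univ [OF that] by (auto simp: couniversal_def Hom_def)
  have tr_Cmp: "\<epsilon> B \<cdot>\<^bsub>D\<^esub> FArr F (tr A B k) \<cdot>\<^bsub>D\<^esub> u = k \<cdot>\<^bsub>D\<^esub> u"
    if "A \<in> Obj C" "B \<in> Obj D" "k \<in> Arr D" "Dom D k = FObj F A" "Cod D k = B"
      "u \<in> Arr D" "Cod D u = FObj F A" for A B k u
  proof -
    have "k \<cdot>\<^bsub>D\<^esub> u = (\<epsilon> B \<cdot>\<^bsub>D\<^esub> FArr F (tr A B k)) \<cdot>\<^bsub>D\<^esub> u" using that by simp
    then show ?thesis using that by (simp del: tr'(4))
  qed
  \<comment> \<open>Composition with \<open>\<epsilon> B\<close> is injective on arrows into
    \<open>Z B\<close>. The functor laws of \<open>G\<close>, naturality of \<eta> and the triangle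
    identity at \<open>G B\<close> are all verified after this composition.\<close>
  have eqI: "m = m'" if "B \<in> Obj D" "m \<in> Arr C" "m' \<in> Arr C" "Dom C m = Dom C m'"
    "Cod C m = Z B" "Cod C m' = Z B" "\<epsilon> B \<cdot>\<^bsub>D\<^esub> FArr F m = \<epsilon> B \<cdot>\<^bsub>D\<^esub> FArr F m'" for m m' B
  proof -
    have "\<epsilon> B \<cdot>\<^bsub>D\<^esub> FArr F m' \<in> Hom D (FObj F (Dom C m')) B" using that by (simp add: Hom_def)
    then have "\<exists>!n. n \<in> Hom C (Dom C m') (Z B) \<and> \<epsilon> B \<cdot>\<^bsub>D\<^esub> FArr F n = \<epsilon> B \<cdot>\<^bsub>D\<^esub> FArr F m'"
      using univ [OF that(1)] that by (simp add: couniversal_def)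
    moreover have "m \<in> Hom C (Dom C m') (Z B)" "m' \<in> Hom C (Dom C m') (Z B)"
      using that by (simp_all add: Hom_def)
    ultimately show ?thesis using that(7) by auto
  qed
  define G where "G = \<lparr>FObj = Z, FArr = (\<lambda>g. tr (Z (Dom D g)) (Cod D g) (g \<cdot>\<^bsub>D\<^esub> \<epsilon> (Dom D g)))\<rparr>"
  define \<eta> where "\<eta> A = tr A (FObj F A) (Idn D (FObj F A))" for A
  have "adjunction C D F G \<eta> \<epsilon>"
    unfolding adjunction_def
  proof (intro conjI ballI)
    show "is_functor D C G"
      unfolding is_functor_def
    proof (intro conjI ballI impI)
      fix B assume "B \<in> Obj D"
      then show "FObj G B \<in> Obj C" "FArr G (Idn D B) = Idn C (FObj G B)"
        by (auto simp: G_def intro: eqI)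
    next
      fix f assume "f \<in> Arr D"
      then show "FArr G f \<in> Hom C (FObj G (Dom D f)) (FObj G (Cod D f))"
        by (simp add: Hom_def G_def)
      fix g assume "g \<in> Arr D" "Cod D f = Dom D g"
      with \<open>f \<in> Arr D\<close> show "FArr G (g \<cdot>\<^bsub>D\<^esub> f) = FArr G g \<cdot>\<^bsub>C\<^esub> FArr G f"
        by (intro eqI [of "Cod D g"]) (simp_all add: G_def tr_Cmp)
    qed
  next
    fix f assume "f \<in> Arr C"
    then show "FArr G (FArr F f) \<cdot>\<^bsub>C\<^esub> \<eta> (Dom C f) = \<eta> (Cod C f) \<cdot>\<^bsub>C\<^esub> f"
      by (intro eqI [of "FObj F (Cod C f)"]) (simp_all add: G_def \<eta>_def tr_Cmp)
  next
    fix B assume "B \<in> Obj D"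
    then show "FArr G (\<epsilon> B) \<cdot>\<^bsub>C\<^esub> \<eta> (FObj G B) = Idn C (FObj G B)"
      by (intro eqI [of B]) (simp_all add: G_def \<eta>_def tr_Cmp)
  qed (use F in \<open>simp_all add: G_def \<eta>_def Hom_def\<close>)
  then show ?thesis by blast
qed

section \<open>Pullbacks\<close>

locale finlim = category +
  assumes limits: "has_finite_limits C"
begin

lemma is_product_ex:
  assumes A: "A \<in> Obj C" and B: "B \<in> Obj C"
  shows "\<exists>a b. is_product C A B a b"
proof -
  \<comment> \<open>The discrete category on two objects.\<close>
  define J :: "(nat, nat) cat" where
    "J = \<lparr>Obj = {0, 1}, Arr = {0, 1}, Dom = id, Cod = id, Idn = id, Cmp = (\<lambda>g f. f)\<rparr>"
  define F :: "(nat, nat, 'a, 'b) ftor" where "F = \<lparr>FObj = (\<lambda>j. if j = 0 then A else B),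
    FArr = (\<lambda>j. Idn C (if j = 0 then A else B))\<rparr>"
  have fin: "finite (Obj J)" "finite (Arr J)" by (simp_all add: J_def)
  have J: "category J" by unfold_locales (auto simp: J_def Hom_def)
  have F: "is_functor J C F" using A B by (auto simp: is_functor_def J_def F_def Hom_def)
  have cone: "is_cone J C F X l \<longleftrightarrow> l 0 \<in> Hom C X A \<and> l 1 \<in> Hom C X B" for X l
    by (auto simp: is_cone_def J_def F_def Hom_def)
  obtain X l where l: "is_limit J C F X l"
    using limits J F fin unfolding has_finite_limits_def by blast
  have "is_product C A B (l 0) (l 1)"
    unfolding is_product_def
  proof (intro conjI ballI impI)
    show "l 0 \<in> Hom C (Dom C (l 0)) A" "l 1 \<in> Hom C (Dom C (l 0)) B"
      using l by (simp_all add: is_limit_def cone Hom_def)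
    fix u v assume "u \<in> Arr C" "v \<in> Arr C" "Dom C u = Dom C v \<and> Cod C u = A \<and> Cod C v = B"
    then have "is_cone J C F (Dom C u) (\<lambda>j. if j = 0 then u else v)"
      by (simp add: cone Hom_def)
    then have "\<exists>!h. h \<in> Hom C (Dom C u) X \<and> (\<forall>j \<in> Obj J. l j \<cdot> h = (if j = 0 then u else v))"
      using l unfolding is_limit_def by blast
    moreover have "Dom C (l 0) = X" using l by (simp add: is_limit_def cone Hom_def)
    ultimately show "\<exists>!h. h \<in> Hom C (Dom C u) (Dom C (l 0)) \<and> l 0 \<cdot> h = u \<and> l 1 \<cdot> h = v"
      by (simp add: J_def)
  qed
  then show ?thesis by blast
qed

lemma is_pullback_ex:
  assumes f: "f \<in> Arr C" and g: "g \<in> Arr C" and fg: "Cod C f = Cod C g"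
  shows "\<exists>a b. is_pullback C f g a b"
proof -
  \<comment> \<open>The cospan \<open>0 -> 2 <- 1\<close>: arrows \<open>0\<close>,
    \<open>1\<close>, \<open>2\<close> are identities, \<open>3\<close> and \<open>4\<close> are the
    two legs. In a composable pair at most one arrow is not an identity, and \<open>Cmp\<close>
    returns that one.\<close>
  define J :: "(nat, nat) cat" where
    "J = \<lparr>Obj = {0, 1, 2}, Arr = {0, 1, 2, 3, 4},
      Dom = (\<lambda>j. if j = 3 then 0 else if j = 4 then 1 else j),
      Cod = (\<lambda>j. if j = 3 \<or> j = 4 then 2 else j), Idn = id,
      Cmp = (\<lambda>j i. if i = 3 \<or> i = 4 then i else j)\<rparr>"
  define F :: "(nat, nat, 'a, 'b) ftor" where
    "F = \<lparr>FObj = (\<lambda>j. if j = 0 then Dom C f else if j = 1 then Dom C g else Cod C f),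
    FArr = (\<lambda>j. if j = 0 then Idn C (Dom C f) else if j = 1 then Idn C (Dom C g)
      else if j = 2 then Idn C (Cod C f) else if j = 3 then f else g)\<rparr>"
  have fin: "finite (Obj J)" "finite (Arr J)" by (simp_all add: J_def)
  have J: "category J" by unfold_locales (auto simp: J_def Hom_def split: if_splits)
  have F: "is_functor J C F" using assms by (auto simp: is_functor_def J_def F_def Hom_def)
  have cone: "is_cone J C F X l \<longleftrightarrow> l 0 \<in> Hom C X (Dom C f) \<and> l 1 \<in> Hom C X (Dom C g) \<and>
      f \<cdot> l 0 = l 2 \<and> g \<cdot> l 1 = l 2" for X l
    using assms by (auto simp: is_cone_def J_def F_def Hom_def) (metis Cmp_simps Idn_Cmp_simp)+
  obtain X l where l: "is_limit J C F X l"
    using limits J F fin unfolding has_finite_limits_def by blast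
  have "is_pullback C f g (l 0) (l 1)"
    unfolding is_pullback_def
  proof (intro conjI ballI impI)
    show "l 0 \<in> Hom C (Dom C (l 0)) (Dom C f)" "l 1 \<in> Hom C (Dom C (l 0)) (Dom C g)"
      "f \<cdot> l 0 = g \<cdot> l 1"
      using l by (simp_all add: is_limit_def cone Hom_def)
    fix u v assume uv: "u \<in> Arr C" "v \<in> Arr C"
      "Dom C u = Dom C v \<and> Cod C u = Dom C f \<and> Cod C v = Dom C g \<and> f \<cdot> u = g \<cdot> v"
    let ?l = "\<lambda>j::nat. if j = 0 then u else if j = 1 then v else f \<cdot> u"
    have "is_cone J C F (Dom C u) ?l" using uv by (simp add: cone Hom_def)
    then have "\<exists>!h. h \<in> Hom C (Dom C u) X \<and> (\<forall>j \<in> Obj J. l j \<cdot> h = ?l j)"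
      using l unfolding is_limit_def by blast
    moreover have l0: "Dom C (l 0) = X" using l by (simp add: is_limit_def cone Hom_def)
    \<comment> \<open>The component at the vertex \<open>2\<close> is \<open>f \<cdot> l 0\<close>,
      so its equation follows from the one at \<open>0\<close>.\<close>
    moreover have "(\<forall>j \<in> Obj J. l j \<cdot> h = ?l j) \<longleftrightarrow> l 0 \<cdot> h = u \<and> l 1 \<cdot> h = v"
      if "h \<in> Hom C (Dom C u) X" for h
    proof -
      have "l 2 \<cdot> h = f \<cdot> l 0 \<cdot> h"
        using l that assoc [of h "l 0" f] f by (auto simp: is_limit_def cone Hom_def)
      then show ?thesis by (auto simp: J_def)
    qed
    ultimately show "\<exists>!h. h \<in> Hom C (Dom C u) (Dom C (l 0)) \<and> l 0 \<cdot> h = u \<and> l 1 \<cdot> h = v"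
      by (simp cong: conj_cong)
  qed (use assms in auto)
  then show ?thesis by blast
qed

lemma is_product_chosen:
  assumes "A \<in> Obj C" "B \<in> Obj C"
  shows "is_product C A B (prod_fst C A B) (prod_snd C A B)"
  unfolding prod_fst_def prod_snd_def
  using someI_ex [of "\<lambda>ab. is_product C A B (fst ab) (snd ab)"] is_product_ex [OF assms] by auto

lemma is_pullback_chosen:
  assumes "f \<in> Arr C" "g \<in> Arr C" "Cod C f = Cod C g"
  shows "is_pullback C f g (pr1 C f g) (pr2 C f g)"
  unfolding pr1_def pr2_def
  using someI_ex [of "\<lambda>ab. is_pullback C f g (fst ab) (snd ab)"] is_pullback_ex [OF assms] by auto

lemma pr_simps [simp]:
  assumes "f \<in> Arr C" "g \<in> Arr C" "Cod C f = Cod C g"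
  shows "pr1 C f g \<in> Arr C" "Cod C (pr1 C f g) = Dom C f"
    "pr2 C f g \<in> Arr C" "Dom C (pr2 C f g) = Dom C (pr1 C f g)" "Cod C (pr2 C f g) = Dom C g"
    "g \<cdot> pr2 C f g = f \<cdot> pr1 C f g"
  using is_pullback_chosen [OF assms] by (auto simp: is_pullback_def Hom_def)

lemma pr_Cmp [simp]:
  assumes "f \<in> Arr C" "g \<in> Arr C" "Cod C f = Cod C g" "h \<in> Arr C" "Cod C h = Dom C (pr1 C f g)"
  shows "g \<cdot> pr2 C f g \<cdot> h = f \<cdot> pr1 C f g \<cdot> h"
proof -
  have "(g \<cdot> pr2 C f g) \<cdot> h = (f \<cdot> pr1 C f g) \<cdot> h" using assms by (simp del: assoc)
  then show ?thesis using assms by (simp del: pr_simps(6))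
qed

text \<open>\<open>(u, v)\<close> is a generalized element of the pullback of \<open>f\<close> and \<open>g\<close>. The equation is oriented so that, as
  a rewrite rule for \<open>g\<close> a polynomial, it replaces a direction by its position.\<close>

definition fib :: "'b \<Rightarrow> 'b \<Rightarrow> 'b \<Rightarrow> 'b \<Rightarrow> bool" where
  "fib f g u v \<longleftrightarrow> f \<in> Arr C \<and> g \<in> Arr C \<and> u \<in> Arr C \<and> v \<in> Arr C \<and> Cod C f = Cod C g \<and>
    Dom C v = Dom C u \<and> Cod C u = Dom C f \<and> Cod C v = Dom C g \<and> g \<cdot> v = f \<cdot> u"

lemma fibD:
  assumes "fib f g u v"
  shows "f \<in> Arr C" "g \<in> Arr C" "u \<in> Arr C" "v \<in> Arr C" "Cod C f = Cod C g"
    "Dom C v = Dom C u" "Cod C u = Dom C f" "Cod C v = Dom C g" "g \<cdot> v = f \<cdot> u"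
  using assms by (simp_all add: fib_def)

lemma fibI:
  assumes "f \<in> Arr C" "g \<in> Arr C" "u \<in> Arr C" "v \<in> Arr C" "Cod C f = Cod C g"
    "Dom C v = Dom C u" "Cod C u = Dom C f" "Cod C v = Dom C g" "g \<cdot> v = f \<cdot> u"
  shows "fib f g u v"
  using assms by (simp add: fib_def)

lemma fib_Cmp [simp]:
  assumes "fib f g u v" "h \<in> Arr C" "Cod C h = Dom C u"
  shows "fib f g (u \<cdot> h) (v \<cdot> h)"
proof -
  note fibD [OF assms(1), simp]
  have "(g \<cdot> v) \<cdot> h = (f \<cdot> u) \<cdot> h" by simp
  then show ?thesis using assms(2,3) by (simp add: fib_def del: fibD(9) [OF assms(1)])
qed

lemma fib_eq_Cmp:
  assumes "fib f g u v" "h \<in> Arr C" "Cod C h = Dom C u"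
  shows "g \<cdot> v \<cdot> h = f \<cdot> u \<cdot> h"
  using fib_Cmp [OF assms] by (simp add: fib_def)

lemma fib_pr [simp]:
  assumes "f \<in> Arr C" "g \<in> Arr C" "Cod C f = Cod C g"
  shows "fib f g (pr1 C f g) (pr2 C f g)"
  using assms by (simp add: fib_def)

lemma pair_ex1:
  assumes "fib f g u v"
  shows "\<exists>!h. h \<in> Hom C (Dom C u) (Dom C (pr1 C f g)) \<and> pr1 C f g \<cdot> h = u \<and> pr2 C f g \<cdot> h = v"
proof -
  note * = fibD [OF assms]
  note ** = is_pullback_chosen [OF *(1,2,5), unfolded is_pullback_def, THEN conjunct2,
      THEN conjunct2, THEN conjunct2, THEN conjunct2, THEN conjunct2, THEN conjunct2]
  show ?thesis
    by (rule ** [rule_format]) (simp_all add: *)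
qed

lemma pair_aux:
  assumes "fib f g u v"
  shows "pair C f g u v \<in> Hom C (Dom C u) (Dom C (pr1 C f g)) \<and>
    pr1 C f g \<cdot> pair C f g u v = u \<and> pr2 C f g \<cdot> pair C f g u v = v"
  unfolding pair_def
  by (rule theI') (rule pair_ex1 [OF assms])

lemma pair_simps [simp]:
  assumes "fib f g u v"
  shows "pair C f g u v \<in> Arr C" "Dom C (pair C f g u v) = Dom C u"
    "Cod C (pair C f g u v) = Dom C (pr1 C f g)"
    "pr1 C f g \<cdot> pair C f g u v = u" "pr2 C f g \<cdot> pair C f g u v = v"
  using pair_aux [OF assms] by (simp_all add: Hom_def)

lemma pr_pair_Cmp [simp]:
  assumes "fib f g u v" "h \<in> Arr C" "Cod C h = Dom C u"
  shows "pr1 C f g \<cdot> pair C f g u v \<cdot> h = u \<cdot> h" "pr2 C f g \<cdot> pair C f g u v \<cdot> h = v \<cdot> h"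
proof -
  note * = fibD [OF assms(1)]
  have "(pr1 C f g \<cdot> pair C f g u v) \<cdot> h = u \<cdot> h" "(pr2 C f g \<cdot> pair C f g u v) \<cdot> h = v \<cdot> h"
    using assms(1) by (simp_all del: assoc)
  then show "pr1 C f g \<cdot> pair C f g u v \<cdot> h = u \<cdot> h" "pr2 C f g \<cdot> pair C f g u v \<cdot> h = v \<cdot> h"
    using assms * by (simp_all del: pair_simps(4,5))
qed

lemma pr_eqI:
  assumes "f \<in> Arr C" "g \<in> Arr C" "Cod C f = Cod C g"
    and "h \<in> Arr C" "Cod C h = Dom C (pr1 C f g)" "k \<in> Arr C" "Cod C k = Dom C (pr1 C f g)"
    and "Dom C h = Dom C k"
    and eq: "pr1 C f g \<cdot> h = pr1 C f g \<cdot> k" "pr2 C f g \<cdot> h = pr2 C f g \<cdot> k"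
  shows "h = k"
proof -
  have "fib f g (pr1 C f g \<cdot> k) (pr2 C f g \<cdot> k)" using assms by simp
  then have "\<exists>!n. n \<in> Hom C (Dom C k) (Dom C (pr1 C f g)) \<and>
      pr1 C f g \<cdot> n = pr1 C f g \<cdot> k \<and> pr2 C f g \<cdot> n = pr2 C f g \<cdot> k"
    using pair_ex1 [of f g "pr1 C f g \<cdot> k" "pr2 C f g \<cdot> k"] assms by simp
  moreover have "h \<in> Hom C (Dom C k) (Dom C (pr1 C f g))" "k \<in> Hom C (Dom C k) (Dom C (pr1 C f g))"
    using assms by (simp_all add: Hom_def)
  ultimately show ?thesis using eq by blast
qed

lemma pair_Cmp [simp]:
  assumes "fib f g u v" "h \<in> Arr C" "Cod C h = Dom C u"
  shows "pair C f g u v \<cdot> h = pair C f g (u \<cdot> h) (v \<cdot> h)"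
  using assms fibD [OF assms(1)] by - (rule pr_eqI [of f g]; simp)

lemma pair_pr [simp]:
  assumes "f \<in> Arr C" "g \<in> Arr C" "Cod C f = Cod C g"
  shows "pair C f g (pr1 C f g) (pr2 C f g) = Idn C (Dom C (pr1 C f g))"
  using assms by - (rule pr_eqI [of f g]; simp)

lemma pair_pr_Cmp [simp]:
  assumes "f \<in> Arr C" "g \<in> Arr C" "Cod C f = Cod C g" "h \<in> Arr C" "Cod C h = Dom C (pr1 C f g)"
  shows "pair C f g (pr1 C f g \<cdot> h) (pr2 C f g \<cdot> h) = h"
  using assms by - (rule pr_eqI [of f g]; simp)

section \<open>Dependent products\<close>

lemma slice_simps:
  "x \<in> Obj (slice C A) \<longleftrightarrow> x \<in> Arr C \<and> Cod C x = A"
  "t \<in> Hom (slice C A) x y \<longleftrightarrow>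
    (\<exists>h. t = (x, y, h) \<and> x \<in> Arr C \<and> Cod C x = A \<and> y \<in> Arr C \<and> Cod C y = A \<and>
      h \<in> Arr C \<and> Dom C h = Dom C x \<and> Cod C h = Dom C y \<and> y \<cdot> h = x)"
  "(y', z, k) \<cdot>\<^bsub>slice C A\<^esub> (x, y, h) = (x, z, k \<cdot> h)"
  by (auto simp: slice_def Hom_def)

lemma slice_HomE:
  assumes "t \<in> Hom (slice C A) x y"
  obtains h where "t = (x, y, h)" "x \<in> Arr C" "Cod C x = A" "y \<in> Arr C" "Cod C y = A"
      "h \<in> Arr C" "Dom C h = Dom C x" "Cod C h = Dom C y" "y \<cdot> h = x"
  using assms unfolding slice_simps by blast

lemma category_slice: "category (slice C A)"
proof
  show "(t'' \<cdot>\<^bsub>slice C A\<^esub> t') \<cdot>\<^bsub>slice C A\<^esub> t = t'' \<cdot>\<^bsub>slice C A\<^esub> (t' \<cdot>\<^bsub>slice C A\<^esub> t)"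
    if "t \<in> Hom (slice C A) w x" "t' \<in> Hom (slice C A) x y" "t'' \<in> Hom (slice C A) y z"
    for t t' t'' w x y z
    using that unfolding slice_simps by (elim exE conjE) (simp add: slice_simps)
  show "t' \<cdot>\<^bsub>slice C A\<^esub> t \<in> Hom (slice C A) x z"
    if t: "t \<in> Hom (slice C A) x y" and t': "t' \<in> Hom (slice C A) y z" for t t' x y z
  proof -
    obtain h where h: "t = (x, y, h)" "x \<in> Arr C" "Cod C x = A" "h \<in> Arr C" "Dom C h = Dom C x"
      "Cod C h = Dom C y" "y \<cdot> h = x" using t by (elim slice_HomE)
    obtain k where k: "t' = (y, z, k)" "z \<in> Arr C" "Cod C z = A" "k \<in> Arr C" "Dom C k = Dom C y"
      "Cod C k = Dom C z" "z \<cdot> k = y" using t' by (elim slice_HomE)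
    have "z \<cdot> k \<cdot> h = x" using assoc [of h k z] h k by simp
    then show ?thesis using h k unfolding h(1) k(1) slice_simps by simp
  qed
  show "t \<cdot>\<^bsub>slice C A\<^esub> Idn (slice C A) x = t" "Idn (slice C A) y \<cdot>\<^bsub>slice C A\<^esub> t = t"
    if "t \<in> Hom (slice C A) x y" for t x y
    using that by (rule slice_HomE, simp add: slice_def)+
  show "Idn (slice C A) x \<in> Hom (slice C A) x x" if "x \<in> Obj (slice C A)" for x
    using that by (simp add: slice_def Hom_def)
qed (simp_all add: slice_def case_prod_unfold)

text \<open>The elementwise form of base change along \<open>m\<close>: the position moves from
  \<open>h\<close> to \<open>m \<cdot> h\<close> while the direction \<open>b\<close> stays the
  same.\<close>

lemma fib_over:
  assumes "fib (z \<cdot> m) f h b" "z \<in> Arr C" "m \<in> Arr C" "Cod C m = Dom C z"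
  shows "fib z f (m \<cdot> h) b"
  using fibD [OF assms(1)] assms(2-) by (simp add: fib_def)

lemma fib_base_change:
  assumes "f \<in> Arr C" "z \<in> Arr C" "m \<in> Arr C" "Cod C m = Dom C z" "Cod C z = Cod C f" "z \<cdot> m = x"
  shows "fib z f (m \<cdot> pr1 C x f) (pr2 C x f)"
proof -
  have x: "x \<in> Arr C" "Cod C x = Cod C f" "Dom C x = Dom C m" using assms by auto
  show ?thesis by (rule fib_over) (use assms x in simp_all)
qed

text \<open>Allows evaluation of a dependent product at \<open>m\<close> to be written with
  \<open>pair\<close> alone, so that \<open>base_change\<close> disappears from later
  arguments.\<close>

lemma base_change_Cmp_pair:
  assumes "f \<in> Arr C" "z \<in> Arr C" "m \<in> Arr C" "Cod C m = Dom C z" "Cod C z = Cod C f" "z \<cdot> m = x"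
    and "fib x f h b"
  shows "base_change C f x z m \<cdot> pair C x f h b = pair C z f (m \<cdot> h) b"
proof -
  have x: "x \<in> Arr C" "Cod C x = Cod C f" "Dom C x = Dom C m" using assms by auto
  show ?thesis using fib_base_change [OF assms(1-6)] fibD [OF assms(7)] assms x
    by (simp add: base_change_def)
qed

lemma base_change_simps:
  assumes "f \<in> Arr C" "z \<in> Arr C" "m \<in> Arr C" "Cod C m = Dom C z" "Cod C z = Cod C f" "z \<cdot> m = x"
  shows "base_change C f x z m \<in> Arr C" "Dom C (base_change C f x z m) = Dom C (pr1 C x f)"
    "Cod C (base_change C f x z m) = Dom C (pr1 C z f)"
proof -
  have x: "x \<in> Arr C" "Cod C x = Cod C f" "Dom C x = Dom C m" using assms by auto
  show "base_change C f x z m \<in> Arr C" "Dom C (base_change C f x z m) = Dom C (pr1 C x f)"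
    "Cod C (base_change C f x z m) = Dom C (pr1 C z f)"
    using fib_base_change [OF assms(1-6)] assms x by (simp_all add: base_change_def)
qed

lemma pb_functor_is_functor:
  assumes f: "f \<in> Arr C"
  shows "is_functor (slice C (Cod C f)) (slice C (Dom C f)) (pb_functor C f)"
  unfolding is_functor_def
proof (intro conjI ballI impI)
  fix x assume "x \<in> Obj (slice C (Cod C f))"
  then have x: "x \<in> Arr C" "Cod C x = Cod C f" by (simp_all add: slice_simps)
  then show "FObj (pb_functor C f) x \<in> Obj (slice C (Dom C f))"
    using f by (simp add: pb_functor_def slice_simps)
  show "FArr (pb_functor C f) (Idn (slice C (Cod C f)) x)
      = Idn (slice C (Dom C f)) (FObj (pb_functor C f) x)"
    using f x by (simp add: pb_functor_def slice_def base_change_def)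
next
  fix t assume "t \<in> Arr (slice C (Cod C f))"
  then obtain x y h where t: "t = (x, y, h)" "x \<in> Arr C" "Cod C x = Cod C f" "y \<in> Arr C"
    "Cod C y = Cod C f" "h \<in> Arr C" "Dom C h = Dom C x" "Cod C h = Dom C y" "y \<cdot> h = x"
    by (auto simp: slice_def Hom_def)
  have *: "fib y f (h \<cdot> pr1 C x f) (pr2 C x f)" using t f by (intro fib_base_change)
  show "FArr (pb_functor C f) t \<in> Hom (slice C (Dom C f))
      (FObj (pb_functor C f) (Dom (slice C (Cod C f)) t)) (FObj (pb_functor C f) (Cod (slice C (Cod C f)) t))"
    using f * t by (simp add: pb_functor_def slice_simps base_change_def) (simp add: slice_def)
  fix s assume "s \<in> Arr (slice C (Cod C f))" "Cod (slice C (Cod C f)) t = Dom (slice C (Cod C f)) s"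
  then obtain z k where s: "s = (y, z, k)" "z \<in> Arr C"
    "Cod C z = Cod C f" "k \<in> Arr C" "Dom C k = Dom C y" "Cod C k = Dom C z" "z \<cdot> k = y"
    using t by (auto simp: slice_def Hom_def)
  have "base_change C f x z (k \<cdot> h) = base_change C f y z k \<cdot> base_change C f x y h"
    unfolding base_change_def [of C f x y h]
    by (subst base_change_Cmp_pair) (use f t s * in \<open>simp_all add: base_change_def\<close>)
  then show "FArr (pb_functor C f) (s \<cdot>\<^bsub>slice C (Cod C f)\<^esub> t)
      = FArr (pb_functor C f) s \<cdot>\<^bsub>slice C (Dom C f)\<^esub> FArr (pb_functor C f) t"
    by (simp add: pb_functor_def slice_simps s(1) t(1))
qed

text \<open>The couniversal arrow at \<open>y\<close> for the pullback functor, stripped of slice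
  triples: \<open>z\<close> plays the role of \<Pi> applied to \<open>y\<close>, and
  \<open>e\<close> that of the counit. It describes any dependent product, not the chosen one, so
  that closure properties can supply their own candidates.\<close>

definition is_dep_prod :: "'b \<Rightarrow> 'b \<Rightarrow> 'b \<Rightarrow> 'b \<Rightarrow> bool" where
  "is_dep_prod f y z e \<longleftrightarrow>
    z \<in> Arr C \<and> Cod C z = Cod C f \<and>
    e \<in> Arr C \<and> Dom C e = Dom C (pr1 C z f) \<and> Cod C e = Dom C y \<and> y \<cdot> e = pr2 C z f \<and>
    (\<forall>x k. x \<in> Arr C \<and> Cod C x = Cod C f \<and>
      k \<in> Arr C \<and> Dom C k = Dom C (pr1 C x f) \<and> Cod C k = Dom C y \<and> y \<cdot> k = pr2 C x f \<longrightarrow>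
      (\<exists>!m. m \<in> Arr C \<and> Dom C m = Dom C x \<and> Cod C m = Dom C z \<and> z \<cdot> m = x \<and>
        e \<cdot> base_change C f x z m = k))"

lemma is_dep_prodD:
  assumes "is_dep_prod f y z e"
  shows "z \<in> Arr C" "Cod C z = Cod C f" "e \<in> Arr C" "Dom C e = Dom C (pr1 C z f)"
    "Cod C e = Dom C y" "y \<cdot> e = pr2 C z f"
  using assms by (simp_all add: is_dep_prod_def)

lemma is_dep_prod_ex1:
  assumes "is_dep_prod f y z e" "x \<in> Arr C" "Cod C x = Cod C f"
    "k \<in> Arr C" "Dom C k = Dom C (pr1 C x f)" "Cod C k = Dom C y" "y \<cdot> k = pr2 C x f"
  shows "\<exists>!m. m \<in> Arr C \<and> Dom C m = Dom C x \<and> Cod C m = Dom C z \<and> z \<cdot> m = x \<and>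
    e \<cdot> base_change C f x z m = k"
  using assms by (simp add: is_dep_prod_def)

text \<open>An arrow of a slice is an ordinary arrow with its source and target recorded, so both
  sides quantify over the same data.\<close>

lemma couniversal_iff_is_dep_prod:
  assumes f: "f \<in> Arr C" and y: "y \<in> Arr C" "Cod C y = Dom C f"
  shows "couniversal (slice C (Cod C f)) (slice C (Dom C f)) (pb_functor C f) y z \<epsilon> \<longleftrightarrow>
    (\<exists>e. \<epsilon> = (pr2 C z f, y, e) \<and> is_dep_prod f y z e)" (is "?L \<longleftrightarrow> ?R")
proof -
  let ?U = "\<lambda>e x k. \<exists>!m. m \<in> Arr C \<and> Dom C m = Dom C x \<and> Cod C m = Dom C z \<and> z \<cdot> m = x \<and>
        e \<cdot> base_change C f x z m = k"
  let ?V = "\<lambda>\<epsilon> x t. \<exists>!m. m \<in> Hom (slice C (Cod C f)) x z \<and>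
      \<epsilon> \<cdot>\<^bsub>slice C (Dom C f)\<^esub> FArr (pb_functor C f) m = t"
  \<comment> \<open>Slice arrows from \<open>x\<close> to \<open>z\<close> are the triples
    \<open>(x, z, n)\<close> with \<open>z \<cdot> n = x\<close>; unique existence transfers along
    this correspondence.\<close>
  have iff: "?V (pr2 C z f, y, e) x (pr2 C x f, y, k) \<longleftrightarrow> ?U e x k"
    if "x \<in> Arr C" "Cod C x = Cod C f" "z \<in> Arr C" "Cod C z = Cod C f" for e x k
  proof -
    have "(m \<in> Hom (slice C (Cod C f)) x z \<and>
        (pr2 C z f, y, e) \<cdot>\<^bsub>slice C (Dom C f)\<^esub> FArr (pb_functor C f) m = (pr2 C x f, y, k)) \<longleftrightarrow>
      (\<exists>n. m = (x, z, n) \<and> n \<in> Arr C \<and> Dom C n = Dom C x \<and> Cod C n = Dom C z \<and> z \<cdot> n = x \<and>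
        e \<cdot> base_change C f x z n = k)" for m
      using that by (auto simp: slice_simps pb_functor_def)
    then show ?thesis by (simp only:) blast
  qed
  show ?thesis
  proof
    assume L: ?L
    then obtain e where e: "\<epsilon> = (pr2 C z f, y, e)" "z \<in> Arr C" "Cod C z = Cod C f"
      "e \<in> Arr C" "Dom C e = Dom C (pr1 C z f)" "Cod C e = Dom C y" "y \<cdot> e = pr2 C z f"
      using f by (auto simp: couniversal_def slice_simps pb_functor_def)
    have "?U e x k" if "x \<in> Arr C" "Cod C x = Cod C f"
      "k \<in> Arr C" "Dom C k = Dom C (pr1 C x f)" "Cod C k = Dom C y" "y \<cdot> k = pr2 C x f" for x k
    proof -
      have "(pr2 C x f, y, k) \<in> Hom (slice C (Dom C f)) (FObj (pb_functor C f) x) y"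
        using that f y by (simp add: slice_simps pb_functor_def)
      moreover have "x \<in> Obj (slice C (Cod C f))" using that by (simp add: slice_simps)
      ultimately have "?V \<epsilon> x (pr2 C x f, y, k)" using L unfolding couniversal_def by blast
      then show ?thesis using iff [of x e k] that e by simp
    qed
    then have "is_dep_prod f y z e" using e unfolding is_dep_prod_def by blast
    then show ?R using e by blast
  next
    assume ?R
    then obtain e where e: "\<epsilon> = (pr2 C z f, y, e)" "is_dep_prod f y z e" by blast
    note e' = is_dep_prodD [OF e(2)]
    show ?L
      unfolding couniversal_def
    proof (intro conjI ballI)
      show "z \<in> Obj (slice C (Cod C f))" using e' by (simp add: slice_simps)
      show "\<epsilon> \<in> Hom (slice C (Dom C f)) (FObj (pb_functor C f) z) y"
        using e' e f y by (simp add: slice_simps pb_functor_def)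
      fix x t assume "x \<in> Obj (slice C (Cod C f))"
        "t \<in> Hom (slice C (Dom C f)) (FObj (pb_functor C f) x) y"
      then obtain k where k: "t = (pr2 C x f, y, k)" "x \<in> Arr C" "Cod C x = Cod C f"
        "k \<in> Arr C" "Dom C k = Dom C (pr1 C x f)" "Cod C k = Dom C y" "y \<cdot> k = pr2 C x f"
        using f by (auto simp: slice_simps pb_functor_def)
      have "?U e x k" by (rule is_dep_prod_ex1 [OF e(2) k(2-)])
      then show "?V \<epsilon> x t" using iff [of x e k] k e e' by simp
    qed
  qed
qed

text \<open>Counits are universal arrows, and universal arrows at all objects assemble into a right
  adjoint. A new exponentiable arrow can thus be obtained by naming one object and one evaluation
  for each \<open>y\<close>.\<close>

lemma exponentiable_iff:
  "exponentiable C f \<longleftrightarrow>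
    f \<in> Arr C \<and> (\<forall>y. y \<in> Arr C \<and> Cod C y = Dom C f \<longrightarrow> (\<exists>z e. is_dep_prod f y z e))"
proof
  assume "exponentiable C f"
  then obtain G \<eta> \<epsilon> where f: "f \<in> Arr C"
    and adj: "adjunction (slice C (Cod C f)) (slice C (Dom C f)) (pb_functor C f) G \<eta> \<epsilon>"
    unfolding exponentiable_def by blast
  have "\<exists>z e. is_dep_prod f y z e" if y: "y \<in> Arr C" "Cod C y = Dom C f" for y
    using couniversal_counit [OF category_slice category_slice adj, of y]
      couniversal_iff_is_dep_prod [OF f y] y by (auto simp: slice_simps)
  then show "f \<in> Arr C \<and> (\<forall>y. y \<in> Arr C \<and> Cod C y = Dom C f \<longrightarrow> (\<exists>z e. is_dep_prod f y z e))"
    using f by blast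
next
  assume *: "f \<in> Arr C \<and> (\<forall>y. y \<in> Arr C \<and> Cod C y = Dom C f \<longrightarrow> (\<exists>z e. is_dep_prod f y z e))"
  then have f: "f \<in> Arr C" by blast
  have "\<exists>z \<epsilon>. couniversal (slice C (Cod C f)) (slice C (Dom C f)) (pb_functor C f) y z \<epsilon>"
    if "y \<in> Obj (slice C (Dom C f))" for y
    using that * couniversal_iff_is_dep_prod [OF f, of y] unfolding slice_simps by blast
  then show "exponentiable C f"
    unfolding exponentiable_def
    using f adjunction_of_couniversal [OF category_slice category_slice pb_functor_is_functor [OF f]]
    by blast
qed

text \<open>Of the data picked by \<open>dep_prod_data\<close> it is known only that some unit
  completes them to an adjunction; this suffices, because universality is a property of the
  counit.\<close>

lemma is_dep_prod_chosen:
  assumes f: "exponentiable C f" and y: "y \<in> Arr C" "Cod C y = Dom C f"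
  shows "is_dep_prod f y (dep_prod C f y) (dep_counit C f y)"
proof -
  obtain G \<eta> \<epsilon> where
    "adjunction (slice C (Cod C f)) (slice C (Dom C f)) (pb_functor C f) G \<eta> \<epsilon>"
    using f unfolding exponentiable_def by blast
  then have "\<exists>G\<epsilon>. \<exists>\<eta>. adjunction (slice C (Cod C f)) (slice C (Dom C f)) (pb_functor C f)
      (fst G\<epsilon>) \<eta> (snd G\<epsilon>)" by auto
  then have "\<exists>\<eta>. adjunction (slice C (Cod C f)) (slice C (Dom C f)) (pb_functor C f)
      (fst (dep_prod_data C f)) \<eta> (snd (dep_prod_data C f))"
    unfolding dep_prod_data_def by (rule someI_ex)
  then obtain \<eta> where adj: "adjunction (slice C (Cod C f)) (slice C (Dom C f)) (pb_functor C f)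
      (fst (dep_prod_data C f)) \<eta> (snd (dep_prod_data C f))" by blast
  have f': "f \<in> Arr C" using f by (simp add: exponentiable_def)
  have "y \<in> Obj (slice C (Dom C f))" using y by (simp add: slice_simps)
  from couniversal_counit [OF category_slice category_slice adj this]
  show ?thesis
    unfolding couniversal_iff_is_dep_prod [OF f' y] by (auto simp: dep_prod_def dep_counit_def)
qed

text \<open>The computation rule for \<Pi>: \<open>m\<close> is the transpose of \<open>k\<close>,
  and evaluating it at an element gives the value of \<open>k\<close> there.\<close>

lemma is_dep_prodE:
  assumes "is_dep_prod f y z e" "f \<in> Arr C" "x \<in> Arr C" "Cod C x = Cod C f"
    "k \<in> Arr C" "Dom C k = Dom C (pr1 C x f)" "Cod C k = Dom C y" "y \<cdot> k = pr2 C x f"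
  obtains m where "m \<in> Arr C" "Dom C m = Dom C x" "Cod C m = Dom C z" "z \<cdot> m = x"
    "\<And>h b. fib x f h b \<Longrightarrow> e \<cdot> pair C z f (m \<cdot> h) b = k \<cdot> pair C x f h b"
proof -
  obtain m where m: "m \<in> Arr C" "Dom C m = Dom C x" "Cod C m = Dom C z" "z \<cdot> m = x"
    "e \<cdot> base_change C f x z m = k"
    using is_dep_prod_ex1 [OF assms(1,3-)] by blast
  note * = is_dep_prodD [OF assms(1)]
  have "e \<cdot> pair C z f (m \<cdot> h) b = k \<cdot> pair C x f h b" if "fib x f h b" for h b
  proof -
    have "k \<cdot> pair C x f h b = (e \<cdot> base_change C f x z m) \<cdot> pair C x f h b"
      using m by simp
    also have "\<dots> = e \<cdot> base_change C f x z m \<cdot> pair C x f h b"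
      by (rule assoc) (use base_change_simps [of f z m x] m(1-4) * assms that in simp_all)
    also have "\<dots> = e \<cdot> pair C z f (m \<cdot> h) b"
      by (subst base_change_Cmp_pair) (use m * assms that in simp_all)
    finally show ?thesis by simp
  qed
  then show ?thesis using m that by blast
qed

text \<open>The extensionality rule for \<Pi>: both arrows are transposes of one and the same arrow
  over \<open>y\<close>, hence equal by uniqueness.\<close>

lemma is_dep_prod_eqI:
  assumes d: "is_dep_prod f y z e" and "f \<in> Arr C" "y \<in> Arr C" "Cod C y = Dom C f"
    and m: "m \<in> Arr C" "Cod C m = Dom C z" and m': "m' \<in> Arr C" "Cod C m' = Dom C z"
    and z: "z \<cdot> m' = z \<cdot> m"
    and ev: "\<And>h b. fib (z \<cdot> m) f h b \<Longrightarrow> e \<cdot> pair C z f (m \<cdot> h) b = e \<cdot> pair C z f (m' \<cdot> h) b"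
  shows "m' = m"
proof -
  note * = is_dep_prodD [OF assms(1)]
  let ?x = "z \<cdot> m"
  let ?k = "e \<cdot> base_change C f ?x z m"
  have fib: "fib z f (m \<cdot> pr1 C (z \<cdot> m) f) (pr2 C (z \<cdot> m) f)"
    by (rule fib_base_change) (use assms * in simp_all)
  have dom: "Dom C m' = Dom C m"
    using arg_cong [OF z, of "Dom C"] m m' * by simp
  have "y \<cdot> ?k = (y \<cdot> e) \<cdot> base_change C f ?x z m"
    by (rule assoc [symmetric]) (use * assms base_change_simps [of f z m ?x] in simp_all)
  also have "\<dots> = pr2 C ?x f" unfolding *(6) using assms(2) * fib m by (simp add: base_change_def)
  finally have yk: "y \<cdot> ?k = pr2 C ?x f" .
  \<comment> \<open>The hypothesis at the generic element, the pair of projections, compares the two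
    base changes in full.\<close>
  have "?k = e \<cdot> base_change C f ?x z m'"
    unfolding base_change_def
    using assms * dom ev [of "pr1 C (z \<cdot> m) f" "pr2 C (z \<cdot> m) f"] by simp
  moreover have "\<exists>!n. n \<in> Arr C \<and> Dom C n = Dom C ?x \<and> Cod C n = Dom C z \<and> z \<cdot> n = ?x \<and>
      e \<cdot> base_change C f ?x z n = ?k"
    by (rule is_dep_prod_ex1 [OF d _ _ _ _ _ yk])
      (use * assms base_change_simps [of f z m ?x] in simp_all)
  moreover have "Dom C m = Dom C ?x" using * m by simp
  ultimately show ?thesis using m m' z dom by metis
qed

text \<open>The two obligations are asymmetric on purpose. Existence is demanded at the generic
  element only, which already determines the evaluated arrow; uniqueness may assume agreement at
  every element.\<close>

lemma is_dep_prodI: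
  assumes f: "f \<in> Arr C" and y: "y \<in> Arr C" "Cod C y = Dom C f"
    and z: "z \<in> Arr C" "Cod C z = Cod C f"
    and e: "e \<in> Arr C" "Dom C e = Dom C (pr1 C z f)" "Cod C e = Dom C y" "y \<cdot> e = pr2 C z f"
    and ex: "\<And>x k. \<lbrakk>x \<in> Arr C; Cod C x = Cod C f; k \<in> Arr C; Dom C k = Dom C (pr1 C x f);
        Cod C k = Dom C y; y \<cdot> k = pr2 C x f\<rbrakk> \<Longrightarrow>
      \<exists>m. m \<in> Arr C \<and> Dom C m = Dom C x \<and> Cod C m = Dom C z \<and> z \<cdot> m = x \<and>
        e \<cdot> pair C z f (m \<cdot> pr1 C x f) (pr2 C x f) = k"
    and eq: "\<And>m m'. \<lbrakk>m \<in> Arr C; m' \<in> Arr C; Dom C m' = Dom C m; Cod C m = Dom C z; Cod C m' = Dom C z;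
        z \<cdot> m' = z \<cdot> m;
        \<And>h b. fib (z \<cdot> m) f h b \<Longrightarrow> e \<cdot> pair C z f (m' \<cdot> h) b = e \<cdot> pair C z f (m \<cdot> h) b\<rbrakk>
      \<Longrightarrow> m' = m"
  shows "is_dep_prod f y z e"
  unfolding is_dep_prod_def
proof (intro conjI allI impI)
  fix x k assume *: "x \<in> Arr C \<and> Cod C x = Cod C f \<and>
      k \<in> Arr C \<and> Dom C k = Dom C (pr1 C x f) \<and> Cod C k = Dom C y \<and> y \<cdot> k = pr2 C x f"
  then have "\<exists>m. m \<in> Arr C \<and> Dom C m = Dom C x \<and> Cod C m = Dom C z \<and> z \<cdot> m = x \<and>
        e \<cdot> base_change C f x z m = k"
    using ex [of x k] unfolding base_change_def by blast
  moreover have "m' = m" if "m \<in> Arr C" "Dom C m = Dom C x" "Cod C m = Dom C z" "z \<cdot> m = x"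
     "m' \<in> Arr C" "Dom C m' = Dom C x" "Cod C m' = Dom C z" "z \<cdot> m' = x"
     and k: "e \<cdot> base_change C f x z m' = e \<cdot> base_change C f x z m" for m m'
  proof (rule eq)
    fix h b assume "fib (z \<cdot> m) f h b"
    then have fib: "fib x f h b" using that by simp
    have "e \<cdot> pair C z f (n \<cdot> h) b = (e \<cdot> base_change C f x z n) \<cdot> pair C x f h b"
      if "n \<in> Arr C" "Cod C n = Dom C z" "z \<cdot> n = x" for n
      using base_change_Cmp_pair [of f z n x h b] base_change_simps [of f z n x] fib e f z that
      by simp
    then show "e \<cdot> pair C z f (m' \<cdot> h) b = e \<cdot> pair C z f (m \<cdot> h) b" using that k by simp
  qed (use that in simp_all)
  ultimately show "\<exists>!m. m \<in> Arr C \<and> Dom C m = Dom C x \<and> Cod C m = Dom C z \<and> z \<cdot> m = x \<and>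
        e \<cdot> base_change C f x z m = k" by metis
qed (use assms in simp_all)

lemma is_dep_prod_Cmp:
  assumes "is_dep_prod f y z e" "f \<in> Arr C" "y \<in> Arr C" "w \<in> Arr C" "Cod C w = Dom C (pr1 C z f)"
  shows "y \<cdot> e \<cdot> w = pr2 C z f \<cdot> w"
  using assoc [of w e y] is_dep_prodD [OF assms(1)] assms by simp

section \<open>Closure of exponentiable arrows under composition and pullback\<close>

lemma exponentiable_Arr: "exponentiable C f \<Longrightarrow> f \<in> Arr C"
  by (simp add: exponentiable_def)

lemma exponentiableE:
  assumes "exponentiable C f" "y \<in> Arr C" "Cod C y = Dom C f"
  obtains z e where "is_dep_prod f y z e"
  using assms unfolding exponentiable_iff by blast

text \<open>Pulling back along \<open>f \<cdot> g\<close> is pulling back along \<open>f\<close> and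
  then \<open>g\<close>, so the right adjoint is \<Pi> along \<open>g\<close> followed by \<Pi>
  along \<open>f\<close>: \<open>z1\<close> is the former of \<open>y\<close>, and \<open>z2\<close>
  the latter of \<open>z1\<close>.\<close>

lemma exponentiable_Cmp:
  assumes f: "exponentiable C f" and g: "exponentiable C g" and fg: "Cod C g = Dom C f"
  shows "exponentiable C (f \<cdot> g)"
  unfolding exponentiable_iff
proof (intro conjI allI impI)
  have arr [simp]: "f \<in> Arr C" "g \<in> Arr C" "Cod C g = Dom C f"
    using f g fg by (simp_all add: exponentiable_def)
  show "f \<cdot> g \<in> Arr C" by simp
  fix y assume "y \<in> Arr C \<and> Cod C y = Dom C (f \<cdot> g)"
  then have y [simp]: "y \<in> Arr C" "Cod C y = Dom C g" by simp_all
  obtain z1 e1 where d1: "is_dep_prod g y z1 e1" by (rule exponentiableE [OF g y])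
  note [simp] = is_dep_prodD [OF d1]
  obtain z2 e2 where d2: "is_dep_prod f z1 z2 e2" by (rule exponentiableE [OF f, of z1]) simp_all
  note [simp] = is_dep_prodD [OF d2]
  have fib_f: "fib x f h (g \<cdot> d)" if "fib x (f \<cdot> g) h d" for x h d
    using fibD [OF that] by (simp add: fib_def)
  have fib_g: "fib z1 g (e2 \<cdot> pair C z2 f h (g \<cdot> d)) d" if "fib z2 (f \<cdot> g) h d" for h d
    using fibD [OF that] fib_f [OF that] is_dep_prod_Cmp [OF d2, of "pair C z2 f h (g \<cdot> d)"]
    by (simp add: fib_def)
  \<comment> \<open>Evaluation happens twice: an element of \<open>z2\<close> evaluated at
    \<open>g \<cdot> d\<close> yields an element of \<open>z1\<close>, which is then evaluated at
    \<open>d\<close>.\<close>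
  define e where "e = e1 \<cdot> pair C z1 g (e2 \<cdot> pair C z2 f (pr1 C z2 (f \<cdot> g)) (g \<cdot> pr2 C z2 (f \<cdot> g)))
    (pr2 C z2 (f \<cdot> g))"
  have fib0: "fib z2 (f \<cdot> g) (pr1 C z2 (f \<cdot> g)) (pr2 C z2 (f \<cdot> g))" by simp
  note [simp] = fib_f [OF fib0] fib_g [OF fib0]
  have e_pair: "e \<cdot> pair C z2 (f \<cdot> g) h d = e1 \<cdot> pair C z1 g (e2 \<cdot> pair C z2 f h (g \<cdot> d)) d"
    if "fib z2 (f \<cdot> g) h d" for h d
    using that fibD [OF that] unfolding e_def by simp
  have "is_dep_prod (f \<cdot> g) y z2 e"
  proof (rule is_dep_prodI)
    show "y \<cdot> e = pr2 C z2 (f \<cdot> g)"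
      unfolding e_def by (subst is_dep_prod_Cmp [OF d1]) simp_all
  next
    fix x k assume x [simp]: "x \<in> Arr C" "Cod C x = Cod C (f \<cdot> g)"
      and k [simp]: "k \<in> Arr C" "Dom C k = Dom C (pr1 C x (f \<cdot> g))" "Cod C k = Dom C y"
        "y \<cdot> k = pr2 C x (f \<cdot> g)"
    let ?u = "pr2 C x f"
    have fibu: "fib x (f \<cdot> g) (pr1 C x f \<cdot> h) d" if "fib ?u g h d" for h d
      using fibD [OF that] by (simp add: fib_def)
    \<comment> \<open>Writing \<open>A\<close>, \<open>B\<close>, \<open>E\<close> for the codomain
      of \<open>f\<close>, its domain and the domain of \<open>g\<close>, this is \<open>k\<close>
      read through \<open>(X \<times> B) \<times> E\<close> \<cong> \<open>X \<times> E\<close>,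
      where the first product and the last are over \<open>A\<close> and the middle one is over
      \<open>B\<close>. It is transposed along \<open>g\<close> to \<open>m1\<close>, and
      \<open>m1\<close> along \<open>f\<close> to \<open>m\<close>.\<close>
    let ?k = "k \<cdot> pair C x (f \<cdot> g) (pr1 C x f \<cdot> pr1 C ?u g) (pr2 C ?u g)"
    have fib1 [simp]: "fib x (f \<cdot> g) (pr1 C x f \<cdot> pr1 C ?u g) (pr2 C ?u g)"
      by (rule fibu) simp
    have "y \<cdot> ?k = pr2 C ?u g"
      using assoc [of "pair C x (f \<cdot> g) (pr1 C x f \<cdot> pr1 C ?u g) (pr2 C ?u g)" k y] by simp
    then obtain m1 where [simp]: "m1 \<in> Arr C" "Dom C m1 = Dom C ?u" "Cod C m1 = Dom C z1" "z1 \<cdot> m1 = ?u"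
      and m1: "\<And>h b. fib ?u g h b \<Longrightarrow> e1 \<cdot> pair C z1 g (m1 \<cdot> h) b = ?k \<cdot> pair C ?u g h b"
      by (elim is_dep_prodE [OF d1, rotated -1]) simp_all
    obtain m where [simp]: "m \<in> Arr C" "Dom C m = Dom C x" "Cod C m = Dom C z2" "z2 \<cdot> m = x"
      and m: "\<And>h b. fib x f h b \<Longrightarrow> e2 \<cdot> pair C z2 f (m \<cdot> h) b = m1 \<cdot> pair C x f h b"
      by (rule is_dep_prodE [OF d2, of x m1]) simp_all
    let ?a = "pr1 C x (f \<cdot> g)" and ?d = "pr2 C x (f \<cdot> g)"
    have fibx: "fib x (f \<cdot> g) ?a ?d" by simp
    note [simp] = fib_f [OF fibx]
    have fibm: "fib z2 (f \<cdot> g) (m \<cdot> ?a) ?d" by (rule fib_over) simp_all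
    have fibg: "fib ?u g (pair C x f ?a (g \<cdot> ?d)) ?d" by (rule fibI) simp_all
    have "e \<cdot> pair C z2 (f \<cdot> g) (m \<cdot> ?a) ?d = k"
      unfolding e_pair [OF fibm] m [OF fib_f [OF fibx]] m1 [OF fibg] using fibg by simp
    then show "\<exists>m. m \<in> Arr C \<and> Dom C m = Dom C x \<and> Cod C m = Dom C z2 \<and> z2 \<cdot> m = x \<and>
        e \<cdot> pair C z2 (f \<cdot> g) (m \<cdot> pr1 C x (f \<cdot> g)) (pr2 C x (f \<cdot> g)) = k"
      by (intro exI [of _ m]) simp
  next
    fix m m' assume [simp]: "m \<in> Arr C" "m' \<in> Arr C" "Dom C m' = Dom C m" "Cod C m = Dom C z2"
      "Cod C m' = Dom C z2" and z: "z2 \<cdot> m' = z2 \<cdot> m"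
      and ev: "\<And>h b. fib (z2 \<cdot> m) (f \<cdot> g) h b \<Longrightarrow>
          e \<cdot> pair C z2 (f \<cdot> g) (m' \<cdot> h) b = e \<cdot> pair C z2 (f \<cdot> g) (m \<cdot> h) b"
    show "m' = m"
    \<comment> \<open>Extensionality is applied twice: arrows into \<open>z2\<close> are compared at
      \<open>b\<close>, and the resulting elements of \<open>z1\<close> at each \<open>d\<close>
      lying over \<open>b\<close>.\<close>
    proof (rule is_dep_prod_eqI [OF d2 _ _ _ _ _ _ _ z])
      fix h b assume hb: "fib (z2 \<cdot> m) f h b"
      note [simp] = fibD(3,4,6-8) [OF hb]
      have fm [simp]: "fib z2 f (m \<cdot> h) b" by (rule fib_over [OF hb]) simp_all
      have fm' [simp]: "fib z2 f (m' \<cdot> h) b" by (rule fib_over [OF hb [folded z]]) simp_all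
      show "e2 \<cdot> pair C z2 f (m \<cdot> h) b = e2 \<cdot> pair C z2 f (m' \<cdot> h) b"
      proof (rule is_dep_prod_eqI [OF d1])
        fix c d assume "fib (z1 \<cdot> e2 \<cdot> pair C z2 f (m' \<cdot> h) b) g c d"
        then have cd: "fib b g c d" by (simp add: is_dep_prod_Cmp [OF d2])
        note [simp] = fibD(3,4,6-9) [OF cd]
        have "fib (z2 \<cdot> m) (f \<cdot> g) (h \<cdot> c) d"
          using fib_eq_Cmp [OF hb, of c] by (simp add: fib_def)
        from ev [OF this] fib_over [OF this] fib_over [OF this [folded z]]
        have "e1 \<cdot> pair C z1 g (e2 \<cdot> pair C z2 f (m' \<cdot> h \<cdot> c) (g \<cdot> d)) d =
          e1 \<cdot> pair C z1 g (e2 \<cdot> pair C z2 f (m \<cdot> h \<cdot> c) (g \<cdot> d)) d"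
          by (simp add: e_pair del: fibD(9) [OF cd])
        then show "e1 \<cdot> pair C z1 g ((e2 \<cdot> pair C z2 f (m' \<cdot> h) b) \<cdot> c) d =
          e1 \<cdot> pair C z1 g ((e2 \<cdot> pair C z2 f (m \<cdot> h) b) \<cdot> c) d"
          by simp
      qed (simp_all add: is_dep_prod_Cmp [OF d2])
    qed simp_all
  qed (simp_all add: e_def)
  then show "\<exists>z e. is_dep_prod (f \<cdot> g) y z e" by blast
qed

text \<open>\<open>\<Pi>\<close> of \<open>y\<close> along the pulled back arrow \<open>f'\<close> is the pullback of \<open>\<Pi>\<^sub>f (g' y) \<rightarrow> \<Pi>\<^sub>f g'\<close> along
  the transpose \<open>A' \<rightarrow> \<Pi>\<^sub>f g'\<close> of the identity, where \<open>g' = pr2 C g f\<close>.\<close>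

lemma exponentiable_pr1:
  assumes f: "exponentiable C f" and g [simp]: "g \<in> Arr C" and gf [simp]: "Cod C g = Cod C f"
  shows "exponentiable C (pr1 C g f)"
  unfolding exponentiable_iff
proof (intro conjI allI impI)
  have [simp]: "f \<in> Arr C" by (rule exponentiable_Arr [OF f])
  let ?f = "pr1 C g f" and ?g = "pr2 C g f"
  show "?f \<in> Arr C" by simp
  fix y assume "y \<in> Arr C \<and> Cod C y = Dom C ?f"
  then have y [simp]: "y \<in> Arr C" "Cod C y = Dom C ?f" by simp_all
  obtain z1 e1 where d1: "is_dep_prod f (?g \<cdot> y) z1 e1" by (rule exponentiableE [OF f, of "?g \<cdot> y"]) simp_all
  obtain z2 e2 where d2: "is_dep_prod f ?g z2 e2" by (rule exponentiableE [OF f, of ?g]) simp_all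
  note [simp] = is_dep_prodD(1-5) [OF d1] is_dep_prodD [OF d2]
  have g_y_e1 [simp]: "?g \<cdot> y \<cdot> e1 = pr2 C z1 f"
    using is_dep_prodD(6) [OF d1] by simp
  \<comment> \<open>\<open>n\<close> is the transpose of the identity: it sends a point of the new
    base to the tautological section of \<open>?g\<close> there.\<close>
  obtain n where [simp]: "n \<in> Arr C" "Dom C n = Dom C g" "Cod C n = Dom C z2" "z2 \<cdot> n = g"
    and n: "\<And>h b. fib g f h b \<Longrightarrow> e2 \<cdot> pair C z2 f (n \<cdot> h) b = Idn C (Dom C ?f) \<cdot> pair C g f h b"
    by (rule is_dep_prodE [OF d2, of g "Idn C (Dom C ?f)"]) simp_all
  \<comment> \<open>\<open>t\<close> is \<Pi> along \<open>f\<close> applied to \<open>y\<close>,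
    regarded as a slice arrow from \<open>?g \<cdot> y\<close> to \<open>?g\<close>.\<close>
  obtain t where [simp]: "t \<in> Arr C" "Dom C t = Dom C z1" "Cod C t = Dom C z2" "z2 \<cdot> t = z1"
    and t: "\<And>h b. fib z1 f h b \<Longrightarrow> e2 \<cdot> pair C z2 f (t \<cdot> h) b = (y \<cdot> e1) \<cdot> pair C z1 f h b"
    by (rule is_dep_prodE [OF d2, of z1 "y \<cdot> e1"]) simp_all
  let ?z = "pr1 C n t" and ?w = "pr2 C n t"
  have z2_n: "z2 \<cdot> n \<cdot> h = g \<cdot> h" if "h \<in> Arr C" "Cod C h = Dom C g" for h
    using assoc [of h n z2] that by simp
  have z2_t: "z2 \<cdot> t \<cdot> h = z1 \<cdot> h" if "h \<in> Arr C" "Cod C h = Dom C z1" for h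
    using assoc [of h t z2] that by simp
  have z1_w: "z1 \<cdot> ?w \<cdot> h = g \<cdot> ?z \<cdot> h" if "h \<in> Arr C" "Cod C h = Dom C ?z" for h
    using that z2_t [of "?w \<cdot> h"] z2_n [of "?z \<cdot> h"] by simp
  have fib_f: "fib z1 f (?w \<cdot> h) (?g \<cdot> b)" if "fib ?z ?f h b" for h b
    using fibD [OF that] by (simp add: fib_def z1_w)
  have fib0: "fib ?z ?f (pr1 C ?z ?f) (pr2 C ?z ?f)" by simp
  note [simp] = fib_f [OF fib0]
  define e where "e = e1 \<cdot> pair C z1 f (?w \<cdot> pr1 C ?z ?f) (?g \<cdot> pr2 C ?z ?f)"
  have e_pair: "e \<cdot> pair C ?z ?f h b = e1 \<cdot> pair C z1 f (?w \<cdot> h) (?g \<cdot> b)"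
    if "fib ?z ?f h b" for h b
    using that fibD [OF that] unfolding e_def by simp
  \<comment> \<open>The equation \<open>n \<cdot> ?z = t \<cdot> ?w\<close> of the pullback says
    that a family in \<open>?z\<close>, composed with \<open>y\<close>, is the tautological section.
    So its value at \<open>b\<close> lies over \<open>b\<close> itself, which is what makes
    \<open>e\<close> an arrow over \<open>y\<close>.\<close>
  have y_e1: "y \<cdot> e1 \<cdot> pair C z1 f (?w \<cdot> h) (?g \<cdot> b) = b" if hb: "fib ?z ?f h b" for h b
  proof -
    note [simp] = fib_f [OF hb] fibD [OF hb]
    have fg: "fib g f (?z \<cdot> h) (?g \<cdot> b)" by (simp add: fib_def)
    have "y \<cdot> e1 \<cdot> pair C z1 f (?w \<cdot> h) (?g \<cdot> b) = e2 \<cdot> pair C z2 f (t \<cdot> ?w \<cdot> h) (?g \<cdot> b)"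
      using t [of "?w \<cdot> h" "?g \<cdot> b"] by simp
    also have "\<dots> = pair C g f (?z \<cdot> h) (?g \<cdot> b)"
      using n [OF fg] fg by simp
    also have "\<dots> = pair C g f (?f \<cdot> b) (?g \<cdot> b)" by simp
    also have "\<dots> = b" by (rule pair_pr_Cmp) simp_all
    finally show ?thesis .
  qed
  have "is_dep_prod ?f y ?z e"
  proof (rule is_dep_prodI)
    show "y \<cdot> e = pr2 C ?z ?f" unfolding e_def by (rule y_e1) simp
  next
    fix x k assume x [simp]: "x \<in> Arr C" "Cod C x = Cod C ?f"
      and k [simp]: "k \<in> Arr C" "Dom C k = Dom C (pr1 C x ?f)" "Cod C k = Dom C y"
        "y \<cdot> k = pr2 C x ?f"
    have y_k [simp]: "y \<cdot> k \<cdot> h = pr2 C x ?f \<cdot> h" if "h \<in> Arr C" "Cod C h = Dom C (pr1 C x ?f)" for h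
      using that assoc [of h k y] by simp
    have fibg: "fib g f (x \<cdot> h) b" if "fib (g \<cdot> x) f h b" for h b
      by (rule fib_over [OF that]) simp_all
    have fibx: "fib x ?f h (pair C g f (x \<cdot> h) b)" if "fib (g \<cdot> x) f h b" for h b
      using fibD [OF that] fibg [OF that] by (simp add: fib_def)
    have fib1: "fib (g \<cdot> x) f (pr1 C (g \<cdot> x) f) (pr2 C (g \<cdot> x) f)" by simp
    note [simp] = fibg [OF fib1] fibx [OF fib1]
    \<comment> \<open>A direction of \<open>f\<close> over \<open>g \<cdot> x\<close> is the same as
      a direction of \<open>?f\<close> over \<open>x\<close>; through this identification
      \<open>k\<close> can be transposed along \<open>f\<close>.\<close>
    let ?k = "k \<cdot> pair C x ?f (pr1 C (g \<cdot> x) f) (pair C g f (x \<cdot> pr1 C (g \<cdot> x) f) (pr2 C (g \<cdot> x) f))"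
    have k_pair: "?k \<cdot> pair C (g \<cdot> x) f h b = k \<cdot> pair C x ?f h (pair C g f (x \<cdot> h) b)"
      if "fib (g \<cdot> x) f h b" for h b
      using that fibD [OF that] by simp
    obtain m1 where [simp]: "m1 \<in> Arr C" "Dom C m1 = Dom C (g \<cdot> x)" "Cod C m1 = Dom C z1"
      "z1 \<cdot> m1 = g \<cdot> x"
      and m1: "\<And>h b. fib (g \<cdot> x) f h b \<Longrightarrow> e1 \<cdot> pair C z1 f (m1 \<cdot> h) b = ?k \<cdot> pair C (g \<cdot> x) f h b"
      by (rule is_dep_prodE [OF d1, of "g \<cdot> x" ?k]) simp_all
    \<comment> \<open>This compatibility lets \<open>x\<close> and \<open>m1\<close> be paired into
      the pullback; both arrows evaluate to the tautological section over \<open>x\<close>.\<close>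
    have "t \<cdot> m1 = n \<cdot> x"
    proof (rule is_dep_prod_eqI [OF d2])
      show "z2 \<cdot> t \<cdot> m1 = z2 \<cdot> n \<cdot> x" by (simp add: z2_t z2_n)
      fix h b assume "fib (z2 \<cdot> n \<cdot> x) f h b"
      then have hb: "fib (g \<cdot> x) f h b" by (simp add: z2_n)
      note [simp] = fibD(3,4,6-9) [OF hb]
      have fib1: "fib z1 f (m1 \<cdot> h) b" by (rule fib_over) (use hb in simp_all)
      have "e2 \<cdot> pair C z2 f (t \<cdot> m1 \<cdot> h) b = y \<cdot> e1 \<cdot> pair C z1 f (m1 \<cdot> h) b"
        using t [OF fib1] fib1 by simp
      also have "\<dots> = pair C g f (x \<cdot> h) b"
        unfolding m1 [OF hb] k_pair [OF hb] using fibx [OF hb] by simp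
      also have "\<dots> = e2 \<cdot> pair C z2 f (n \<cdot> x \<cdot> h) b"
        using n [OF fibg [OF hb]] fibg [OF hb] by simp
      finally show "e2 \<cdot> pair C z2 f ((n \<cdot> x) \<cdot> h) b = e2 \<cdot> pair C z2 f ((t \<cdot> m1) \<cdot> h) b" by simp
    qed simp_all
    then have fm [simp]: "fib n t x m1" by (simp add: fib_def)
    let ?m = "pair C n t x m1"
    have fx: "fib x ?f (pr1 C x ?f) (pr2 C x ?f)" by simp
    have fz: "fib ?z ?f (?m \<cdot> pr1 C x ?f) (pr2 C x ?f)"
      by (rule fib_over) simp_all
    have fgx: "fib (g \<cdot> x) f (pr1 C x ?f) (?g \<cdot> pr2 C x ?f)" by (simp add: fib_def)
    have "e \<cdot> pair C ?z ?f (?m \<cdot> pr1 C x ?f) (pr2 C x ?f) =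
        e1 \<cdot> pair C z1 f (?w \<cdot> ?m \<cdot> pr1 C x ?f) (?g \<cdot> pr2 C x ?f)"
      by (rule e_pair [OF fz])
    also have "?w \<cdot> ?m \<cdot> pr1 C x ?f = m1 \<cdot> pr1 C x ?f" by (rule pr_pair_Cmp) simp_all
    also have "e1 \<cdot> pair C z1 f (m1 \<cdot> pr1 C x ?f) (?g \<cdot> pr2 C x ?f) =
        k \<cdot> pair C x ?f (pr1 C x ?f) (pair C g f (x \<cdot> pr1 C x ?f) (?g \<cdot> pr2 C x ?f))"
      unfolding m1 [OF fgx] by (rule k_pair [OF fgx])
    also have "pair C g f (x \<cdot> pr1 C x ?f) (?g \<cdot> pr2 C x ?f) =
        pair C g f (?f \<cdot> pr2 C x ?f) (?g \<cdot> pr2 C x ?f)" by simp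
    also have "\<dots> = pr2 C x ?f" by (rule pair_pr_Cmp) simp_all
    also have "k \<cdot> pair C x ?f (pr1 C x ?f) (pr2 C x ?f) = k" by simp
    finally show "\<exists>m. m \<in> Arr C \<and> Dom C m = Dom C x \<and> Cod C m = Dom C ?z \<and> ?z \<cdot> m = x \<and>
        e \<cdot> pair C ?z ?f (m \<cdot> pr1 C x ?f) (pr2 C x ?f) = k"
      by (intro exI [of _ ?m]) simp
  next
    fix m m' assume [simp]: "m \<in> Arr C" "m' \<in> Arr C" "Dom C m' = Dom C m" "Cod C m = Dom C ?z"
      "Cod C m' = Dom C ?z" and z: "?z \<cdot> m' = ?z \<cdot> m"
      and ev: "\<And>h b. fib (?z \<cdot> m) ?f h b \<Longrightarrow>
          e \<cdot> pair C ?z ?f (m' \<cdot> h) b = e \<cdot> pair C ?z ?f (m \<cdot> h) b"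
    \<comment> \<open>The components along \<open>?z\<close> agree by assumption, so it remains to
      compare those in \<open>z1\<close>, by extensionality there.\<close>
    have "?w \<cdot> m' = ?w \<cdot> m"
    proof (rule is_dep_prod_eqI [OF d1])
      show "z1 \<cdot> ?w \<cdot> m' = z1 \<cdot> ?w \<cdot> m" by (simp add: z1_w z)
      fix h b assume "fib (z1 \<cdot> ?w \<cdot> m) f h b"
      then have hb: "fib (g \<cdot> ?z \<cdot> m) f h b" by (simp add: z1_w)
      note [simp] = fibD(3,4,6-9) [OF hb]
      have fg: "fib g f (?z \<cdot> m \<cdot> h) b" using fib_over [of g "?z \<cdot> m" f h b] hb by simp
      have fz: "fib (?z \<cdot> m) ?f h (pair C g f (?z \<cdot> m \<cdot> h) b)"
        using fg by (simp add: fib_def)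
      have fzm: "fib ?z ?f (m \<cdot> h) (pair C g f (?z \<cdot> m \<cdot> h) b)"
        by (rule fib_over [OF fz]) simp_all
      have fzm': "fib ?z ?f (m' \<cdot> h) (pair C g f (?z \<cdot> m \<cdot> h) b)"
        by (rule fib_over [OF fz [folded z]]) simp_all
      show "e1 \<cdot> pair C z1 f ((?w \<cdot> m) \<cdot> h) b = e1 \<cdot> pair C z1 f ((?w \<cdot> m') \<cdot> h) b"
        using ev [OF fz] fg unfolding e_pair [OF fzm] e_pair [OF fzm'] by simp
    qed simp_all
    then show "m' = m" by (intro pr_eqI [OF _ _ _ _ _ _ _ _ z]) simp_all
  qed (simp_all add: e_def)
  then show "\<exists>z e. is_dep_prod ?f y z e" by blast
qed

section \<open>Polynomials in terms of generalized elements\<close>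


text \<open>\<open>dir \<phi> a d\<close> is \<open>\<phi>\<^sup>\<sharp> (a, d)\<close>.\<close>

definition dir :: "'b pmor \<Rightarrow> 'b \<Rightarrow> 'b \<Rightarrow> 'b" where
  "dir \<phi> a d = Dir \<phi> \<cdot> pair C (Pos \<phi>) (Tgt \<phi>) a d"

lemma pmor_simps [simp]:
  assumes "is_pmor C \<phi>"
  shows "Src \<phi> \<in> Arr C" "Tgt \<phi> \<in> Arr C" "Pos \<phi> \<in> Arr C" "Dir \<phi> \<in> Arr C"
    "Dom C (Pos \<phi>) = Cod C (Src \<phi>)" "Cod C (Pos \<phi>) = Cod C (Tgt \<phi>)"
    "Dom C (Dir \<phi>) = Dom C (pr1 C (Pos \<phi>) (Tgt \<phi>))" "Cod C (Dir \<phi>) = Dom C (Src \<phi>)"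
  using assms by (auto simp: is_pmor_def Hom_def exponentiable_Arr)

lemma pmor_exponentiable:
  assumes "is_pmor C \<phi>"
  shows "exponentiable C (Src \<phi>)" "exponentiable C (Tgt \<phi>)"
  using assms by (simp_all add: is_pmor_def)

lemma is_pmorI:
  assumes "exponentiable C p" "exponentiable C q" "Src \<phi> = p" "Tgt \<phi> = q"
    and "Pos \<phi> \<in> Arr C" "Dom C (Pos \<phi>) = Cod C p" "Cod C (Pos \<phi>) = Cod C q"
    and "Dir \<phi> \<in> Arr C" "Dom C (Dir \<phi>) = Dom C (pr1 C (Pos \<phi>) q)" "Cod C (Dir \<phi>) = Dom C p"
    and "p \<cdot> Dir \<phi> = pr1 C (Pos \<phi>) q"
  shows "is_pmor C \<phi>"
  unfolding is_pmor_def Hom_def assms(3,4) using assms by blast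

lemma dir_simps [simp]:
  assumes \<phi>: "is_pmor C \<phi>" and f: "fib (Pos \<phi>) (Tgt \<phi>) a d"
  shows "dir \<phi> a d \<in> Arr C" "Dom C (dir \<phi> a d) = Dom C a" "Cod C (dir \<phi> a d) = Dom C (Src \<phi>)"
    "Src \<phi> = p \<Longrightarrow> p \<cdot> dir \<phi> a d = a"
    "h \<in> Arr C \<Longrightarrow> Cod C h = Dom C a \<Longrightarrow> dir \<phi> a d \<cdot> h = dir \<phi> (a \<cdot> h) (d \<cdot> h)"
proof -
  show "dir \<phi> a d \<in> Arr C" "Dom C (dir \<phi> a d) = Dom C a" "Cod C (dir \<phi> a d) = Dom C (Src \<phi>)"
    using assms by (simp_all add: dir_def)
  have "Src \<phi> \<cdot> Dir \<phi> = pr1 C (Pos \<phi>) (Tgt \<phi>)" using \<phi> by (simp add: is_pmor_def)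
  then have "Src \<phi> \<cdot> dir \<phi> a d = a"
    using assoc [of "pair C (Pos \<phi>) (Tgt \<phi>) a d" "Dir \<phi>" "Src \<phi>"] assms by (simp add: dir_def)
  then show "p \<cdot> dir \<phi> a d = a" if "Src \<phi> = p" using that by simp
  show "dir \<phi> a d \<cdot> h = dir \<phi> (a \<cdot> h) (d \<cdot> h)" if "h \<in> Arr C" "Cod C h = Dom C a"
    using assms that by (simp add: dir_def)
qed

lemma fib_dir [simp]:
  assumes "is_pmor C \<phi>" "fib (Pos \<phi>) (Tgt \<phi>) a d" "Src \<phi> = p" "x \<in> Arr C" "h \<in> Arr C"
    "Cod C h = Dom C x" "Cod C x = Cod C p" "x \<cdot> h = a"
  shows "fib x p h (dir \<phi> a d)"
proof -
  have "Dom C a = Dom C h" using assms by auto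
  then show ?thesis using assms dir_simps(4) [OF assms(1-3)] by (intro fibI) (auto simp del: dir_simps(4))
qed

lemma Dir_eq_dir:
  assumes "is_pmor C \<phi>"
  shows "Dir \<phi> = dir \<phi> (pr1 C (Pos \<phi>) (Tgt \<phi>)) (pr2 C (Pos \<phi>) (Tgt \<phi>))"
  using assms by (simp add: dir_def)

text \<open>The generic element, the pair of projections, recovers \<open>Dir\<close>. Equality of
  polynomial morphisms can therefore be checked on elements.\<close>

lemma pmor_eqI:
  assumes "is_pmor C \<phi>" "is_pmor C \<psi>" "Src \<phi> = Src \<psi>" "Tgt \<phi> = Tgt \<psi>" "Pos \<phi> = Pos \<psi>"
    and "\<And>a d. fib (Pos \<psi>) (Tgt \<psi>) a d \<Longrightarrow> dir \<phi> a d = dir \<psi> a d"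
  shows "\<phi> = \<psi>"
proof -
  have "Dir \<phi> = Dir \<psi>"
    unfolding Dir_eq_dir [OF assms(1)] Dir_eq_dir [OF assms(2)] assms(4,5)
    using assms(2) by (intro assms(6)) simp
  then show ?thesis using assms by (intro pmor.equality) simp_all
qed

text \<open>Replaces \<open>reindex\<close> by its effect
  \<open>(a, d) \<mapsto> (a, \<phi>^\<sharp>(x a, d))\<close>, in which no comparison of iterated
  pullbacks remains.\<close>

lemma reindex_pair:
  assumes \<phi>: "is_pmor C \<phi>" and x: "x \<in> Arr C" "Cod C x = Cod C (Src \<phi>)"
  shows "reindex C \<phi> x \<in> Arr C"
    "Dom C (reindex C \<phi> x) = Dom C (pr1 C (Pos \<phi> \<cdot> x) (Tgt \<phi>))"
    "Cod C (reindex C \<phi> x) = Dom C (pr1 C x (Src \<phi>))"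
    "fib (Pos \<phi> \<cdot> x) (Tgt \<phi>) a d \<Longrightarrow>
      reindex C \<phi> x \<cdot> pair C (Pos \<phi> \<cdot> x) (Tgt \<phi>) a d = pair C x (Src \<phi>) a (dir \<phi> (x \<cdot> a) d)"
proof -
  have *: "fib (Pos \<phi>) (Tgt \<phi>) (x \<cdot> a) d" if "fib (Pos \<phi> \<cdot> x) (Tgt \<phi>) a d" for a d
    using fib_over [OF that] assms by simp
  have **: "fib (Pos \<phi>) (Tgt \<phi>) (x \<cdot> pr1 C (Pos \<phi> \<cdot> x) (Tgt \<phi>)) (pr2 C (Pos \<phi> \<cdot> x) (Tgt \<phi>))"
    using assms by (intro *) simp
  then have eq: "reindex C \<phi> x = pair C x (Src \<phi>) (pr1 C (Pos \<phi> \<cdot> x) (Tgt \<phi>))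
      (dir \<phi> (x \<cdot> pr1 C (Pos \<phi> \<cdot> x) (Tgt \<phi>)) (pr2 C (Pos \<phi> \<cdot> x) (Tgt \<phi>)))"
    by (simp add: reindex_def Let_def dir_def)
  show "reindex C \<phi> x \<in> Arr C"
    "Dom C (reindex C \<phi> x) = Dom C (pr1 C (Pos \<phi> \<cdot> x) (Tgt \<phi>))"
    "Cod C (reindex C \<phi> x) = Dom C (pr1 C x (Src \<phi>))"
    unfolding eq using ** assms by simp_all
  show "reindex C \<phi> x \<cdot> pair C (Pos \<phi> \<cdot> x) (Tgt \<phi>) a d = pair C x (Src \<phi>) a (dir \<phi> (x \<cdot> a) d)"
    if "fib (Pos \<phi> \<cdot> x) (Tgt \<phi>) a d"
    unfolding eq using ** assms that fibD [OF that] by simp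
qed

lemma Poly_simps:
  "p \<in> Obj (Poly C) \<longleftrightarrow> exponentiable C p"
  "\<phi> \<in> Arr (Poly C) \<longleftrightarrow> is_pmor C \<phi>"
  "Dom (Poly C) = Src" "Cod (Poly C) = Tgt"
  "\<phi> \<in> Hom (Poly C) p q \<longleftrightarrow> is_pmor C \<phi> \<and> Src \<phi> = p \<and> Tgt \<phi> = q"
  by (simp_all add: Poly_def Hom_def)

lemma Poly_Cmp_simps [simp]:
  "Src (\<psi> \<cdot>\<^bsub>Poly C\<^esub> \<phi>) = Src \<phi>" "Tgt (\<psi> \<cdot>\<^bsub>Poly C\<^esub> \<phi>) = Tgt \<psi>"
  "Pos (\<psi> \<cdot>\<^bsub>Poly C\<^esub> \<phi>) = Pos \<psi> \<cdot> Pos \<phi>"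
  by (simp_all add: Poly_def)

lemma
  assumes \<phi> [simp]: "is_pmor C \<phi>" and \<psi> [simp]: "is_pmor C \<psi>" and eq [simp]: "Tgt \<phi> = Src \<psi>"
  shows is_pmor_Cmp: "is_pmor C (\<psi> \<cdot>\<^bsub>Poly C\<^esub> \<phi>)"
    and dir_Cmp: "fib (Pos \<psi> \<cdot> Pos \<phi>) (Tgt \<psi>) a d \<Longrightarrow>
      dir (\<psi> \<cdot>\<^bsub>Poly C\<^esub> \<phi>) a d = dir \<phi> a (dir \<psi> (Pos \<phi> \<cdot> a) d)"
proof -
  have pos: "Pos \<phi> \<in> Arr C" "Cod C (Pos \<phi>) = Cod C (Src \<psi>)" by simp_all
  note [simp] = reindex_pair [OF \<psi> pos]
  have Dir: "Dir (\<psi> \<cdot>\<^bsub>Poly C\<^esub> \<phi>) = Dir \<phi> \<cdot> reindex C \<psi> (Pos \<phi>)" by (simp add: Poly_def)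
  have fib: "fib (Pos \<psi>) (Tgt \<psi>) (Pos \<phi> \<cdot> a) d" if "fib (Pos \<psi> \<cdot> Pos \<phi>) (Tgt \<psi>) a d" for a d
    using fib_over [OF that] by simp
  show *: "dir (\<psi> \<cdot>\<^bsub>Poly C\<^esub> \<phi>) a d = dir \<phi> a (dir \<psi> (Pos \<phi> \<cdot> a) d)"
    if "fib (Pos \<psi> \<cdot> Pos \<phi>) (Tgt \<psi>) a d" for a d
    unfolding dir_def [of "\<psi> \<cdot>\<^bsub>Poly C\<^esub> \<phi>"] dir_def [of \<phi>]
    using that fib [OF that] fibD [OF that] by (simp add: Dir)
  let ?a = "pr1 C (Pos \<psi> \<cdot> Pos \<phi>) (Tgt \<psi>)" and ?d = "pr2 C (Pos \<psi> \<cdot> Pos \<phi>) (Tgt \<psi>)"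
  have f: "fib (Pos \<psi> \<cdot> Pos \<phi>) (Tgt \<psi>) ?a ?d" by simp
  note [simp] = fib [OF f]
  \<comment> \<open>The composite direction map is its own value at the generic element; its typing
    and its compatibility with the source can then be read off from those of
    \<open>dir\<close>.\<close>
  have **: "Dir (\<psi> \<cdot>\<^bsub>Poly C\<^esub> \<phi>) = dir \<phi> ?a (dir \<psi> (Pos \<phi> \<cdot> ?a) ?d)"
    unfolding * [OF f, symmetric] by (simp add: dir_def Dir)
  show "is_pmor C (\<psi> \<cdot>\<^bsub>Poly C\<^esub> \<phi>)"
    by (rule is_pmorI [of "Src \<phi>" "Tgt \<psi>"]) (simp_all add: pmor_exponentiable **)
qed

lemma Poly_Idn:
  assumes p: "exponentiable C p"
  shows is_pmor_Idn: "is_pmor C (Idn (Poly C) p)"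
    and dir_Idn: "fib (Idn C (Cod C p)) p a d \<Longrightarrow> dir (Idn (Poly C) p) a d = d"
    and Idn_Poly_simps: "Src (Idn (Poly C) p) = p" "Tgt (Idn (Poly C) p) = p"
      "Pos (Idn (Poly C) p) = Idn C (Cod C p)"
proof -
  have [simp]: "p \<in> Arr C" by (rule exponentiable_Arr [OF p])
  show *: "Src (Idn (Poly C) p) = p" "Tgt (Idn (Poly C) p) = p"
      "Pos (Idn (Poly C) p) = Idn C (Cod C p)" by (simp_all add: Poly_def)
  have Dir: "Dir (Idn (Poly C) p) = pr2 C (Idn C (Cod C p)) p" by (simp add: Poly_def)
  show "is_pmor C (Idn (Poly C) p)"
    by (rule is_pmorI [OF p p]) (simp_all add: * Dir)
  show "dir (Idn (Poly C) p) a d = d" if "fib (Idn C (Cod C p)) p a d"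
    using that by (simp add: dir_def * Dir)
qed

text \<open>Serves to make inverses in \<open>Poly C\<close> unique, so that
  \<open>inv_arr (Poly C)\<close> can be computed from an explicit inverse.\<close>

lemma category_Poly: "category (Poly C)"
proof
  show "(\<theta> \<cdot>\<^bsub>Poly C\<^esub> \<psi>) \<cdot>\<^bsub>Poly C\<^esub> \<phi> = \<theta> \<cdot>\<^bsub>Poly C\<^esub> (\<psi> \<cdot>\<^bsub>Poly C\<^esub> \<phi>)"
    if \<phi>: "\<phi> \<in> Hom (Poly C) p q" and \<psi>: "\<psi> \<in> Hom (Poly C) q r" and \<theta>: "\<theta> \<in> Hom (Poly C) r s"
    for \<phi> \<psi> \<theta> p q r s
  proof (rule pmor_eqI)
    note [simp] = \<phi> [unfolded Poly_simps, THEN conjunct1] \<phi> [unfolded Poly_simps, THEN conjunct2, THEN conjunct1]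
      \<phi> [unfolded Poly_simps, THEN conjunct2, THEN conjunct2]
      \<psi> [unfolded Poly_simps, THEN conjunct1] \<psi> [unfolded Poly_simps, THEN conjunct2, THEN conjunct1]
      \<psi> [unfolded Poly_simps, THEN conjunct2, THEN conjunct2]
      \<theta> [unfolded Poly_simps, THEN conjunct1] \<theta> [unfolded Poly_simps, THEN conjunct2, THEN conjunct1]
      \<theta> [unfolded Poly_simps, THEN conjunct2, THEN conjunct2]
    show "is_pmor C ((\<theta> \<cdot>\<^bsub>Poly C\<^esub> \<psi>) \<cdot>\<^bsub>Poly C\<^esub> \<phi>)" "is_pmor C (\<theta> \<cdot>\<^bsub>Poly C\<^esub> (\<psi> \<cdot>\<^bsub>Poly C\<^esub> \<phi>))"
      by (simp_all add: is_pmor_Cmp)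
    fix a d assume "fib (Pos (\<theta> \<cdot>\<^bsub>Poly C\<^esub> (\<psi> \<cdot>\<^bsub>Poly C\<^esub> \<phi>))) (Tgt (\<theta> \<cdot>\<^bsub>Poly C\<^esub> (\<psi> \<cdot>\<^bsub>Poly C\<^esub> \<phi>))) a d"
    then have f1: "fib (Pos \<theta> \<cdot> Pos \<psi> \<cdot> Pos \<phi>) s a d" by simp
    note [simp] = fibD(3,4,6-8) [OF f1]
    have f2: "fib (Pos \<theta> \<cdot> Pos \<psi>) s (Pos \<phi> \<cdot> a) d"
      by (rule fib_over) (use f1 in simp_all)
    have f3: "fib (Pos \<theta>) s (Pos \<psi> \<cdot> Pos \<phi> \<cdot> a) d"
      by (rule fib_over) (use f2 in simp_all)
    have f4: "fib (Pos \<psi> \<cdot> Pos \<phi>) r a (dir \<theta> (Pos \<psi> \<cdot> Pos \<phi> \<cdot> a) d)"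
      using f3 by simp
    show "dir ((\<theta> \<cdot>\<^bsub>Poly C\<^esub> \<psi>) \<cdot>\<^bsub>Poly C\<^esub> \<phi>) a d = dir (\<theta> \<cdot>\<^bsub>Poly C\<^esub> (\<psi> \<cdot>\<^bsub>Poly C\<^esub> \<phi>)) a d"
      using f1 f2 f3 f4 by (simp add: dir_Cmp is_pmor_Cmp)
  qed (use that in \<open>simp_all add: Poly_simps\<close>)
  show "\<psi> \<cdot>\<^bsub>Poly C\<^esub> \<phi> \<in> Hom (Poly C) p r"
    if "\<phi> \<in> Hom (Poly C) p q" "\<psi> \<in> Hom (Poly C) q r" for \<phi> \<psi> p q r
    using that by (simp add: Poly_simps is_pmor_Cmp)
  show "\<phi> \<cdot>\<^bsub>Poly C\<^esub> Idn (Poly C) p = \<phi>" "Idn (Poly C) q \<cdot>\<^bsub>Poly C\<^esub> \<phi> = \<phi>"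
    if "\<phi> \<in> Hom (Poly C) p q" for \<phi> p q
  proof -
    have [simp]: "is_pmor C \<phi>" "Src \<phi> = p" "Tgt \<phi> = q" using that by (simp_all add: Poly_simps)
    have p: "exponentiable C p" and q: "exponentiable C q"
      using pmor_exponentiable [of \<phi>] by simp_all
    note [simp] = Poly_Idn(1,3-) [OF p] Poly_Idn(1,3-) [OF q] exponentiable_Arr [OF p] exponentiable_Arr [OF q]
    show "\<phi> \<cdot>\<^bsub>Poly C\<^esub> Idn (Poly C) p = \<phi>"
    proof (rule pmor_eqI)
      fix a d assume "fib (Pos \<phi>) (Tgt \<phi>) a d"
      then have f: "fib (Pos \<phi>) q a d" by simp
      note [simp] = fibD(3,4,6-8) [OF f]
      show "dir (\<phi> \<cdot>\<^bsub>Poly C\<^esub> Idn (Poly C) p) a d = dir \<phi> a d"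
        using f by (simp add: dir_Cmp dir_Idn [OF p])
    qed (simp_all add: is_pmor_Cmp)
    show "Idn (Poly C) q \<cdot>\<^bsub>Poly C\<^esub> \<phi> = \<phi>"
    proof (rule pmor_eqI)
      fix a d assume "fib (Pos \<phi>) (Tgt \<phi>) a d"
      then have f: "fib (Pos \<phi>) q a d" by simp
      note [simp] = fibD(3,4,6-8) [OF f]
      have "fib (Idn C (Cod C q)) q (Pos \<phi> \<cdot> a) d" using fibD(9) [OF f] by (simp add: fib_def)
      then show "dir (Idn (Poly C) q \<cdot>\<^bsub>Poly C\<^esub> \<phi>) a d = dir \<phi> a d"
        using f by (simp add: dir_Cmp dir_Idn [OF q])
    qed (simp_all add: is_pmor_Cmp)
  qed
  show "Idn (Poly C) p \<in> Hom (Poly C) p p" if "p \<in> Obj (Poly C)" for p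
    using that by (simp add: Poly_simps Poly_Idn)
qed (simp_all add: Poly_simps pmor_exponentiable)

section \<open>The composition product in terms of generalized elements\<close>


lemma prod_simps [simp]:
  assumes "A \<in> Obj C" "B \<in> Obj C"
  shows "prod_fst C A B \<in> Arr C" "Cod C (prod_fst C A B) = A"
    "prod_snd C A B \<in> Arr C" "Cod C (prod_snd C A B) = B"
    "Dom C (prod_snd C A B) = Dom C (prod_fst C A B)"
  using is_product_chosen [OF assms] by (auto simp: is_product_def Hom_def)

lemma prod_ex1:
  assumes "u \<in> Arr C" "v \<in> Arr C" "Dom C v = Dom C u"
  shows "\<exists>!h. h \<in> Hom C (Dom C u) (Dom C (prod_fst C (Cod C u) (Cod C v))) \<and>
    prod_fst C (Cod C u) (Cod C v) \<cdot> h = u \<and> prod_snd C (Cod C u) (Cod C v) \<cdot> h = v"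
proof -
  have "is_product C (Cod C u) (Cod C v) (prod_fst C (Cod C u) (Cod C v)) (prod_snd C (Cod C u) (Cod C v))"
    using assms by (simp add: is_product_chosen)
  note * = this [unfolded is_product_def, THEN conjunct2, THEN conjunct2]
  show ?thesis by (rule * [rule_format]) (simp_all add: assms)
qed

lemma prod_eqI:
  assumes "A \<in> Obj C" "B \<in> Obj C" "h \<in> Arr C" "k \<in> Arr C" "Dom C h = Dom C k"
    "Cod C h = Dom C (prod_fst C A B)" "Cod C k = Dom C (prod_fst C A B)"
    "prod_fst C A B \<cdot> h = prod_fst C A B \<cdot> k" "prod_snd C A B \<cdot> h = prod_snd C A B \<cdot> k"
  shows "h = k"
proof -
  have "\<exists>!n. n \<in> Hom C (Dom C k) (Dom C (prod_fst C A B)) \<and>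
    prod_fst C A B \<cdot> n = prod_fst C A B \<cdot> k \<and> prod_snd C A B \<cdot> n = prod_snd C A B \<cdot> k"
    using prod_ex1 [of "prod_fst C A B \<cdot> k" "prod_snd C A B \<cdot> k"] assms by simp
  moreover have "h \<in> Hom C (Dom C k) (Dom C (prod_fst C A B))"
    "k \<in> Hom C (Dom C k) (Dom C (prod_fst C A B))"
    using assms by (simp_all add: Hom_def)
  ultimately show ?thesis using assms(8,9) by blast
qed

section \<open>Positions and directions of the composition product\<close>

lemma tri_is_dep_prod:
  assumes "exponentiable C p" "exponentiable C q"
  shows "is_dep_prod p (prod_snd C (Cod C q) (Dom C p)) (tri_base C p q)
    (dep_counit C p (prod_snd C (Cod C q) (Dom C p)))"
  unfolding tri_base_def
  by (rule is_dep_prod_chosen [OF assms(1)]) (use assms in \<open>simp_all add: exponentiable_Arr\<close>)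

lemma tri_base_simps [simp]:
  assumes "exponentiable C p" "exponentiable C q"
  shows "tri_base C p q \<in> Arr C" "Cod C (tri_base C p q) = Cod C p"
  using is_dep_prodD [OF tri_is_dep_prod [OF assms]] by simp_all

lemma tri_ev_simps [simp]:
  assumes "exponentiable C p" "exponentiable C q"
  shows "tri_ev C p q \<in> Arr C" "Dom C (tri_ev C p q) = Dom C (pr1 C (tri_base C p q) p)"
    "Cod C (tri_ev C p q) = Cod C q"
  using is_dep_prodD [OF tri_is_dep_prod [OF assms]] exponentiable_Arr assms
  by (simp_all add: tri_ev_def)

text \<open>The dependent product classifies arrows to the product of \<open>Cod C q\<close> and
  \<open>Dom C p\<close> over \<open>Dom C p\<close>. The second component of such an arrow is
  forced to be the projection \<open>pr2 C x p\<close>, so it amounts to an arrow \<open>f\<close>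
  into \<open>Cod C q\<close>.\<close>

lemma tri_elem_ex1:
  assumes p: "exponentiable C p" and q: "exponentiable C q"
    and x: "x \<in> Arr C" "Cod C x = Cod C p"
    and f: "f \<in> Arr C" "Dom C f = Dom C (pr1 C x p)" "Cod C f = Cod C q"
  shows "\<exists>!m. m \<in> Hom C (Dom C x) (Dom C (tri_base C p q)) \<and>
        tri_base C p q \<cdot> m = x \<and>
        tri_ev C p q \<cdot> base_change C p x (tri_base C p q) m = f"
proof -
  note [simp] = exponentiable_Arr [OF p] exponentiable_Arr [OF q] p q x f
  let ?b = "tri_base C p q"
  let ?fst = "prod_fst C (Cod C q) (Dom C p)" and ?snd = "prod_snd C (Cod C q) (Dom C p)"
  let ?e = "dep_counit C p ?snd"
  note d = tri_is_dep_prod [OF p q]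
  note [simp] = is_dep_prodD [OF d]
  obtain k where k: "k \<in> Arr C" "Dom C k = Dom C (pr1 C x p)" "Cod C k = Dom C ?fst"
    "?fst \<cdot> k = f" "?snd \<cdot> k = pr2 C x p"
    using prod_ex1 [of f "pr2 C x p"] by (auto simp: Hom_def)
  \<comment> \<open>Evaluation followed by \<open>?snd\<close> is always the projection; hence
    agreement in the first component already gives agreement with \<open>k\<close>.\<close>
  have ev: "tri_ev C p q \<cdot> base_change C p x ?b m = f \<longleftrightarrow> ?e \<cdot> base_change C p x ?b m = k"
    if m [simp]: "m \<in> Arr C" "Dom C m = Dom C x" "Cod C m = Dom C ?b" "?b \<cdot> m = x" for m
  proof -
    note [simp] = base_change_simps [of p ?b m x]
    have fib: "fib ?b p (m \<cdot> pr1 C x p) (pr2 C x p)" by (rule fib_base_change) simp_all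
    have 1: "?snd \<cdot> ?e \<cdot> base_change C p x ?b m = ?snd \<cdot> k"
      using is_dep_prod_Cmp [OF d, of "base_change C p x ?b m"] fib by (simp add: k base_change_def)
    have 2: "tri_ev C p q \<cdot> base_change C p x ?b m = ?fst \<cdot> ?e \<cdot> base_change C p x ?b m"
      by (simp add: tri_ev_def)
    show ?thesis
      unfolding 2
      by (rule iffI, rule prod_eqI [of "Cod C q" "Dom C p"]) (simp_all add: 1 k)
  qed
  have "\<exists>!m. m \<in> Arr C \<and> Dom C m = Dom C x \<and> Cod C m = Dom C ?b \<and> ?b \<cdot> m = x \<and>
    ?e \<cdot> base_change C p x ?b m = k"
    by (rule is_dep_prod_ex1 [OF d]) (simp_all add: k)
  then show ?thesis using ev unfolding Hom_def mem_Collect_eq by (simp cong: conj_cong)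
qed

lemma tri_elem_aux:
  assumes "exponentiable C p" "exponentiable C q" "x \<in> Arr C" "Cod C x = Cod C p"
    "f \<in> Arr C" "Dom C f = Dom C (pr1 C x p)" "Cod C f = Cod C q"
  shows "tri_elem C p q x f \<in> Hom C (Dom C x) (Dom C (tri_base C p q)) \<and>
    tri_base C p q \<cdot> tri_elem C p q x f = x \<and>
    tri_ev C p q \<cdot> base_change C p x (tri_base C p q) (tri_elem C p q x f) = f"
  unfolding tri_elem_def by (rule theI') (rule tri_elem_ex1 [OF assms])

text \<open>A position \<open>m\<close> of \<open>p \<triangleleft> q\<close> is a pair \<open>(x, f)\<close> with \<open>x = tri_base C p q \<cdot> m\<close> and \<open>f y = tap p q m y\<close>;
  \<open>tdir p q m y z\<close> is the direction \<open>(y, z)\<close> at \<open>m\<close>.\<close>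

definition tap :: "'b \<Rightarrow> 'b \<Rightarrow> 'b \<Rightarrow> 'b \<Rightarrow> 'b" where
  "tap p q m y = tri_ev C p q \<cdot> pair C (tri_base C p q) p m y"

definition tfib :: "'b \<Rightarrow> 'b \<Rightarrow> 'b \<Rightarrow> 'b \<Rightarrow> 'b \<Rightarrow> bool" where
  "tfib p q m y z \<longleftrightarrow> fib (tri_base C p q) p m y \<and> z \<in> Arr C \<and> Dom C z = Dom C m \<and>
    Cod C z = Dom C q \<and> q \<cdot> z = tap p q m y"

definition tdir :: "'b \<Rightarrow> 'b \<Rightarrow> 'b \<Rightarrow> 'b \<Rightarrow> 'b \<Rightarrow> 'b" where
  "tdir p q m y z = pair C (tri_ev C p q) q (pair C (tri_base C p q) p m y) z"

definition tfst :: "'b \<Rightarrow> 'b \<Rightarrow> 'b \<Rightarrow> 'b" where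
  "tfst p q d = pr2 C (tri_base C p q) p \<cdot> pr1 C (tri_ev C p q) q \<cdot> d"

definition tsnd :: "'b \<Rightarrow> 'b \<Rightarrow> 'b \<Rightarrow> 'b" where
  "tsnd p q d = pr2 C (tri_ev C p q) q \<cdot> d"

lemma tap_simps [simp]:
  assumes "exponentiable C p" "exponentiable C q" and f: "fib (tri_base C p q) p m y"
  shows "tap p q m y \<in> Arr C" "Dom C (tap p q m y) = Dom C m" "Cod C (tap p q m y) = Cod C q"
    "h \<in> Arr C \<Longrightarrow> Cod C h = Dom C m \<Longrightarrow> tap p q m y \<cdot> h = tap p q (m \<cdot> h) (y \<cdot> h)"
  using assms fibD [OF f] by (simp_all add: tap_def)

lemma tri_elem_simps [simp]:
  assumes p: "exponentiable C p" and q: "exponentiable C q"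
    and x: "x \<in> Arr C" "Cod C x = Cod C p"
    and f: "f \<in> Arr C" "Dom C f = Dom C (pr1 C x p)" "Cod C f = Cod C q"
  shows "tri_elem C p q x f \<in> Arr C" "Dom C (tri_elem C p q x f) = Dom C x"
    "Cod C (tri_elem C p q x f) = Dom C (tri_base C p q)"
    "tri_base C p q \<cdot> tri_elem C p q x f = x"
  using tri_elem_aux [OF assms] by (simp_all add: Hom_def)

text \<open>The computation rule for positions of the composition product, inherited from the
  dependent product.\<close>

lemma tap_tri_elem:
  assumes p: "exponentiable C p" and q: "exponentiable C q"
    and x: "x \<in> Arr C" "Cod C x = Cod C p"
    and f: "f \<in> Arr C" "Dom C f = Dom C (pr1 C x p)" "Cod C f = Cod C q"
    and hy: "fib x p h y"
  shows "tap p q (tri_elem C p q x f \<cdot> h) y = f \<cdot> pair C x p h y"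
proof -
  let ?b = "tri_base C p q" and ?m = "tri_elem C p q x f"
  note [simp] = p q x f exponentiable_Arr [OF p] fibD(3,4,6-8) [OF hy]
  have "f \<cdot> pair C x p h y = (tri_ev C p q \<cdot> base_change C p x ?b ?m) \<cdot> pair C x p h y"
    using tri_elem_aux [OF p q x f] by simp
  also have "\<dots> = tri_ev C p q \<cdot> base_change C p x ?b ?m \<cdot> pair C x p h y"
    by (rule assoc) (use hy in \<open>simp_all add: base_change_simps\<close>)
  also have "base_change C p x ?b ?m \<cdot> pair C x p h y = pair C ?b p (?m \<cdot> h) y"
    by (rule base_change_Cmp_pair) (use hy in simp_all)
  finally show ?thesis by (simp add: tap_def)
qed

text \<open>Extensionality for positions: the hypothesis gives the first components of the
  evaluations, and the second ones are the same projection.\<close>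

lemma tri_base_eqI:
  assumes p: "exponentiable C p" and q: "exponentiable C q"
    and m: "m \<in> Arr C" "Cod C m = Dom C (tri_base C p q)"
    and m': "m' \<in> Arr C" "Cod C m' = Dom C (tri_base C p q)"
    and base: "tri_base C p q \<cdot> m' = tri_base C p q \<cdot> m"
    and tap: "\<And>h y. fib (tri_base C p q \<cdot> m) p h y \<Longrightarrow> tap p q (m' \<cdot> h) y = tap p q (m \<cdot> h) y"
  shows "m' = m"
proof (rule is_dep_prod_eqI [OF tri_is_dep_prod [OF p q] _ _ _ m m' base])
  note [simp] = p q m m' exponentiable_Arr [OF p] exponentiable_Arr [OF q]
  note [simp] = is_dep_prodD [OF tri_is_dep_prod [OF p q]]
  show "p \<in> Arr C" "prod_snd C (Cod C q) (Dom C p) \<in> Arr C"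
    "Cod C (prod_snd C (Cod C q) (Dom C p)) = Dom C p" by simp_all
  fix h b assume hb: "fib (tri_base C p q \<cdot> m) p h b"
  have fib1: "fib (tri_base C p q) p (m \<cdot> h) b" by (rule fib_over [OF hb]) simp_all
  have fib2: "fib (tri_base C p q) p (m' \<cdot> h) b" by (rule fib_over [OF hb [folded base]]) simp_all
  have dom: "Dom C m' = Dom C m"
    using arg_cong [OF base, of "Dom C"] by simp
  note [simp] = fibD(3,4,6-8) [OF hb] fib1 fib2
  let ?e = "dep_counit C p (prod_snd C (Cod C q) (Dom C p))"
  have "prod_fst C (Cod C q) (Dom C p) \<cdot> ?e \<cdot> pair C (tri_base C p q) p (n \<cdot> h) b = tap p q (n \<cdot> h) b"
    if "fib (tri_base C p q) p (n \<cdot> h) b" for n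
    using that by (simp add: tap_def tri_ev_def)
  then have "prod_fst C (Cod C q) (Dom C p) \<cdot> ?e \<cdot> pair C (tri_base C p q) p (m \<cdot> h) b =
      prod_fst C (Cod C q) (Dom C p) \<cdot> ?e \<cdot> pair C (tri_base C p q) p (m' \<cdot> h) b"
    using tap [OF hb] by simp
  then show "?e \<cdot> pair C (tri_base C p q) p (m \<cdot> h) b = ?e \<cdot> pair C (tri_base C p q) p (m' \<cdot> h) b"
    by - (rule prod_eqI [of "Cod C q" "Dom C p"], simp_all add: dom is_dep_prod_Cmp [OF tri_is_dep_prod [OF p q]])
qed

lemma tri_simps [simp]:
  assumes "exponentiable C p" "exponentiable C q"
  shows "tri C p q \<in> Arr C" "Cod C (tri C p q) = Dom C (tri_base C p q)"
  using assms exponentiable_Arr by (simp_all add: tri_def)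

lemma Dom_tri:
  assumes "exponentiable C p" "exponentiable C q"
  shows "Dom C (tri C p q) = Dom C (pr1 C (tri_ev C p q) q)"
  using assms exponentiable_Arr by (simp_all add: tri_def)

text \<open>\<open>tri C p q\<close> is a pullback of \<open>q\<close> followed by a pullback of
  \<open>p\<close>.\<close>

lemma exponentiable_tri:
  assumes "exponentiable C p" "exponentiable C q"
  shows "exponentiable C (tri C p q)"
  unfolding tri_def using assms exponentiable_Arr
  by (intro exponentiable_Cmp exponentiable_pr1) simp_all

lemma tfibD:
  assumes "tfib p q m y z"
  shows "fib (tri_base C p q) p m y" "m \<in> Arr C" "y \<in> Arr C" "z \<in> Arr C"
    "Dom C z = Dom C m" "Dom C y = Dom C m" "Cod C m = Dom C (tri_base C p q)"
    "Cod C y = Dom C p" "Cod C z = Dom C q" "q \<cdot> z = tap p q m y"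
  using assms by (simp_all add: tfib_def fib_def)

lemma tdir_simps [simp]:
  assumes p: "exponentiable C p" and q: "exponentiable C q" and f: "tfib p q m y z"
  shows "tdir p q m y z \<in> Arr C" "Dom C (tdir p q m y z) = Dom C m"
    "Cod C (tdir p q m y z) = Dom C (tri C p q)" "tri C p q \<cdot> tdir p q m y z = m"
    "tfst p q (tdir p q m y z) = y" "tsnd p q (tdir p q m y z) = z"
    "h \<in> Arr C \<Longrightarrow> Cod C h = Dom C m \<Longrightarrow>
      tdir p q m y z \<cdot> h = tdir p q (m \<cdot> h) (y \<cdot> h) (z \<cdot> h)"
proof -
  note [simp] = p q exponentiable_Arr [OF p] exponentiable_Arr [OF q] tfibD(1-9) [OF f]
  have [simp]: "fib (tri_ev C p q) q (pair C (tri_base C p q) p m y) z"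
    using f by (intro fibI) (simp_all add: tfib_def tap_def)
  show "tdir p q m y z \<in> Arr C" "Dom C (tdir p q m y z) = Dom C m"
    "Cod C (tdir p q m y z) = Dom C (tri C p q)"
    "tfst p q (tdir p q m y z) = y" "tsnd p q (tdir p q m y z) = z"
    by (simp_all add: tdir_def tfst_def tsnd_def Dom_tri)
  show "tri C p q \<cdot> tdir p q m y z = m" by (simp add: tdir_def tri_def)
  show "tdir p q m y z \<cdot> h = tdir p q (m \<cdot> h) (y \<cdot> h) (z \<cdot> h)"
    if "h \<in> Arr C" "Cod C h = Dom C m"
    using that by (simp add: tdir_def)
qed

lemma
  assumes p: "exponentiable C p" and q: "exponentiable C q"
    and d: "d \<in> Arr C" "Cod C d = Dom C (tri C p q)" and h: "h \<in> Arr C" "Cod C h = Dom C d"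
  shows tfst_Cmp: "tfst p q d \<cdot> h = tfst p q (d \<cdot> h)"
    and tsnd_Cmp: "tsnd p q d \<cdot> h = tsnd p q (d \<cdot> h)"
  using assms exponentiable_Arr [OF p] exponentiable_Arr [OF q]
  by (simp_all add: tfst_def tsnd_def Dom_tri)

lemma tfib_Cmp [simp]:
  assumes "exponentiable C p" "exponentiable C q" "tfib p q m y z" "h \<in> Arr C" "Cod C h = Dom C m"
  shows "tfib p q (m \<cdot> h) (y \<cdot> h) (z \<cdot> h)"
  using tfibD [OF assms(3)] assms exponentiable_Arr [OF assms(2)] assoc [of h z q]
  by (simp add: tfib_def)

text \<open>Surjective pairing for the iterated pullback on which \<open>tri\<close> is defined; it
  lets an arbitrary direction be treated as a pair \<open>(y, z)\<close>.\<close>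

lemma tdir_split:
  assumes p: "exponentiable C p" and q: "exponentiable C q"
    and d: "d \<in> Arr C" "Cod C d = Dom C (tri C p q)" "tri C p q \<cdot> d = m"
  shows "tfib p q m (tfst p q d) (tsnd p q d)" "tdir p q m (tfst p q d) (tsnd p q d) = d"
proof -
  note [simp] = p q exponentiable_Arr [OF p] exponentiable_Arr [OF q] d(1)
    d(2) [unfolded Dom_tri [OF p q]]
  have m: "m = pr1 C (tri_base C p q) p \<cdot> pr1 C (tri_ev C p q) q \<cdot> d"
    using d(3) by (simp add: tri_def)
  show "tfib p q m (tfst p q d) (tsnd p q d)" "tdir p q m (tfst p q d) (tsnd p q d) = d"
    unfolding m by (simp_all add: tfib_def tdir_def tfst_def tsnd_def tap_def)
qed

text \<open>The definition of \<open>tri_mor\<close> fixes it at the generic position and direction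
  only. Restriction along the arrow classifying a given element extends the formulas to all
  elements, and later arguments rely on those alone.\<close>

lemma
  assumes \<phi> [simp]: "is_pmor C \<phi>" "Src \<phi> = p" "Tgt \<phi> = p'"
    and \<psi> [simp]: "is_pmor C \<psi>" "Src \<psi> = q" "Tgt \<psi> = q'"
  shows is_pmor_tri_mor: "is_pmor C (tri_mor C \<phi> \<psi>)"
    and tri_mor_simps: "Src (tri_mor C \<phi> \<psi>) = tri C p q" "Tgt (tri_mor C \<phi> \<psi>) = tri C p' q'"
      "tri_base C p' q' \<cdot> Pos (tri_mor C \<phi> \<psi>) = Pos \<phi> \<cdot> tri_base C p q"
    and tap_Pos_tri_mor: "fib (Pos \<phi> \<cdot> tri_base C p q) p' h y \<Longrightarrow>
      tap p' q' (Pos (tri_mor C \<phi> \<psi>) \<cdot> h) y = Pos \<psi> \<cdot> tap p q h (dir \<phi> (tri_base C p q \<cdot> h) y)"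
    and dir_tri_mor: "\<lbrakk>a \<in> Arr C; Cod C a = Dom C (tri_base C p q);
        tfib p' q' (Pos (tri_mor C \<phi> \<psi>) \<cdot> a) y z\<rbrakk> \<Longrightarrow>
      dir (tri_mor C \<phi> \<psi>) a (tdir p' q' (Pos (tri_mor C \<phi> \<psi>) \<cdot> a) y z) =
      tdir p q a (dir \<phi> (tri_base C p q \<cdot> a) y)
        (dir \<psi> (tap p q a (dir \<phi> (tri_base C p q \<cdot> a) y)) z)"
proof -
  have exp [simp]: "exponentiable C p" "exponentiable C p'" "exponentiable C q" "exponentiable C q'"
    using pmor_exponentiable [OF \<phi>(1)] pmor_exponentiable [OF \<psi>(1)] by simp_all
  note [simp] = exp [THEN exponentiable_Arr]
  let ?b = "tri_base C p q" and ?f = "tri_ev C p q" and ?M = "tri_mor C \<phi> \<psi>"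
  let ?m = "tri_elem C p' q' (Pos \<phi> \<cdot> ?b) (Pos \<psi> \<cdot> ?f \<cdot> reindex C \<phi> ?b)"
  show src: "Src ?M = tri C p q" and tgt: "Tgt ?M = tri C p' q'"
    by (simp_all add: tri_mor_def Let_def)
  have pos: "Pos ?M = ?m" by (simp add: tri_mor_def Let_def)
  note re = reindex_pair [OF \<phi>(1), of ?b, unfolded \<phi>(2,3)]
  note [simp] = re(1-3)
  have m [simp]: "?m \<in> Arr C" "Dom C ?m = Dom C ?b" "Cod C ?m = Dom C (tri_base C p' q')"
      "tri_base C p' q' \<cdot> ?m = Pos \<phi> \<cdot> ?b"
    using tri_elem_simps [of p' q' "Pos \<phi> \<cdot> ?b" "Pos \<psi> \<cdot> ?f \<cdot> reindex C \<phi> ?b"] by simp_all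
  show "tri_base C p' q' \<cdot> Pos ?M = Pos \<phi> \<cdot> ?b" by (simp add: pos)
  have fib1: "fib (Pos \<phi>) p' (?b \<cdot> h) y" if "fib (Pos \<phi> \<cdot> ?b) p' h y" for h y
    using fib_over [OF that] by simp
  have fib2: "fib ?b p h (dir \<phi> (?b \<cdot> h) y)" if "fib (Pos \<phi> \<cdot> ?b) p' h y" for h y
    using fib1 [OF that] fibD [OF that] by simp
  have re_pair: "reindex C \<phi> ?b \<cdot> pair C (Pos \<phi> \<cdot> ?b) p' h y = pair C ?b p h (dir \<phi> (?b \<cdot> h) y)"
    if "fib (Pos \<phi> \<cdot> ?b) p' h y" for h y
    using re(4) [OF _ _ that] by simp
  show tap: "tap p' q' (Pos ?M \<cdot> h) y = Pos \<psi> \<cdot> tap p q h (dir \<phi> (?b \<cdot> h) y)"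
    if "fib (Pos \<phi> \<cdot> ?b) p' h y" for h y
  proof -
    have "tap p' q' (?m \<cdot> h) y = (Pos \<psi> \<cdot> ?f \<cdot> reindex C \<phi> ?b) \<cdot> pair C (Pos \<phi> \<cdot> ?b) p' h y"
      by (rule tap_tri_elem) (simp_all add: that)
    also have "\<dots> = Pos \<psi> \<cdot> ?f \<cdot> reindex C \<phi> ?b \<cdot> pair C (Pos \<phi> \<cdot> ?b) p' h y"
      using that fibD [OF that] by simp
    also have "\<dots> = Pos \<psi> \<cdot> tap p q h (dir \<phi> (?b \<cdot> h) y)"
      by (simp add: re_pair [OF that] tap_def)
    finally show ?thesis by (simp add: pos)
  qed
  \<comment> \<open>\<open>Y\<close> is \<phi>^\<sharp>(x, y'), and the next constant
    \<open>Z\<close> is \<psi>^\<sharp>(f(\<phi>^\<sharp>(x, y')), z').\<close>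
  define Y where "Y a y = dir \<phi> (?b \<cdot> a) y" for a y
  define Z where "Z a y z = dir \<psi> (tap p q a (Y a y)) z" for a y z
  have tf: "fib (Pos \<phi> \<cdot> ?b) p' a y" "fib (Pos \<phi>) p' (?b \<cdot> a) y" "fib ?b p a (Y a y)"
      "fib (Pos \<psi>) q' (tap p q a (Y a y)) z" "tfib p q a (Y a y) (Z a y z)"
    if a: "a \<in> Arr C" "Cod C a = Dom C ?b" and yz: "tfib p' q' (?m \<cdot> a) y z" for a y z
  proof -
    note [simp] = a tfibD(3-6,8,9) [OF yz]
    have "tri_base C p' q' \<cdot> ?m \<cdot> a = (Pos \<phi> \<cdot> ?b) \<cdot> a"
      by (subst assoc [symmetric]) (simp_all del: assoc)
    then show f: "fib (Pos \<phi> \<cdot> ?b) p' a y" using fibD(9) [OF tfibD(1) [OF yz]] by (simp add: fib_def)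
    show f': "fib (Pos \<phi>) p' (?b \<cdot> a) y" by (rule fib1 [OF f])
    show f2: "fib ?b p a (Y a y)" unfolding Y_def by (rule fib2 [OF f])
    note [simp] = f2
    have "q' \<cdot> z = Pos \<psi> \<cdot> tap p q a (Y a y)"
      using tfibD(10) [OF yz] tap [OF f] by (simp only: pos Y_def)
    then show f3: "fib (Pos \<psi>) q' (tap p q a (Y a y)) z" by (intro fibI) simp_all
    show "tfib p q a (Y a y) (Z a y z)"
      unfolding tfib_def Z_def using f3 by simp
  qed
  let ?a = "pr1 C ?m (tri C p' q')" and ?d = "pr2 C ?m (tri C p' q')"
  let ?y = "tfst p' q' ?d" and ?z = "tsnd p' q' ?d"
  have tfa: "tfib p' q' (?m \<cdot> ?a) ?y ?z"
    by (rule tdir_split) simp_all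
  have a: "?a \<in> Arr C" "Cod C ?a = Dom C ?b" by simp_all
  note tfa' = tf [OF a tfa]
  note [simp] = tfa'
  have re_pair_a: "reindex C \<phi> ?b \<cdot> pair C (Pos \<phi> \<cdot> ?b) p' ?a ?y = pair C ?b p ?a (Y ?a ?y)"
    unfolding Y_def by (rule re_pair [OF tfa'(1)])
  have "Dir ?M = pair C ?f q (reindex C \<phi> ?b \<cdot> pair C (Pos \<phi> \<cdot> ?b) p' ?a ?y)
      (Dir \<psi> \<cdot> pair C (Pos \<psi>) q' (?f \<cdot> reindex C \<phi> ?b \<cdot> pair C (Pos \<phi> \<cdot> ?b) p' ?a ?y) ?z)"
    by (simp only: tri_mor_def Let_def \<phi>(2,3) \<psi>(2,3) pmor.select_convs tfst_def tsnd_def)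
  then have Dir: "Dir ?M = tdir p q ?a (Y ?a ?y) (Z ?a ?y ?z)"
    unfolding re_pair_a by (simp only: tdir_def tap_def Z_def dir_def [of \<psi>] \<psi>(3))
  show "is_pmor C ?M"
    by (rule is_pmorI [of "tri C p q" "tri C p' q'"])
      (simp_all add: src tgt pos Dir exponentiable_tri)
  show "dir ?M a (tdir p' q' (Pos ?M \<cdot> a) y z) =
      tdir p q a (dir \<phi> (?b \<cdot> a) y) (dir \<psi> (tap p q a (dir \<phi> (?b \<cdot> a) y)) z)"
    if "a \<in> Arr C" "Cod C a = Dom C ?b" "tfib p' q' (Pos ?M \<cdot> a) y z" for a y z
  proof -
    note [simp] = that(1,2) tfibD(3-6,8,9) [OF that(3) [unfolded pos]]
    let ?w = "pair C ?m (tri C p' q') a (tdir p' q' (?m \<cdot> a) y z)"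
    have [simp]: "tfib p' q' (?m \<cdot> a) y z" using that(3) by (simp only: pos)
    have [simp]: "fib ?m (tri C p' q') a (tdir p' q' (?m \<cdot> a) y z)" by (rule fibI) simp_all
    \<comment> \<open>\<open>?w\<close> classifies the given element, so the generic directions
      \<open>?y\<close> and \<open>?z\<close> restrict along it to \<open>y\<close> and
      \<open>z\<close>.\<close>
    have "?y \<cdot> ?w = y" "?z \<cdot> ?w = z" by (simp_all add: tfst_Cmp tsnd_Cmp)
    then have "Y ?a ?y \<cdot> ?w = Y a y" "Z ?a ?y ?z \<cdot> ?w = Z a y z"
      unfolding Z_def using tfa' by (simp_all add: Y_def)
    then show ?thesis
      unfolding dir_def [of ?M] Dir tgt pos using tfa' by (simp add: Y_def Z_def)
  qed
qed

section \<open>The bijection\<close>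


lemma frown_simps [simp]:
  assumes "f \<in> Arr C" "q \<in> Arr C" "Cod C f = Cod C q" "p \<in> Arr C" "Dom C f = Cod C p"
  shows "frown C p f q \<in> Arr C" "Cod C (frown C p f q) = Dom C (pr1 C f q)"
  using assms by (simp_all add: frown_def)

lemma exponentiable_frown:
  assumes "f \<in> Arr C" "q \<in> Arr C" "Cod C f = Cod C q" "exponentiable C p" "Dom C f = Cod C p"
  shows "exponentiable C (frown C p f q)"
  unfolding frown_def using assms by (intro exponentiable_pr1) (simp_all add: exponentiable_Arr)

text \<open>A direction of \<open>frown C p f q\<close> is \<open>fdir p f q c y\<close> for a position \<open>c\<close> and \<open>y\<close> in \<open>P\<^sub>*\<close> over it;
  \<open>ffst\<close> projects to \<open>y\<close>.\<close>

definition ffst :: "'b \<Rightarrow> 'b \<Rightarrow> 'b \<Rightarrow> 'b" where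
  "ffst p f q = pr2 C (pr1 C f q) p"

lemma ffst_simps [simp]:
  assumes "f \<in> Arr C" "q \<in> Arr C" "Cod C f = Cod C q" "p \<in> Arr C" "Dom C f = Cod C p"
  shows "ffst p f q \<in> Arr C" "Dom C (ffst p f q) = Dom C (frown C p f q)"
    "Cod C (ffst p f q) = Dom C p" "p \<cdot> ffst p f q = pr1 C f q \<cdot> frown C p f q"
    "\<lbrakk>h \<in> Arr C; Cod C h = Dom C (frown C p f q)\<rbrakk> \<Longrightarrow>
      p \<cdot> ffst p f q \<cdot> h = pr1 C f q \<cdot> frown C p f q \<cdot> h"
  using assms by (simp_all add: frown_def ffst_def)

definition fdir :: "'b \<Rightarrow> 'b \<Rightarrow> 'b \<Rightarrow> 'b \<Rightarrow> 'b \<Rightarrow> 'b" where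
  "fdir p f q c y = pair C (pr1 C f q) p c y"

lemma fdir_simps [simp]:
  assumes "fib (pr1 C f q) p c y"
  shows "fdir p f q c y \<in> Arr C" "Dom C (fdir p f q c y) = Dom C c"
    "Cod C (fdir p f q c y) = Dom C (frown C p f q)"
    "frown C p f q \<cdot> fdir p f q c y = c" "ffst p f q \<cdot> fdir p f q c y = y"
    "\<lbrakk>h \<in> Arr C; Cod C h = Dom C c\<rbrakk> \<Longrightarrow> fdir p f q c y \<cdot> h = fdir p f q (c \<cdot> h) (y \<cdot> h)"
  using assms by (simp_all add: frown_def ffst_def fdir_def)

lemma frown_eqI:
  assumes "f \<in> Arr C" "q \<in> Arr C" "Cod C f = Cod C q" "p \<in> Arr C" "Dom C f = Cod C p"
    and "d \<in> Arr C" "Cod C d = Dom C (frown C p f q)" "d' \<in> Arr C" "Cod C d' = Dom C (frown C p f q)"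
    and "Dom C d = Dom C d'"
    and "frown C p f q \<cdot> d = frown C p f q \<cdot> d'" "ffst p f q \<cdot> d = ffst p f q \<cdot> d'"
  shows "d = d'"
  by (rule pr_eqI [of "pr1 C f q" p]) (use assms in \<open>simp_all add: frown_def ffst_def\<close>)

text \<open>\<open>corr p q r \<phi> f \<psi>\<close> relates \<open>\<phi> : p \<rightarrow> q \<triangleleft> r\<close> to \<open>\<psi> : frown C p f q \<rightarrow> r\<close> when, on generalized
  elements, \<open>\<phi>\<^sub>1 a = (f a, \<psi>\<^sub>1 (a, -))\<close> and \<open>\<phi>\<^sup>\<sharp> (a, (z, w))\<close> is the \<open>P\<^sub>*\<close>-component of \<open>\<psi>\<^sup>\<sharp> ((a, z), w)\<close>.\<close>

definition corr :: "'b \<Rightarrow> 'b \<Rightarrow> 'b \<Rightarrow> 'b pmor \<Rightarrow> 'b \<Rightarrow> 'b pmor \<Rightarrow> bool" where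
  "corr p q r \<phi> f \<psi> \<longleftrightarrow>
    tri_base C q r \<cdot> Pos \<phi> = f \<and>
    (\<forall>a z. fib f q a z \<longrightarrow> tap q r (Pos \<phi> \<cdot> a) z = Pos \<psi> \<cdot> pair C f q a z) \<and>
    (\<forall>a z w. fib f q a z \<longrightarrow> fib (Pos \<psi>) r (pair C f q a z) w \<longrightarrow>
      dir \<phi> a (tdir q r (Pos \<phi> \<cdot> a) z w) = ffst p f q \<cdot> dir \<psi> (pair C f q a z) w)"

lemma corrD:
  assumes "corr p q r \<phi> f \<psi>"
  shows "tri_base C q r \<cdot> Pos \<phi> = f"
    "fib f q a z \<Longrightarrow> tap q r (Pos \<phi> \<cdot> a) z = Pos \<psi> \<cdot> pair C f q a z"
    "fib f q a z \<Longrightarrow> fib (Pos \<psi>) r (pair C f q a z) w \<Longrightarrow>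
      dir \<phi> a (tdir q r (Pos \<phi> \<cdot> a) z w) = ffst p f q \<cdot> dir \<psi> (pair C f q a z) w"
  using assms by (auto simp: corr_def)

lemma tri_homD:
  assumes "\<phi> \<in> tri_hom C p q r"
  shows "is_pmor C \<phi>" "Src \<phi> = p" "Tgt \<phi> = tri C q r"
  using assms by (simp_all add: tri_hom_def Poly_simps)

lemma frown_homD:
  assumes "(f, \<psi>) \<in> frown_hom C p q r"
  shows "f \<in> Arr C" "Dom C f = Cod C p" "Cod C f = Cod C q"
    "is_pmor C \<psi>" "Src \<psi> = frown C p f q" "Tgt \<psi> = r"
  using assms by (simp_all add: frown_hom_def Poly_simps Hom_def)

lemma fib_tri_base:
  assumes "exponentiable C q" "exponentiable C r" "m \<in> Arr C" "Cod C m = Dom C (tri_base C q r)"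
    and "fib f q a z" "tri_base C q r \<cdot> m = f"
  shows "fib (tri_base C q r) q (m \<cdot> a) z"
  by (rule fib_over) (use assms in simp_all)

text \<open>Bridges two readings of a pair \<open>(z, w)\<close>: as successive elements of fibres
  over \<open>f\<close> and \<open>g\<close>, which suits \<open>frown\<close>, and as a direction
  of the composition product. They match once the position \<open>m\<close> evaluates to
  \<open>g\<close>.\<close>

lemma tfib_of_fib:
  assumes q: "exponentiable C q" and r: "exponentiable C r"
    and m: "m \<in> Arr C" "Cod C m = Dom C (tri_base C q r)" "tri_base C q r \<cdot> m = f"
    and g: "g \<in> Arr C" and az: "fib f q a z" and w: "fib g r (pair C f q a z) w"
    and tap: "tap q r (m \<cdot> a) z = g \<cdot> pair C f q a z"
  shows "tfib q r (m \<cdot> a) z w"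
proof -
  have "Dom C f = Dom C m" using m q r by auto
  then show ?thesis
    unfolding tfib_def using fib_tri_base [OF q r m(1,2) az m(3)] fibD [OF w] fibD [OF az] az tap m
    by simp
qed

lemma fib_tdir:
  assumes "exponentiable C q" "exponentiable C r" "m \<in> Arr C" "Cod C m = Dom C (tri_base C q r)"
    and "a \<in> Arr C" "Cod C a = Dom C m" "tfib q r (m \<cdot> a) z w"
  shows "fib m (tri C q r) a (tdir q r (m \<cdot> a) z w)"
  using assms by (intro fibI) simp_all

lemma corr_exists_right:
  assumes p: "exponentiable C p" and q: "exponentiable C q" and r: "exponentiable C r"
    and \<phi>: "\<phi> \<in> tri_hom C p q r"
  shows "\<exists>f \<psi>. (f, \<psi>) \<in> frown_hom C p q r \<and> corr p q r \<phi> f \<psi>"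
proof -
  note [simp] = p q r p [THEN exponentiable_Arr] q [THEN exponentiable_Arr] r [THEN exponentiable_Arr]
    tri_homD [OF \<phi>]
  define m where "m = Pos \<phi>"
  have m [simp]: "m \<in> Arr C" "Dom C m = Cod C p" "Cod C m = Dom C (tri_base C q r)"
    by (simp_all add: m_def)
  define f where "f = tri_base C q r \<cdot> m"
  have f [simp]: "f \<in> Arr C" "Dom C f = Cod C p" "Cod C f = Cod C q" by (simp_all add: f_def)
  \<comment> \<open>The function part of the position \<open>m\<close>, uncurried by evaluating it
    at the generic element of the pullback of \<open>f\<close> and \<open>q\<close>.\<close>
  define g where "g = tap q r (m \<cdot> pr1 C f q) (pr2 C f q)"
  have fibm: "fib (tri_base C q r) q (m \<cdot> a) z" if "fib f q a z" for a z
    using that by (intro fib_tri_base) (simp_all add: f_def)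
  have fib0: "fib f q (pr1 C f q) (pr2 C f q)" by simp
  note [simp] = fibm [OF fib0]
  have g [simp]: "g \<in> Arr C" "Dom C g = Dom C (pr1 C f q)" "Cod C g = Cod C r"
    by (simp_all add: g_def)
  have g_pair: "g \<cdot> pair C f q a z = tap q r (m \<cdot> a) z" if "fib f q a z" for a z
    using that fibD [OF that] by (simp add: g_def)
  have tf: "tfib q r (m \<cdot> a) z w" if "fib f q a z" "fib g r (pair C f q a z) w" for a z w
    by (rule tfib_of_fib [of q r m f g]) (simp_all add: that g_pair f_def [symmetric])
  have fd: "fib m (tri C q r) a (tdir q r (m \<cdot> a) z w)"
    if "fib f q a z" "fib g r (pair C f q a z) w" for a z w
    using fibD(3,7) [OF that(1)] by (intro fib_tdir tf that) simp_all
  define k where "k a z w = dir \<phi> a (tdir q r (m \<cdot> a) z w)" for a z w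
  have k: "k a z w \<in> Arr C" "Dom C (k a z w) = Dom C a" "Cod C (k a z w) = Dom C p" "p \<cdot> k a z w = a"
    "\<And>h. h \<in> Arr C \<Longrightarrow> Cod C h = Dom C a \<Longrightarrow> k a z w \<cdot> h = k (a \<cdot> h) (z \<cdot> h) (w \<cdot> h)"
    if "fib f q a z" "fib g r (pair C f q a z) w" for a z w
    using fibD(3,7) [OF that(1)] fd [OF that] tf [OF that]
    by (simp_all add: k_def m_def)
  let ?c = "pr1 C g r" and ?w = "pr2 C g r"
  let ?a = "pr1 C f q \<cdot> ?c" and ?z = "pr2 C f q \<cdot> ?c"
  have az [simp]: "fib f q ?a ?z" by simp
  have "pair C f q ?a ?z = ?c" by simp
  then have cw: "fib g r (pair C f q ?a ?z) ?w" by simp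
  note k0 [simp] = k [OF az cw]
  \<comment> \<open>The direction \<open>k\<close> of \<open>p\<close> lies over the first component
    of the position \<open>?c\<close>, so the two combine into a direction of
    \<open>frown C p f q\<close>.\<close>
  have fk: "fib (pr1 C f q) p ?c (k ?a ?z ?w)" by (intro fibI) simp_all
  define \<psi> where "\<psi> = \<lparr>Src = frown C p f q, Tgt = r, Pos = g, Dir = fdir p f q ?c (k ?a ?z ?w)\<rparr>"
  have \<psi>_simps [simp]: "Src \<psi> = frown C p f q" "Tgt \<psi> = r" "Pos \<psi> = g" by (simp_all add: \<psi>_def)
  have \<psi>: "is_pmor C \<psi>"
    by (rule is_pmorI [of "frown C p f q" r]) (use fk in \<open>simp_all add: exponentiable_frown \<psi>_def\<close>)
  have "corr p q r \<phi> f \<psi>"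
    unfolding corr_def m_def [symmetric]
  proof (intro conjI allI impI)
    show "tri_base C q r \<cdot> m = f" by (simp add: f_def)
    fix a z assume f1: "fib f q a z"
    note [simp] = f1 fibD(3,4,6-8) [OF f1]
    show "tap q r (m \<cdot> a) z = Pos \<psi> \<cdot> pair C f q a z" by (simp add: g_pair)
    fix w assume "fib (Pos \<psi>) r (pair C f q a z) w"
    then have f2: "fib g r (pair C f q a z) w" by simp
    note [simp] = f2 fibD(3,4,6-8) [OF f2]
    have "fib (pr1 C f q) p (pair C f q a z) (k a z w)"
      using k(1-4) [OF f1 f2] by (intro fibI) simp_all
    then show "dir \<phi> a (tdir q r (m \<cdot> a) z w) = ffst p f q \<cdot> dir \<psi> (pair C f q a z) w"
      using fk by (simp add: dir_def [of \<psi>]) (simp add: \<psi>_def k_def [of a z w, symmetric])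
  qed
  moreover have "(f, \<psi>) \<in> frown_hom C p q r"
    using \<psi> by (simp add: frown_hom_def Hom_def Poly_simps)
  ultimately show ?thesis by blast
qed

text \<open>\<open>corr\<close> fixes \<open>f\<close> outright, fixes \<open>Pos\<close> by
  evaluation at the generic pair, and fixes the component of \<open>Dir\<close> in the domain of
  \<open>p\<close>. The other component of a direction of \<open>frown\<close> is its position, so
  nothing is left free.\<close>

lemma corr_unique_right:
  assumes p: "exponentiable C p" and q: "exponentiable C q" and r: "exponentiable C r"
    and t: "(f, \<psi>) \<in> frown_hom C p q r" and t': "(f', \<psi>') \<in> frown_hom C p q r"
    and c: "corr p q r \<phi> f \<psi>" and c': "corr p q r \<phi> f' \<psi>'"
  shows "f' = f \<and> \<psi>' = \<psi>"
proof
  show f: "f' = f" using corrD(1) [OF c] corrD(1) [OF c'] by simp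
  note [simp] = p q r p [THEN exponentiable_Arr] q [THEN exponentiable_Arr] r [THEN exponentiable_Arr]
    frown_homD [OF t] frown_homD(4-) [OF t' [unfolded f]]
  note c' = c' [unfolded f]
  have "Pos \<psi>' \<cdot> pair C f q (pr1 C f q) (pr2 C f q) = Pos \<psi> \<cdot> pair C f q (pr1 C f q) (pr2 C f q)"
    by (subst corrD(2) [OF c, symmetric], simp, subst corrD(2) [OF c', symmetric], simp_all del: pair_pr)
  then have pos: "Pos \<psi>' = Pos \<psi>" by simp
  show "\<psi>' = \<psi>"
  proof (rule pmor_eqI)
    fix c w assume "fib (Pos \<psi>) (Tgt \<psi>) c w"
    then have f1: "fib (Pos \<psi>) r c w" by simp
    note [simp] = f1 fibD(3,4,6-8) [OF f1]
    let ?a = "pr1 C f q \<cdot> c" and ?z = "pr2 C f q \<cdot> c"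
    have az: "fib f q ?a ?z" by simp
    have "ffst p f q \<cdot> dir \<psi> (pair C f q ?a ?z) w = ffst p f q \<cdot> dir \<psi>' (pair C f q ?a ?z) w"
      using corrD(3) [OF c az, of w] corrD(3) [OF c' az, of w] by (simp add: pos)
    then have "ffst p f q \<cdot> dir \<psi>' c w = ffst p f q \<cdot> dir \<psi> c w" by simp
    then show "dir \<psi>' c w = dir \<psi> c w"
      by - (rule frown_eqI [of f q p], simp_all add: pos)
  qed (simp_all add: pos)
qed

lemma corr_exists_left:
  assumes p: "exponentiable C p" and q: "exponentiable C q" and r: "exponentiable C r"
    and t: "(f, \<psi>) \<in> frown_hom C p q r"
  shows "\<exists>\<phi>. \<phi> \<in> tri_hom C p q r \<and> corr p q r \<phi> f \<psi>"
proof -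
  note [simp] = p q r p [THEN exponentiable_Arr] q [THEN exponentiable_Arr] r [THEN exponentiable_Arr]
    frown_homD [OF t]
  define g where "g = Pos \<psi>"
  have g [simp]: "g \<in> Arr C" "Dom C g = Dom C (pr1 C f q)" "Cod C g = Cod C r"
    by (simp_all add: g_def)
  \<comment> \<open>Currying: \<open>f\<close> is the base of the position and \<open>g\<close> its
    function part.\<close>
  define m where "m = tri_elem C q r f g"
  have m [simp]: "m \<in> Arr C" "Dom C m = Cod C p" "Cod C m = Dom C (tri_base C q r)"
    "tri_base C q r \<cdot> m = f"
    unfolding m_def by simp_all
  have tap: "tap q r (m \<cdot> a) z = g \<cdot> pair C f q a z" if "fib f q a z" for a z
    unfolding m_def by (rule tap_tri_elem) (simp_all add: that)
  define k where "k a d = ffst p f q \<cdot> dir \<psi> (pair C f q a (tfst q r d)) (tsnd q r d)" for a d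
  \<comment> \<open>The converse passage to \<open>tfib_of_fib\<close>: a direction at
    \<open>a\<close> splits into an element over \<open>f \<cdot> a\<close> and one over the value
    of \<open>g\<close> there.\<close>
  have fib1: "fib f q a (tfst q r d)" "fib g r (pair C f q a (tfst q r d)) (tsnd q r d)"
    if "fib m (tri C q r) a d" for a d
  proof -
    note [simp] = fibD(3,4,6-9) [OF that]
    have tf: "tfib q r (m \<cdot> a) (tfst q r d) (tsnd q r d)" by (rule tdir_split) simp_all
    note [simp] = tfibD(2-9) [OF tf]
    have "tri_base C q r \<cdot> m \<cdot> a = f \<cdot> a"
      using assoc [of a m "tri_base C q r"] by simp
    then show f: "fib f q a (tfst q r d)"
      using fibD(9) [OF tfibD(1) [OF tf]] by (intro fibI) simp_all
    then show "fib g r (pair C f q a (tfst q r d)) (tsnd q r d)"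
      using tfibD(10) [OF tf] by (intro fibI) (simp_all add: tap)
  qed
  have k: "k a d \<in> Arr C" "Dom C (k a d) = Dom C a" "Cod C (k a d) = Dom C p" "p \<cdot> k a d = a"
    "\<And>h. h \<in> Arr C \<Longrightarrow> Cod C h = Dom C a \<Longrightarrow> k a d \<cdot> h = k (a \<cdot> h) (d \<cdot> h)"
    if "fib m (tri C q r) a d" for a d
    using fib1 [OF that] fibD [OF that]
    by (simp_all add: k_def g_def tfst_Cmp tsnd_Cmp)
  let ?a = "pr1 C m (tri C q r)" and ?d = "pr2 C m (tri C q r)"
  have fib0: "fib m (tri C q r) ?a ?d" by simp
  note [simp] = k [OF fib0]
  define \<phi> where "\<phi> = \<lparr>Src = p, Tgt = tri C q r, Pos = m, Dir = k ?a ?d\<rparr>"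
  have \<phi>_simps [simp]: "Src \<phi> = p" "Tgt \<phi> = tri C q r" "Pos \<phi> = m" by (simp_all add: \<phi>_def)
  have \<phi>: "is_pmor C \<phi>"
    by (rule is_pmorI [of p "tri C q r"]) (simp_all add: exponentiable_tri \<phi>_def)
  have dir: "dir \<phi> a d = k a d" if "fib m (tri C q r) a d" for a d
    using that fibD [OF that] by (simp add: dir_def [of \<phi>]) (simp add: \<phi>_def)
  have "corr p q r \<phi> f \<psi>"
    unfolding corr_def \<phi>_simps
  proof (intro conjI allI impI)
    fix a z assume f1: "fib f q a z"
    note [simp] = f1 fibD(3,4,6-8) [OF f1]
    show "tap q r (m \<cdot> a) z = Pos \<psi> \<cdot> pair C f q a z" by (simp add: tap g_def)
    fix w assume "fib (Pos \<psi>) r (pair C f q a z) w"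
    then have f2: "fib g r (pair C f q a z) w" by (simp add: g_def)
    note [simp] = f2 fibD(3,4,6-8) [OF f2]
    have tf [simp]: "tfib q r (m \<cdot> a) z w"
      by (rule tfib_of_fib [of q r m f g]) (simp_all add: tap)
    have "fib m (tri C q r) a (tdir q r (m \<cdot> a) z w)" by (rule fib_tdir) simp_all
    then show "dir \<phi> a (tdir q r (m \<cdot> a) z w) = ffst p f q \<cdot> dir \<psi> (pair C f q a z) w"
      by (simp add: dir k_def)
  qed simp
  moreover have "\<phi> \<in> tri_hom C p q r"
    using \<phi> by (simp add: tri_hom_def Poly_simps)
  ultimately show ?thesis by blast
qed

text \<open>Positions agree by extensionality, since \<open>corr\<close> prescribes both base and
  evaluations; every direction of \<open>tri C q r\<close> is a pair, and on pairs
  \<open>corr\<close> prescribes \<open>dir\<close>.\<close>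

lemma corr_unique_left:
  assumes p: "exponentiable C p" and q: "exponentiable C q" and r: "exponentiable C r"
    and s: "\<phi> \<in> tri_hom C p q r" and s': "\<phi>' \<in> tri_hom C p q r" and t: "(f, \<psi>) \<in> frown_hom C p q r"
    and c: "corr p q r \<phi> f \<psi>" and c': "corr p q r \<phi>' f \<psi>"
  shows "\<phi>' = \<phi>"
proof -
  note [simp] = p q r p [THEN exponentiable_Arr] q [THEN exponentiable_Arr] r [THEN exponentiable_Arr]
    tri_homD [OF s] tri_homD [OF s'] frown_homD [OF t] corrD(1) [OF c] corrD(1) [OF c']
  have pos: "Pos \<phi>' = Pos \<phi>"
  proof (rule tri_base_eqI [OF q r])
    fix a z assume "fib (tri_base C q r \<cdot> Pos \<phi>) q a z"
    then have "fib f q a z" by simp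
    then show "tap q r (Pos \<phi>' \<cdot> a) z = tap q r (Pos \<phi> \<cdot> a) z"
      using corrD(2) [OF c] corrD(2) [OF c'] by simp
  qed simp_all
  show ?thesis
  proof (rule pmor_eqI)
    fix a d assume "fib (Pos \<phi>) (Tgt \<phi>) a d"
    then have f0: "fib (Pos \<phi>) (tri C q r) a d" by simp
    note [simp] = fibD [OF f0]
    let ?z = "tfst q r d" and ?w = "tsnd q r d"
    have tf: "tfib q r (Pos \<phi> \<cdot> a) ?z ?w" by (rule tdir_split) simp_all
    have d: "tdir q r (Pos \<phi> \<cdot> a) ?z ?w = d" by (rule tdir_split) simp_all
    note [simp] = tfibD(2-9) [OF tf]
    have "tri_base C q r \<cdot> Pos \<phi> \<cdot> a = f \<cdot> a"
      using assoc [of a "Pos \<phi>" "tri_base C q r"] by simp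
    then have f1: "fib f q a ?z"
      using fibD(9) [OF tfibD(1) [OF tf]] by (intro fibI) simp_all
    then have f2: "fib (Pos \<psi>) r (pair C f q a ?z) ?w"
      using tfibD(10) [OF tf] corrD(2) [OF c f1] by (intro fibI) simp_all
    show "dir \<phi>' a d = dir \<phi> a d"
      using corrD(3) [OF c f1 f2] corrD(3) [OF c' f1 f2] by (simp add: pos d)
  qed (simp_all add: pos)
qed

text \<open>Introduced by description, so that everything about it follows from \<open>corr\<close>
  and uniqueness.\<close>

definition transpose :: "'b \<Rightarrow> 'b \<Rightarrow> 'b \<Rightarrow> 'b pmor \<Rightarrow> 'b \<times> 'b pmor" where
  "transpose p q r \<phi> = (THE t. t \<in> frown_hom C p q r \<and> corr p q r \<phi> (fst t) (snd t))"

lemma transpose: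
  assumes "exponentiable C p" "exponentiable C q" "exponentiable C r" "\<phi> \<in> tri_hom C p q r"
  shows "transpose p q r \<phi> \<in> frown_hom C p q r"
    and "corr p q r \<phi> (fst (transpose p q r \<phi>)) (snd (transpose p q r \<phi>))"
proof -
  have "\<exists>!t. t \<in> frown_hom C p q r \<and> corr p q r \<phi> (fst t) (snd t)"
    using corr_exists_right [OF assms] corr_unique_right [OF assms(1-3)] by (intro ex_ex1I) fastforce+
  from theI' [OF this]
  show "transpose p q r \<phi> \<in> frown_hom C p q r"
    and "corr p q r \<phi> (fst (transpose p q r \<phi>)) (snd (transpose p q r \<phi>))"
    by (simp_all add: transpose_def)
qed

lemma transpose_eqI:
  assumes "exponentiable C p" "exponentiable C q" "exponentiable C r"
    and "\<phi> \<in> tri_hom C p q r" "(f, \<psi>) \<in> frown_hom C p q r" "corr p q r \<phi> f \<psi>"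
  shows "transpose p q r \<phi> = (f, \<psi>)"
  using transpose [OF assms(1-4)] corr_unique_right [OF assms(1-3) assms(5) _ assms(6)]
  by (metis prod.collapse)

lemma bij_betw_transpose:
  assumes "exponentiable C p" "exponentiable C q" "exponentiable C r"
  shows "bij_betw (transpose p q r) (tri_hom C p q r) (frown_hom C p q r)"
proof (rule bij_betw_imageI)
  show "inj_on (transpose p q r) (tri_hom C p q r)"
  proof (rule inj_onI)
    fix \<phi> \<phi>' assume *: "\<phi> \<in> tri_hom C p q r" "\<phi>' \<in> tri_hom C p q r"
      and "transpose p q r \<phi> = transpose p q r \<phi>'"
    then show "\<phi> = \<phi>'"
      using corr_unique_left [OF assms *(2,1), of "fst (transpose p q r \<phi>)" "snd (transpose p q r \<phi>)"]
        transpose [OF assms *(1)] transpose [OF assms *(2)] by simp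
  qed
  show "transpose p q r ` tri_hom C p q r = frown_hom C p q r"
  proof (intro equalityI subsetI)
    fix t assume "t \<in> frown_hom C p q r"
    then show "t \<in> transpose p q r ` tri_hom C p q r"
      using corr_exists_left [OF assms, of "fst t" "snd t"] transpose_eqI [OF assms, of _ "fst t" "snd t"]
      by (metis image_eqI prod.collapse)
  qed (use transpose [OF assms] in auto)
qed

text \<open>If the vertical maps carry related pairs to related pairs, then the image of the
  transpose is related to the image of \<phi>, and uniqueness identifies it with the transpose of
  that image.\<close>

lemma square_transposeI:
  assumes "exponentiable C p" "exponentiable C q" "exponentiable C r"
    and "exponentiable C p'" "exponentiable C q'" "exponentiable C r'"
    and u: "\<And>\<phi>. \<phi> \<in> tri_hom C p q r \<Longrightarrow> u \<phi> \<in> tri_hom C p' q' r'"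
    and v: "\<And>f \<psi>. (f, \<psi>) \<in> frown_hom C p q r \<Longrightarrow> (vf f, vp f \<psi>) \<in> frown_hom C p' q' r'"
    and corr: "\<And>\<phi> f \<psi>. \<lbrakk>\<phi> \<in> tri_hom C p q r; (f, \<psi>) \<in> frown_hom C p q r; corr p q r \<phi> f \<psi>\<rbrakk> \<Longrightarrow>
      corr p' q' r' (u \<phi>) (vf f) (vp f \<psi>)"
  shows "square (tri_hom C p q r) (tri_hom C p' q' r') (frown_hom C p q r) (frown_hom C p' q' r')
    u (\<lambda>(f, h). (vf f, vp f h)) (transpose p q r) (transpose p' q' r')"
  unfolding square_def
proof (intro conjI ballI)
  fix \<phi> assume s: "\<phi> \<in> tri_hom C p q r"
  obtain f \<psi> where t: "transpose p q r \<phi> = (f, \<psi>)" by fastforce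
  have "(f, \<psi>) \<in> frown_hom C p q r" "corr p q r \<phi> f \<psi>"
    using transpose [OF assms(1-3) s] by (simp_all add: t)
  then show "transpose p' q' r' (u \<phi>) = (case transpose p q r \<phi> of (f, h) \<Rightarrow> (vf f, vp f h))"
    using s u v corr by (simp add: t transpose_eqI assms)
qed (use u v in auto)

section \<open>Naturality\<close>


text \<open>The action on directions is recorded only after \<open>ffst\<close>, which is the
  component that \<open>corr\<close> sees.\<close>

lemma
  assumes \<gamma> [simp]: "is_pmor C \<gamma>" "Src \<gamma> = p'" "Tgt \<gamma> = p"
    and f [simp]: "f \<in> Arr C" "Dom C f = Cod C p" "Cod C f = Cod C q" and q: "q \<in> Arr C"
  shows is_pmor_frown_map: "is_pmor C (frown_map C \<gamma> f q)"
    and frown_map_simps: "Src (frown_map C \<gamma> f q) = frown C p' (f \<cdot> Pos \<gamma>) q"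
      "Tgt (frown_map C \<gamma> f q) = frown C p f q"
    and Pos_frown_map: "fib (f \<cdot> Pos \<gamma>) q a z \<Longrightarrow>
      Pos (frown_map C \<gamma> f q) \<cdot> pair C (f \<cdot> Pos \<gamma>) q a z = pair C f q (Pos \<gamma> \<cdot> a) z"
    and dir_frown_map: "fib (Pos (frown_map C \<gamma> f q)) (frown C p f q) c d \<Longrightarrow>
      ffst p' (f \<cdot> Pos \<gamma>) q \<cdot> dir (frown_map C \<gamma> f q) c d =
      dir \<gamma> (pr1 C (f \<cdot> Pos \<gamma>) q \<cdot> c) (ffst p f q \<cdot> d)"
proof -
  have exp [simp]: "exponentiable C p" "exponentiable C p'"
    using pmor_exponentiable [OF \<gamma>(1)] by simp_all
  note [simp] = exp [THEN exponentiable_Arr] q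
  let ?M = "frown_map C \<gamma> f q" and ?F = "frown C p f q"
  define f' where "f' = f \<cdot> Pos \<gamma>"
  have f' [simp]: "f' \<in> Arr C" "Dom C f' = Cod C p'" "Cod C f' = Cod C q" by (simp_all add: f'_def)
  have fib_f: "fib f q (Pos \<gamma> \<cdot> a) z" if "fib f' q a z" for a z
    using that by (intro fib_over) (simp_all add: f'_def)
  have fib0: "fib f' q (pr1 C f' q) (pr2 C f' q)" by simp
  note [simp] = fib_f [OF fib0]
  define g where "g = pair C f q (Pos \<gamma> \<cdot> pr1 C f' q) (pr2 C f' q)"
  have g [simp]: "g \<in> Arr C" "Dom C g = Dom C (pr1 C f' q)" "Cod C g = Dom C (pr1 C f q)"
    "pr1 C f q \<cdot> g = Pos \<gamma> \<cdot> pr1 C f' q"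
    by (simp_all add: g_def)
  have g_Cmp: "pr1 C f q \<cdot> g \<cdot> h = Pos \<gamma> \<cdot> pr1 C f' q \<cdot> h" if "h \<in> Arr C" "Cod C h = Dom C (pr1 C f' q)" for h
    using that assoc [of h g "pr1 C f q"] by simp
  have g_pair: "g \<cdot> pair C f' q a z = pair C f q (Pos \<gamma> \<cdot> a) z" if "fib f' q a z" for a z
    using that fibD [OF that] by (simp add: g_def)
  have fib_\<gamma>: "fib (Pos \<gamma>) p (pr1 C f' q \<cdot> c) (ffst p f q \<cdot> d)" if "fib g ?F c d" for c d
    using fibD [OF that] by (intro fibI) (simp_all add: g_Cmp)
  have fib_k: "fib (pr1 C f' q) p' c (dir \<gamma> (pr1 C f' q \<cdot> c) (ffst p f q \<cdot> d))" if "fib g ?F c d" for c d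
    using fib_\<gamma> [OF that] fibD [OF that] by simp
  let ?c = "pr1 C g ?F" and ?d = "pr2 C g ?F"
  have fib1: "fib g ?F ?c ?d" by simp
  note [simp] = fib_k [OF fib1] fib_\<gamma> [OF fib1]
  have simps: "Src ?M = frown C p' f' q" "Tgt ?M = ?F" "Pos ?M = g"
    by (simp_all add: frown_map_def Let_def f'_def g_def)
  have Dir: "Dir ?M = fdir p' f' q ?c (dir \<gamma> (pr1 C f' q \<cdot> ?c) (ffst p f q \<cdot> ?d))"
    by (simp only: frown_map_def Let_def fdir_def dir_def ffst_def \<gamma>(2,3) pmor.select_convs g_def f'_def)
  have "is_pmor C ?M"
    by (rule is_pmorI [of "frown C p' f' q" ?F])
      (simp_all add: simps Dir exponentiable_frown)
  moreover have "ffst p' f' q \<cdot> dir ?M c d = dir \<gamma> (pr1 C f' q \<cdot> c) (ffst p f q \<cdot> d)" if "fib g ?F c d" for c d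
    using that fibD [OF that] fib_k [OF that] unfolding dir_def [of ?M] simps Dir by simp
  ultimately show "is_pmor C ?M" "Src ?M = frown C p' (f \<cdot> Pos \<gamma>) q" "Tgt ?M = ?F"
    "fib (f \<cdot> Pos \<gamma>) q a z \<Longrightarrow> Pos ?M \<cdot> pair C (f \<cdot> Pos \<gamma>) q a z = pair C f q (Pos \<gamma> \<cdot> a) z"
    "fib (Pos ?M) ?F c d \<Longrightarrow> ffst p' (f \<cdot> Pos \<gamma>) q \<cdot> dir ?M c d =
      dir \<gamma> (pr1 C (f \<cdot> Pos \<gamma>) q \<cdot> c) (ffst p f q \<cdot> d)"
    using g_pair simps by (simp_all add: f'_def)
qed

text \<open>Both sides pull a direction of \<open>p\<close> at the image of \<open>a\<close> back
  along \<gamma>^\<sharp>. On one side it comes from \<phi>, on the other it is the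
  \<open>ffst\<close> component given by \<psi>, and \<open>corr\<close> at the image of
  \<open>a\<close> says that these agree.\<close>

lemma square_left:
  assumes p: "exponentiable C p" and p': "exponentiable C p'" and q: "exponentiable C q"
    and r: "exponentiable C r" and \<gamma>: "\<gamma> \<in> Hom (Poly C) p' p"
  shows "square (tri_hom C p q r) (tri_hom C p' q r) (frown_hom C p q r) (frown_hom C p' q r)
    (\<lambda>g. g \<cdot>\<^bsub>Poly C\<^esub> \<gamma>)
    (\<lambda>(f, h). (f \<cdot> Pos \<gamma>, h \<cdot>\<^bsub>Poly C\<^esub> frown_map C \<gamma> f q))
    (transpose p q r) (transpose p' q r)"
proof (rule square_transposeI [OF p q r p' q r])
  have \<gamma>' [simp]: "is_pmor C \<gamma>" "Src \<gamma> = p'" "Tgt \<gamma> = p" using \<gamma> by (simp_all add: Poly_simps)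
  note [simp] = p p' q r p [THEN exponentiable_Arr] p' [THEN exponentiable_Arr]
    q [THEN exponentiable_Arr] r [THEN exponentiable_Arr]
  show "\<phi> \<cdot>\<^bsub>Poly C\<^esub> \<gamma> \<in> tri_hom C p' q r" if "\<phi> \<in> tri_hom C p q r" for \<phi>
    using tri_homD [OF that] by (simp add: tri_hom_def Poly_simps is_pmor_Cmp)
  fix f \<psi> assume t: "(f, \<psi>) \<in> frown_hom C p q r"
  note [simp] = frown_homD [OF t]
  note map = is_pmor_frown_map [OF \<gamma>', of f q] frown_map_simps [OF \<gamma>', of f q]
  note [simp] = map
  show "(f \<cdot> Pos \<gamma>, \<psi> \<cdot>\<^bsub>Poly C\<^esub> frown_map C \<gamma> f q) \<in> frown_hom C p' q r"
    by (simp add: frown_hom_def Hom_def Poly_simps is_pmor_Cmp)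
  fix \<phi> assume s: "\<phi> \<in> tri_hom C p q r" and c: "corr p q r \<phi> f \<psi>"
  note [simp] = tri_homD [OF s] corrD(1) [OF c]
  show "corr p' q r (\<phi> \<cdot>\<^bsub>Poly C\<^esub> \<gamma>) (f \<cdot> Pos \<gamma>) (\<psi> \<cdot>\<^bsub>Poly C\<^esub> frown_map C \<gamma> f q)"
    unfolding corr_def
  proof (intro conjI allI impI)
    show "tri_base C q r \<cdot> Pos (\<phi> \<cdot>\<^bsub>Poly C\<^esub> \<gamma>) = f \<cdot> Pos \<gamma>"
      using assoc [of "Pos \<gamma>" "Pos \<phi>" "tri_base C q r"] by simp
    fix a z assume f1: "fib (f \<cdot> Pos \<gamma>) q a z"
    note [simp] = f1 fibD(3,4,6-8) [OF f1]
    have f2 [simp]: "fib f q (Pos \<gamma> \<cdot> a) z" by (rule fib_over [OF f1]) simp_all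
    let ?M = "frown_map C \<gamma> f q" and ?c = "pair C (f \<cdot> Pos \<gamma>) q a z"
    have Mc: "Pos ?M \<cdot> ?c = pair C f q (Pos \<gamma> \<cdot> a) z" by (rule Pos_frown_map) simp_all
    show tap: "tap q r (Pos (\<phi> \<cdot>\<^bsub>Poly C\<^esub> \<gamma>) \<cdot> a) z = Pos (\<psi> \<cdot>\<^bsub>Poly C\<^esub> ?M) \<cdot> ?c"
      using corrD(2) [OF c f2] by (simp add: Mc)
    fix w assume "fib (Pos (\<psi> \<cdot>\<^bsub>Poly C\<^esub> ?M)) r ?c w"
    then have f3: "fib (Pos \<psi> \<cdot> Pos ?M) r ?c w" by simp
    have f4: "fib (Pos \<psi>) r (pair C f q (Pos \<gamma> \<cdot> a) z) w"
      using fib_over [OF f3] by (simp add: Mc)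
    have tf: "tfib q r (Pos \<phi> \<cdot> Pos \<gamma> \<cdot> a) z w"
      by (rule tfib_of_fib [of q r "Pos \<phi>" f "Pos \<psi>"]) (simp_all add: f4 corrD(2) [OF c])
    have f5: "fib (Pos \<phi> \<cdot> Pos \<gamma>) (tri C q r) a (tdir q r (Pos \<phi> \<cdot> Pos \<gamma> \<cdot> a) z w)"
      using tf by (intro fibI) simp_all
    have "dir (\<phi> \<cdot>\<^bsub>Poly C\<^esub> \<gamma>) a (tdir q r (Pos \<phi> \<cdot> Pos \<gamma> \<cdot> a) z w) =
        dir \<gamma> a (ffst p f q \<cdot> dir \<psi> (pair C f q (Pos \<gamma> \<cdot> a) z) w)"
      using f5 corrD(3) [OF c f2 f4] by (simp add: dir_Cmp)
    also have "\<dots> = ffst p' (f \<cdot> Pos \<gamma>) q \<cdot> dir ?M ?c (dir \<psi> (Pos ?M \<cdot> ?c) w)"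
      by (subst dir_frown_map) (simp_all add: Mc f4)
    also have "\<dots> = ffst p' (f \<cdot> Pos \<gamma>) q \<cdot> dir (\<psi> \<cdot>\<^bsub>Poly C\<^esub> ?M) ?c w"
      using f3 by (simp add: dir_Cmp)
    finally show "dir (\<phi> \<cdot>\<^bsub>Poly C\<^esub> \<gamma>) a (tdir q r (Pos (\<phi> \<cdot>\<^bsub>Poly C\<^esub> \<gamma>) \<cdot> a) z w) =
        ffst p' (f \<cdot> Pos \<gamma>) q \<cdot> dir (\<psi> \<cdot>\<^bsub>Poly C\<^esub> ?M) ?c w" by simp
  qed
qed

section \<open>Naturality in r\<close>

text \<open>The identity on \<open>q\<close> fixes \<open>f\<close> and \<open>z\<close>, so only
  \<open>w\<close> changes: both composites first move it along \<rho>^\<sharp> at the value of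
  \<psi> on \<open>(a, z)\<close>, and then \<open>corr\<close> applies to the pair so
  obtained.\<close>

lemma square_right:
  assumes p: "exponentiable C p" and q: "exponentiable C q"
    and r: "exponentiable C r" and r': "exponentiable C r'" and \<rho>: "\<rho> \<in> Hom (Poly C) r r'"
  shows "square (tri_hom C p q r) (tri_hom C p q r') (frown_hom C p q r) (frown_hom C p q r')
    (\<lambda>g. tri_mor C (Idn (Poly C) q) \<rho> \<cdot>\<^bsub>Poly C\<^esub> g)
    (\<lambda>(f, h). (f, \<rho> \<cdot>\<^bsub>Poly C\<^esub> h))
    (transpose p q r) (transpose p q r')"
proof (rule square_transposeI [OF p q r p q r'])
  have \<rho>' [simp]: "is_pmor C \<rho>" "Src \<rho> = r" "Tgt \<rho> = r'" using \<rho> by (simp_all add: Poly_simps)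
  note [simp] = p q r r' p [THEN exponentiable_Arr] q [THEN exponentiable_Arr]
    r [THEN exponentiable_Arr] r' [THEN exponentiable_Arr]
  note Id = is_pmor_Idn [OF q] Idn_Poly_simps(1,2) [OF q]
  let ?M = "tri_mor C (Idn (Poly C) q) \<rho>"
  note [simp] = is_pmor_tri_mor [OF Id \<rho>'] tri_mor_simps [OF Id \<rho>'] Id Idn_Poly_simps(3) [OF q]
  show "?M \<cdot>\<^bsub>Poly C\<^esub> \<phi> \<in> tri_hom C p q r'" if "\<phi> \<in> tri_hom C p q r" for \<phi>
    using tri_homD [OF that] by (simp add: tri_hom_def Poly_simps is_pmor_Cmp)
  fix f \<psi> assume t: "(f, \<psi>) \<in> frown_hom C p q r"
  note [simp] = frown_homD [OF t]
  show "(f, \<rho> \<cdot>\<^bsub>Poly C\<^esub> \<psi>) \<in> frown_hom C p q r'"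
    by (simp add: frown_hom_def Hom_def Poly_simps is_pmor_Cmp)
  fix \<phi> assume s: "\<phi> \<in> tri_hom C p q r" and c: "corr p q r \<phi> f \<psi>"
  note [simp] = tri_homD [OF s] corrD(1) [OF c]
  have base [simp]: "tri_base C q r' \<cdot> Pos ?M = tri_base C q r" by simp
  have base_Cmp: "tri_base C q r' \<cdot> Pos ?M \<cdot> a = tri_base C q r \<cdot> a"
    if "a \<in> Arr C" "Cod C a = Dom C (tri_base C q r)" for a
    using that assoc [of a "Pos ?M" "tri_base C q r'"] by simp
  have base_\<phi>: "tri_base C q r \<cdot> Pos \<phi> \<cdot> a = f \<cdot> a" if "a \<in> Arr C" "Cod C a = Cod C p" for a
    using that assoc [of a "Pos \<phi>" "tri_base C q r"] by simp
  show "corr p q r' (?M \<cdot>\<^bsub>Poly C\<^esub> \<phi>) f (\<rho> \<cdot>\<^bsub>Poly C\<^esub> \<psi>)"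
    unfolding corr_def
  proof (intro conjI allI impI)
    show "tri_base C q r' \<cdot> Pos (?M \<cdot>\<^bsub>Poly C\<^esub> \<phi>) = f"
      by (simp add: base_Cmp)
    fix a z assume f1: "fib f q a z"
    note [simp] = f1 fibD(3,4,6-8) [OF f1]
    have fb [simp]: "fib (tri_base C q r) q (Pos \<phi> \<cdot> a) z"
      by (rule fib_tri_base [OF q r]) simp_all
    have fI [simp]: "fib (Idn C (Cod C q)) q (f \<cdot> a) z"
      using fibD(9) [OF f1] by (intro fibI) simp_all
    have dI [simp]: "dir (Idn (Poly C) q) (f \<cdot> a) z = z" by (rule dir_Idn [OF q]) simp
    have tap: "tap q r' (Pos ?M \<cdot> Pos \<phi> \<cdot> a) z = Pos \<rho> \<cdot> tap q r (Pos \<phi> \<cdot> a) z"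
      by (subst tap_Pos_tri_mor [OF Id \<rho>']) (simp_all add: base_\<phi>)
    then show "tap q r' (Pos (?M \<cdot>\<^bsub>Poly C\<^esub> \<phi>) \<cdot> a) z = Pos (\<rho> \<cdot>\<^bsub>Poly C\<^esub> \<psi>) \<cdot> pair C f q a z"
      by (simp add: corrD(2) [OF c])
    fix w assume "fib (Pos (\<rho> \<cdot>\<^bsub>Poly C\<^esub> \<psi>)) r' (pair C f q a z) w"
    then have f2: "fib (Pos \<rho> \<cdot> Pos \<psi>) r' (pair C f q a z) w" by simp
    have f3 [simp]: "fib (Pos \<rho>) r' (tap q r (Pos \<phi> \<cdot> a) z) w"
      using fib_over [OF f2] by (simp add: corrD(2) [OF c])
    have tf: "tfib q r' (Pos ?M \<cdot> Pos \<phi> \<cdot> a) z w"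
      using fibD [OF f3] by (simp add: tfib_def tap base_Cmp fib_def base_\<phi> fibD(9) [OF f1])
    have f4: "fib (Pos ?M \<cdot> Pos \<phi>) (tri C q r') a (tdir q r' (Pos ?M \<cdot> Pos \<phi> \<cdot> a) z w)"
      using tf by (intro fibI) simp_all
    have f5: "fib (Pos \<psi>) r (pair C f q a z) (dir \<rho> (tap q r (Pos \<phi> \<cdot> a) z) w)"
      by (intro fib_dir) (simp_all add: corrD(2) [OF c, symmetric])
    have "dir (?M \<cdot>\<^bsub>Poly C\<^esub> \<phi>) a (tdir q r' (Pos ?M \<cdot> Pos \<phi> \<cdot> a) z w) =
        dir \<phi> a (tdir q r (Pos \<phi> \<cdot> a) z (dir \<rho> (tap q r (Pos \<phi> \<cdot> a) z) w))"
      using f4 tf by (simp add: dir_Cmp dir_tri_mor [OF Id \<rho>'] base_\<phi>)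
    also have "\<dots> = ffst p f q \<cdot> dir \<psi> (pair C f q a z) (dir \<rho> (tap q r (Pos \<phi> \<cdot> a) z) w)"
      by (rule corrD(3) [OF c f1 f5])
    also have "\<dots> = ffst p f q \<cdot> dir (\<rho> \<cdot>\<^bsub>Poly C\<^esub> \<psi>) (pair C f q a z) w"
      using f2 by (simp add: dir_Cmp corrD(2) [OF c])
    finally show "dir (?M \<cdot>\<^bsub>Poly C\<^esub> \<phi>) a (tdir q r' (Pos (?M \<cdot>\<^bsub>Poly C\<^esub> \<phi>) \<cdot> a) z w) =
        ffst p f q \<cdot> dir (\<rho> \<cdot>\<^bsub>Poly C\<^esub> \<psi>) (pair C f q a z) w" by simp
  qed
qed

text \<open>An arrow \<open>g : P \<times>\<^sub>Q Q\<^sub>* \<rightarrow> P \<times>\<^sub>Q\<^sub>' Q'\<^sub>*\<close> over \<open>P\<close>, as a morphism that is the identity on the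
  \<open>P\<^sub>*\<close>-component of directions.\<close>

definition frown_over :: "'b \<Rightarrow> 'b \<Rightarrow> 'b \<Rightarrow> 'b \<Rightarrow> 'b \<Rightarrow> 'b \<Rightarrow> 'b pmor" where
  "frown_over p f q f' q' g = \<lparr>Src = frown C p f q, Tgt = frown C p f' q', Pos = g,
    Dir = pair C (pr1 C f q) p (pr1 C g (frown C p f' q')) (ffst p f' q' \<cdot> pr2 C g (frown C p f' q'))\<rparr>"

lemma frown_over_simps [simp]:
  "Src (frown_over p f q f' q' g) = frown C p f q" "Tgt (frown_over p f q f' q' g) = frown C p f' q'"
  "Pos (frown_over p f q f' q' g) = g"
  by (simp_all add: frown_over_def)

lemma
  assumes p: "exponentiable C p"
    and [simp]: "f \<in> Arr C" "Dom C f = Cod C p" "q \<in> Arr C" "Cod C f = Cod C q"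
    and [simp]: "f' \<in> Arr C" "Dom C f' = Cod C p" "q' \<in> Arr C" "Cod C f' = Cod C q'"
    and [simp]: "g \<in> Arr C" "Dom C g = Dom C (pr1 C f q)" "Cod C g = Dom C (pr1 C f' q')"
      "pr1 C f' q' \<cdot> g = pr1 C f q"
  shows is_pmor_frown_over: "is_pmor C (frown_over p f q f' q' g)"
    and dir_frown_over: "fib g (frown C p f' q') c d \<Longrightarrow>
      ffst p f q \<cdot> dir (frown_over p f q f' q' g) c d = ffst p f' q' \<cdot> d"
proof -
  note [simp] = p p [THEN exponentiable_Arr]
  let ?F = "frown C p f' q'"
  have g_Cmp: "pr1 C f' q' \<cdot> g \<cdot> h = pr1 C f q \<cdot> h" if "h \<in> Arr C" "Cod C h = Dom C (pr1 C f q)" for h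
    using that assoc [of h g "pr1 C f' q'"] by simp
  let ?c = "pr1 C g ?F" and ?d = "pr2 C g ?F"
  have fib_d: "fib (pr1 C f q) p c (ffst p f' q' \<cdot> d)" if "fib g ?F c d" for c d
    using fibD [OF that] by (intro fibI) (simp_all add: g_Cmp)
  have fib: "fib (pr1 C f q) p ?c (ffst p f' q' \<cdot> ?d)" by (rule fib_d) simp
  have Dir: "Dir (frown_over p f q f' q' g) = fdir p f q ?c (ffst p f' q' \<cdot> ?d)"
    by (simp add: frown_over_def fdir_def)
  show "is_pmor C (frown_over p f q f' q' g)"
    by (rule is_pmorI [of "frown C p f q" ?F]) (use fib in \<open>simp_all add: Dir exponentiable_frown\<close>)
  show "ffst p f q \<cdot> dir (frown_over p f q f' q' g) c d = ffst p f' q' \<cdot> d" if "fib g ?F c d"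
    using that fibD [OF that] fib fib_d [OF that] by (simp add: dir_def Dir)
qed

section \<open>The inverse of the canonical isomorphism, and naturality in q\<close>

text \<open>Both factors preserve the component seen by \<open>ffst\<close>, so inverting the
  position arrows suffices. One composite is treated here; exchanging the roles of \<open>g\<close>
  and \<open>h\<close> gives the other.\<close>

lemma frown_over_Cmp_eq_Idn:
  assumes p: "exponentiable C p"
    and f [simp]: "f \<in> Arr C" "Dom C f = Cod C p" "q \<in> Arr C" "Cod C f = Cod C q"
    and f' [simp]: "f' \<in> Arr C" "Dom C f' = Cod C p" "q' \<in> Arr C" "Cod C f' = Cod C q'"
    and g [simp]: "g \<in> Arr C" "Dom C g = Dom C (pr1 C f q)" "Cod C g = Dom C (pr1 C f' q')"
      "pr1 C f' q' \<cdot> g = pr1 C f q"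
    and h [simp]: "h \<in> Arr C" "Dom C h = Dom C (pr1 C f' q')" "Cod C h = Dom C (pr1 C f q)"
      "pr1 C f q \<cdot> h = pr1 C f' q'"
    and hg: "h \<cdot> g = Idn C (Dom C (pr1 C f q))"
  shows "frown_over p f' q' f q h \<cdot>\<^bsub>Poly C\<^esub> frown_over p f q f' q' g = Idn (Poly C) (frown C p f q)"
proof -
  note [simp] = p p [THEN exponentiable_Arr]
  let ?F = "frown C p f q" and ?G = "frown_over p f q f' q' g" and ?H = "frown_over p f' q' f q h"
  have F [simp]: "exponentiable C ?F" by (rule exponentiable_frown) simp_all
  note [simp] = is_pmor_frown_over [OF p f f' g] is_pmor_frown_over [OF p f' f h]
    is_pmor_Idn [OF F] Idn_Poly_simps [OF F]
  show ?thesis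
  proof (rule pmor_eqI)
    fix c d assume "fib (Pos (Idn (Poly C) ?F)) (Tgt (Idn (Poly C) ?F)) c d"
    then have f1: "fib (Idn C (Dom C (pr1 C f q))) ?F c d" by simp
    note [simp] = f1 fibD(3,4,6-9) [OF f1]
    have "h \<cdot> g \<cdot> c = (h \<cdot> g) \<cdot> c" by (rule assoc [symmetric]) simp_all
    then have hgc: "h \<cdot> g \<cdot> c = c" by (simp add: hg)
    have f2: "fib (h \<cdot> g) ?F c d" by (simp add: hg)
    have f3: "fib h ?F (g \<cdot> c) d" by (rule fibI) (simp_all add: hgc)
    have f4: "fib g (frown C p f' q') c (dir ?H (g \<cdot> c) d)"
      using f3 by (intro fib_dir) simp_all
    have "dir (?H \<cdot>\<^bsub>Poly C\<^esub> ?G) c d = dir ?G c (dir ?H (g \<cdot> c) d)"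
      using f2 by (simp add: dir_Cmp)
    moreover have "\<dots> = d"
      by (rule frown_eqI [of f q p])
        (use f3 f4 in \<open>simp_all add: dir_frown_over [OF p f f' g] dir_frown_over [OF p f' f h]\<close>)
    ultimately show "dir (?H \<cdot>\<^bsub>Poly C\<^esub> ?G) c d = dir (Idn (Poly C) ?F) c d"
      using f1 by (simp add: dir_Idn)
  qed (simp_all add: hg is_pmor_Cmp)
qed

text \<open>For cartesian \<open>\<phi>\<close>, this is \<open>z \<mapsto> z'\<close> with \<open>\<phi>\<^sup>\<sharp> (q z, z') = z\<close>.\<close>

definition lift :: "'b pmor \<Rightarrow> 'b" where
  "lift \<phi> = pr2 C (Pos \<phi>) (Tgt \<phi>) \<cdot> inv_arr C (Dir \<phi>)"

text \<open>Inverting \<phi>^\<sharp> in \<open>q \<cdot> Dir \<phi> = pr1 C (Pos \<phi>) q'\<close>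
  shows that the inverse sends \<open>z\<close> to the pair of \<open>q \<cdot> z\<close> and
  \<open>lift \<phi> \<cdot> z\<close>. The two cancellation rules are the two halves of
  invertibility.\<close>

lemma lift:
  assumes "cartesian C \<phi>" and [simp]: "Src \<phi> = q" "Tgt \<phi> = q'"
  shows "lift \<phi> \<in> Arr C" "Dom C (lift \<phi>) = Dom C q" "Cod C (lift \<phi>) = Dom C q'"
    and "\<lbrakk>z \<in> Arr C; Cod C z = Dom C q\<rbrakk> \<Longrightarrow> fib (Pos \<phi>) q' (q \<cdot> z) (lift \<phi> \<cdot> z)"
    and "\<lbrakk>z \<in> Arr C; Cod C z = Dom C q\<rbrakk> \<Longrightarrow> dir \<phi> (q \<cdot> z) (lift \<phi> \<cdot> z) = z"
    and "fib (Pos \<phi>) q' b z' \<Longrightarrow> lift \<phi> \<cdot> dir \<phi> b z' = z'"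
proof -
  have \<phi> [simp]: "is_pmor C \<phi>" using assms by (simp add: cartesian_def)
  have arr [simp]: "q \<in> Arr C" "q' \<in> Arr C" using pmor_simps(1,2) [OF \<phi>] by simp_all
  obtain I where inv: "inverse_arrows C (Dir \<phi>) I" using assms by (auto simp: cartesian_def is_iso_def)
  then have I: "I \<in> Arr C" "Dom C I = Dom C q" "Cod C I = Dom C (pr1 C (Pos \<phi>) q')"
    "I \<cdot> Dir \<phi> = Idn C (Dom C (pr1 C (Pos \<phi>) q'))" "Dir \<phi> \<cdot> I = Idn C (Dom C q)"
    by (auto simp: inverse_arrows_def Hom_def)
  note [simp] = I(1-3)
  have D: "q \<cdot> Dir \<phi> = pr1 C (Pos \<phi>) q'" using \<phi> by (simp add: is_pmor_def)
  have lift: "lift \<phi> = pr2 C (Pos \<phi>) q' \<cdot> I" by (simp add: lift_def inv_arr_eqI [OF inv])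
  show "lift \<phi> \<in> Arr C" "Dom C (lift \<phi>) = Dom C q" "Cod C (lift \<phi>) = Dom C q'"
    by (simp_all add: lift)
  have "pr1 C (Pos \<phi>) q' \<cdot> I = q \<cdot> Dir \<phi> \<cdot> I" unfolding D [symmetric] by (rule assoc) simp_all
  then have p1: "pr1 C (Pos \<phi>) q' \<cdot> I = q" by (simp add: I(4,5))
  have p1z: "q \<cdot> z = pr1 C (Pos \<phi>) q' \<cdot> I \<cdot> z" if "z \<in> Arr C" "Cod C z = Dom C q" for z
    using that assoc [of z I "pr1 C (Pos \<phi>) q'"] by (simp add: p1)
  have p2z: "lift \<phi> \<cdot> z = pr2 C (Pos \<phi>) q' \<cdot> I \<cdot> z" if "z \<in> Arr C" "Cod C z = Dom C q" for z
    using that by (simp add: lift)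
  show "fib (Pos \<phi>) q' (q \<cdot> z) (lift \<phi> \<cdot> z)" if "z \<in> Arr C" "Cod C z = Dom C q"
    unfolding p1z [OF that] p2z [OF that] using that by simp
  show "dir \<phi> (q \<cdot> z) (lift \<phi> \<cdot> z) = z" if "z \<in> Arr C" "Cod C z = Dom C q"
    unfolding p1z [OF that] p2z [OF that] dir_def
    using that assoc [of z I "Dir \<phi>"] by (simp add: I(4,5))
  show "lift \<phi> \<cdot> dir \<phi> b z' = z'" if "fib (Pos \<phi>) q' b z'"
    using that fibD [OF that] assoc [of "pair C (Pos \<phi>) q' b z'" "Dir \<phi>" I]
    by (simp add: lift dir_def I(4,5))
qed

text \<open>The inverse \<open>(a, z') \<mapsto> (a, \<phi>\<^sup>\<sharp> (f a, z'))\<close> of the position part of \<^const>\<open>frown_can\<close>.\<close>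

definition unlift :: "'b pmor \<Rightarrow> 'b \<Rightarrow> 'b" where
  "unlift \<phi> f = (let f' = Pos \<phi> \<cdot> f; q' = Tgt \<phi> in
    pair C f (Src \<phi>) (pr1 C f' q') (dir \<phi> (f \<cdot> pr1 C f' q') (pr2 C f' q')))"

lemma unlift:
  assumes \<phi> [simp]: "is_pmor C \<phi>" "Src \<phi> = q" "Tgt \<phi> = q'"
    and f [simp]: "f \<in> Arr C" "Cod C f = Cod C q"
  shows "unlift \<phi> f \<in> Arr C" "Dom C (unlift \<phi> f) = Dom C (pr1 C (Pos \<phi> \<cdot> f) q')"
    "Cod C (unlift \<phi> f) = Dom C (pr1 C f q)" "pr1 C f q \<cdot> unlift \<phi> f = pr1 C (Pos \<phi> \<cdot> f) q'"
    and "fib (Pos \<phi> \<cdot> f) q' a z \<Longrightarrow>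
      fib f q a (dir \<phi> (f \<cdot> a) z) \<and> unlift \<phi> f \<cdot> pair C (Pos \<phi> \<cdot> f) q' a z = pair C f q a (dir \<phi> (f \<cdot> a) z)"
proof -
  have arr [simp]: "q \<in> Arr C" "q' \<in> Arr C" using pmor_simps(1,2) [OF \<phi>(1)] by simp_all
  have fib1: "fib (Pos \<phi>) q' (f \<cdot> a) z" if "fib (Pos \<phi> \<cdot> f) q' a z" for a z
    using fib_over [OF that] by simp
  have fib2: "fib f q a (dir \<phi> (f \<cdot> a) z)" if "fib (Pos \<phi> \<cdot> f) q' a z" for a z
    using fib1 [OF that] fibD [OF that] by simp
  let ?a = "pr1 C (Pos \<phi> \<cdot> f) q'" and ?z = "pr2 C (Pos \<phi> \<cdot> f) q'"
  have fib0: "fib (Pos \<phi> \<cdot> f) q' ?a ?z" by simp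
  note [simp] = fib1 [OF fib0] fib2 [OF fib0]
  have unlift: "unlift \<phi> f = pair C f q ?a (dir \<phi> (f \<cdot> ?a) ?z)" by (simp add: unlift_def Let_def)
  show "unlift \<phi> f \<in> Arr C" "Dom C (unlift \<phi> f) = Dom C (pr1 C (Pos \<phi> \<cdot> f) q')"
    "Cod C (unlift \<phi> f) = Dom C (pr1 C f q)" "pr1 C f q \<cdot> unlift \<phi> f = pr1 C (Pos \<phi> \<cdot> f) q'"
    by (simp_all add: unlift)
  show "fib f q a (dir \<phi> (f \<cdot> a) z) \<and> unlift \<phi> f \<cdot> pair C (Pos \<phi> \<cdot> f) q' a z = pair C f q a (dir \<phi> (f \<cdot> a) z)"
    if "fib (Pos \<phi> \<cdot> f) q' a z"
    using that fib1 [OF that] fib2 [OF that] fibD [OF that] by (simp add: unlift)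
qed

text \<open>On positions, \<open>frown_can\<close> is \<open>(a, z) \<mapsto> (a, lift z)\<close>
  and \<open>unlift\<close> is \<open>(a, z') \<mapsto> (a, \<phi>^\<sharp>(f a, z'))\<close>; the
  round trips are the cancellation rules for \<open>lift\<close>. This replaces the abstract inverse
  in the naturality square by a formula.\<close>

lemma inv_arr_frown_can:
  assumes p: "exponentiable C p" and cart: "cartesian C \<phi>" and \<phi> [simp]: "Src \<phi> = q" "Tgt \<phi> = q'"
    and f [simp]: "f \<in> Arr C" "Dom C f = Cod C p" "Cod C f = Cod C q"
  shows "inv_arr (Poly C) (frown_can C p f \<phi>) = frown_over p (Pos \<phi> \<cdot> f) q' f q (unlift \<phi> f)"
proof -
  have \<phi>' [simp]: "is_pmor C \<phi>" using cart by (simp add: cartesian_def)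
  have arr [simp]: "q \<in> Arr C" "q' \<in> Arr C" using pmor_simps(1,2) [OF \<phi>'] by simp_all
  define f' where "f' = Pos \<phi> \<cdot> f"
  have f' [simp]: "f' \<in> Arr C" "Dom C f' = Cod C p" "Cod C f' = Cod C q'" by (simp_all add: f'_def)
  note lift = lift [OF cart \<phi>] and unlift = unlift [OF \<phi>' \<phi> f(1,3), folded f'_def]
  note [simp] = lift(1-3) unlift(1-4)
  have Pos_Cmp: "f' \<cdot> a = Pos \<phi> \<cdot> f \<cdot> a" if "a \<in> Arr C" "Cod C a = Cod C p" for a
    using that by (simp add: f'_def)
  define h where "h = unlift \<phi> f"
  have h [simp]: "h \<in> Arr C" "Dom C h = Dom C (pr1 C f' q')" "Cod C h = Dom C (pr1 C f q)"
    "pr1 C f q \<cdot> h = pr1 C f' q'" by (simp_all add: h_def)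
  have fib1: "fib f' q' a (lift \<phi> \<cdot> z)" if "fib f q a z" for a z
    using fibD [OF that] fibD(9) [OF lift(4), of z] by (intro fibI) (simp_all add: Pos_Cmp)
  have fib0: "fib f q (pr1 C f q) (pr2 C f q)" by simp
  define g where "g = pair C f' q' (pr1 C f q) (lift \<phi> \<cdot> pr2 C f q)"
  have g [simp]: "g \<in> Arr C" "Dom C g = Dom C (pr1 C f q)" "Cod C g = Dom C (pr1 C f' q')"
    "pr1 C f' q' \<cdot> g = pr1 C f q"
    using fib1 [OF fib0] by (simp_all add: g_def)
  have g_pair: "g \<cdot> pair C f q a z = pair C f' q' a (lift \<phi> \<cdot> z)" if "fib f q a z" for a z
    using that fib1 [OF fib0] fibD [OF that] by (simp add: g_def)
  \<comment> \<open>Typing of the inverse is what permits reassociating the composite in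
    \<open>frown_can\<close> into \<open>lift\<close>.\<close>
  have "inv_arr C (Dir \<phi>) \<in> Arr C \<and> Cod C (inv_arr C (Dir \<phi>)) = Dom C (pr1 C (Pos \<phi>) q') \<and>
      Dom C (inv_arr C (Dir \<phi>)) = Dom C q"
  proof -
    obtain I where inv: "inverse_arrows C (Dir \<phi>) I" using cart by (auto simp: cartesian_def is_iso_def)
    then show ?thesis unfolding inv_arr_eqI [OF inv] by (simp add: inverse_arrows_def Hom_def)
  qed
  then have can: "frown_can C p f \<phi> = frown_over p f q f' q' g"
    by (simp add: frown_can_def frown_over_def Let_def g_def lift_def ffst_def f'_def)
  have hg: "h \<cdot> g = Idn C (Dom C (pr1 C f q))"
  proof -
    have "h \<cdot> g = pair C f q (pr1 C f q) (dir \<phi> (f \<cdot> pr1 C f q) (lift \<phi> \<cdot> pr2 C f q))"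
      unfolding h_def g_def using unlift(5) [OF fib1 [OF fib0]] by simp
    also have "dir \<phi> (f \<cdot> pr1 C f q) (lift \<phi> \<cdot> pr2 C f q) = pr2 C f q"
      using lift(5) [of "pr2 C f q"] by simp
    finally show ?thesis by simp
  qed
  have gh: "g \<cdot> h = Idn C (Dom C (pr1 C f' q'))"
  proof -
    let ?a = "pr1 C f' q'" and ?z = "pr2 C f' q'"
    have fz: "fib f' q' ?a ?z" by simp
    have h_eq: "h = pair C f q ?a (dir \<phi> (f \<cdot> ?a) ?z)"
      using unlift(5) [OF fz] by (simp add: h_def)
    have fz': "fib f q ?a (dir \<phi> (f \<cdot> ?a) ?z)" using unlift(5) [OF fz] by blast
    have "fib (Pos \<phi>) q' (f \<cdot> ?a) ?z" by (rule fib_over) (simp_all add: f'_def)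
    then have "lift \<phi> \<cdot> dir \<phi> (f \<cdot> ?a) ?z = ?z" by (rule lift(6))
    then show ?thesis unfolding h_eq g_pair [OF fz'] by simp
  qed
  have "inverse_arrows (Poly C) (frown_over p f q f' q' g) (frown_over p f' q' f q h)"
    unfolding inverse_arrows_def Poly_simps frown_over_simps
    using frown_over_Cmp_eq_Idn [of p f q f' q' g h] frown_over_Cmp_eq_Idn [of p f' q' f q h g]
    by (simp add: p hg gh is_pmor_frown_over)
  then show ?thesis
    unfolding can by (simp add: category.inv_arr_eqI [OF category_Poly] f'_def h_def)
qed

text \<open>With \<open>y\<close> the direction \<chi>^\<sharp>(f a, z), the inverse canonical map
  sends \<open>(a, z)\<close> to \<open>(a, y)\<close>, and the morphism induced by \<chi> on the
  composition product likewise replaces \<open>z\<close> by \<open>y\<close>. Both sides thus reduce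
  to \<open>corr\<close> at \<open>(a, y)\<close>.\<close>

lemma square_mid:
  assumes p: "exponentiable C p" and q: "exponentiable C q" and q': "exponentiable C q'"
    and r: "exponentiable C r" and \<chi>: "\<chi> \<in> Hom (Poly C) q q'" and cart: "cartesian C \<chi>"
  shows "square (tri_hom C p q r) (tri_hom C p q' r) (frown_hom C p q r) (frown_hom C p q' r)
    (\<lambda>g. tri_mor C \<chi> (Idn (Poly C) r) \<cdot>\<^bsub>Poly C\<^esub> g)
    (\<lambda>(f, h). (Pos \<chi> \<cdot> f, h \<cdot>\<^bsub>Poly C\<^esub> inv_arr (Poly C) (frown_can C p f \<chi>)))
    (transpose p q r) (transpose p q' r)"
proof (rule square_transposeI [OF p q r p q' r])
  have \<chi>' [simp]: "is_pmor C \<chi>" "Src \<chi> = q" "Tgt \<chi> = q'" using \<chi> by (simp_all add: Poly_simps)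
  note [simp] = p q q' r p [THEN exponentiable_Arr] q [THEN exponentiable_Arr]
    r [THEN exponentiable_Arr] q' [THEN exponentiable_Arr]
  note Id = is_pmor_Idn [OF r] Idn_Poly_simps(1,2) [OF r]
  let ?M = "tri_mor C \<chi> (Idn (Poly C) r)"
  note [simp] = is_pmor_tri_mor [OF \<chi>' Id] tri_mor_simps [OF \<chi>' Id] Id Idn_Poly_simps(3) [OF r]
  show "?M \<cdot>\<^bsub>Poly C\<^esub> \<phi> \<in> tri_hom C p q' r" if "\<phi> \<in> tri_hom C p q r" for \<phi>
    using tri_homD [OF that] by (simp add: tri_hom_def Poly_simps is_pmor_Cmp)
  fix f \<psi> assume t: "(f, \<psi>) \<in> frown_hom C p q r"
  note [simp] = frown_homD [OF t]
  note can = inv_arr_frown_can [OF p cart \<chi>'(2,3), of f]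
  define f' where "f' = Pos \<chi> \<cdot> f"
  have f' [simp]: "f' \<in> Arr C" "Dom C f' = Cod C p" "Cod C f' = Cod C q'" by (simp_all add: f'_def)
  note unlift = unlift [OF \<chi>', of f, folded f'_def]
  let ?h = "unlift \<chi> f"
  let ?B = "frown_over p f' q' f q ?h"
  have B [simp]: "is_pmor C ?B" by (rule is_pmor_frown_over) (simp_all add: unlift)
  have can: "inv_arr (Poly C) (frown_can C p f \<chi>) = ?B" unfolding f'_def by (rule can) simp_all
  show "(Pos \<chi> \<cdot> f, \<psi> \<cdot>\<^bsub>Poly C\<^esub> inv_arr (Poly C) (frown_can C p f \<chi>)) \<in> frown_hom C p q' r"
    unfolding can f'_def [symmetric] by (simp add: frown_hom_def Hom_def Poly_simps is_pmor_Cmp)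
  fix \<phi> assume s: "\<phi> \<in> tri_hom C p q r" and c: "corr p q r \<phi> f \<psi>"
  note [simp] = tri_homD [OF s] corrD(1) [OF c]
  have base_Cmp: "tri_base C q' r \<cdot> Pos ?M \<cdot> a = Pos \<chi> \<cdot> tri_base C q r \<cdot> a"
    if "a \<in> Arr C" "Cod C a = Dom C (tri_base C q r)" for a
    using that assoc [of a "Pos ?M" "tri_base C q' r"] by simp
  have base_\<phi>: "tri_base C q r \<cdot> Pos \<phi> \<cdot> a = f \<cdot> a" if "a \<in> Arr C" "Cod C a = Cod C p" for a
    using that assoc [of a "Pos \<phi>" "tri_base C q r"] by simp
  show "corr p q' r (?M \<cdot>\<^bsub>Poly C\<^esub> \<phi>) (Pos \<chi> \<cdot> f)
      (\<psi> \<cdot>\<^bsub>Poly C\<^esub> inv_arr (Poly C) (frown_can C p f \<chi>))"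
    unfolding can f'_def [symmetric] corr_def
  proof (intro conjI allI impI)
    show "tri_base C q' r \<cdot> Pos (?M \<cdot>\<^bsub>Poly C\<^esub> \<phi>) = f'"
      by (simp add: base_Cmp f'_def)
    fix a z assume f1: "fib f' q' a z"
    note [simp] = f1 fibD(3,4,6-8) [OF f1]
    let ?c = "pair C f' q' a z"
    define y where "y = dir \<chi> (f \<cdot> a) z"
    have f2: "fib f q a y" and hc: "?h \<cdot> ?c = pair C f q a y" using unlift(5) [OF _ _ f1] by (simp_all add: y_def)
    note [simp] = f2 fibD(4,6,8) [OF f2] hc
    have fb [simp]: "fib (tri_base C q r) q (Pos \<phi> \<cdot> a) y"
      by (rule fib_tri_base [OF q r]) simp_all
    have f3: "fib (Pos \<chi> \<cdot> tri_base C q r) q' (Pos \<phi> \<cdot> a) z"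
      using fibD(9) [OF f1] by (intro fibI) (simp_all add: base_\<phi> f'_def)
    have tap: "tap q' r (Pos ?M \<cdot> Pos \<phi> \<cdot> a) z = tap q r (Pos \<phi> \<cdot> a) y"
      by (subst tap_Pos_tri_mor [OF \<chi>' Id]) (simp_all add: f3 base_\<phi> y_def [symmetric])
    then show "tap q' r (Pos (?M \<cdot>\<^bsub>Poly C\<^esub> \<phi>) \<cdot> a) z = Pos (\<psi> \<cdot>\<^bsub>Poly C\<^esub> ?B) \<cdot> ?c"
      by (simp add: corrD(2) [OF c] unlift)
    fix w assume "fib (Pos (\<psi> \<cdot>\<^bsub>Poly C\<^esub> ?B)) r ?c w"
    then have f4: "fib (Pos \<psi> \<cdot> ?h) r ?c w" by simp
    have f5 [simp]: "fib (Pos \<psi>) r (pair C f q a y) w"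
      using fib_over [OF f4] by (simp add: unlift)
    have fI: "fib (Idn C (Cod C r)) r (tap q r (Pos \<phi> \<cdot> a) y) w"
      using fibD [OF f5] by (intro fibI) (simp_all add: corrD(2) [OF c])
    have fb' [simp]: "fib (tri_base C q' r) q' (Pos ?M \<cdot> Pos \<phi> \<cdot> a) z"
      using fibD(9) [OF f1] by (intro fibI) (simp_all add: base_Cmp base_\<phi> f'_def)
    have tf: "tfib q' r (Pos ?M \<cdot> Pos \<phi> \<cdot> a) z w"
      using fibD [OF fI] unfolding tfib_def by (simp add: tap)
    have f6: "fib (Pos ?M \<cdot> Pos \<phi>) (tri C q' r) a (tdir q' r (Pos ?M \<cdot> Pos \<phi> \<cdot> a) z w)"
      using tf by (intro fibI) simp_all
    have "dir (?M \<cdot>\<^bsub>Poly C\<^esub> \<phi>) a (tdir q' r (Pos ?M \<cdot> Pos \<phi> \<cdot> a) z w) =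
        dir \<phi> a (tdir q r (Pos \<phi> \<cdot> a) y w)"
      using f6 tf fI
      by (simp add: dir_Cmp dir_tri_mor [OF \<chi>' Id] base_\<phi> y_def [symmetric] dir_Idn)
    also have "\<dots> = ffst p f q \<cdot> dir \<psi> (pair C f q a y) w"
      by (rule corrD(3) [OF c f2 f5])
    also have "\<dots> = ffst p f' q' \<cdot> dir ?B ?c (dir \<psi> (?h \<cdot> ?c) w)"
      by (subst dir_frown_over) (simp_all add: unlift)
    also have "\<dots> = ffst p f' q' \<cdot> dir (\<psi> \<cdot>\<^bsub>Poly C\<^esub> ?B) ?c w"
      using f4 by (simp add: dir_Cmp)
    finally show "dir (?M \<cdot>\<^bsub>Poly C\<^esub> \<phi>) a (tdir q' r (Pos (?M \<cdot>\<^bsub>Poly C\<^esub> \<phi>) \<cdot> a) z w) =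
        ffst p f' q' \<cdot> dir (\<psi> \<cdot>\<^bsub>Poly C\<^esub> ?B) ?c w" by simp
  qed
qed

end

theorem theorem4p23:
  fixes C :: "('o, 'm) cat"
  assumes "category C"
    and "has_finite_limits C"
  shows "\<exists>\<Theta> :: 'm \<Rightarrow> 'm \<Rightarrow> 'm \<Rightarrow> 'm pmor \<Rightarrow> 'm \<times> 'm pmor.
    (\<forall>p \<in> Obj (Poly C). \<forall>q \<in> Obj (Poly C). \<forall>r \<in> Obj (Poly C).
       tri C q r \<in> Obj (Poly C) \<and>
       (\<forall>f \<in> Hom C (Cod C p) (Cod C q). frown C p f q \<in> Obj (Poly C)) \<and>
       bij_betw (\<Theta> p q r) (tri_hom C p q r) (frown_hom C p q r)) \<and>
    (\<forall>p \<in> Obj (Poly C). \<forall>p' \<in> Obj (Poly C). \<forall>q \<in> Obj (Poly C). \<forall>r \<in> Obj (Poly C).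
       \<forall>\<gamma> \<in> Hom (Poly C) p' p.
         square (tri_hom C p q r) (tri_hom C p' q r) (frown_hom C p q r) (frown_hom C p' q r)
           (\<lambda>g. g \<cdot>\<^bsub>Poly C\<^esub> \<gamma>)
           (\<lambda>(f, h). (f \<cdot>\<^bsub>C\<^esub> Pos \<gamma>, h \<cdot>\<^bsub>Poly C\<^esub> frown_map C \<gamma> f q))
           (\<Theta> p q r) (\<Theta> p' q r)) \<and>
    (\<forall>p \<in> Obj (Poly C). \<forall>q \<in> Obj (Poly C). \<forall>r \<in> Obj (Poly C). \<forall>r' \<in> Obj (Poly C).
       \<forall>\<rho> \<in> Hom (Poly C) r r'.
         square (tri_hom C p q r) (tri_hom C p q r') (frown_hom C p q r) (frown_hom C p q r')
           (\<lambda>g. tri_mor C (Idn (Poly C) q) \<rho> \<cdot>\<^bsub>Poly C\<^esub> g)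
           (\<lambda>(f, h). (f, \<rho> \<cdot>\<^bsub>Poly C\<^esub> h))
           (\<Theta> p q r) (\<Theta> p q r')) \<and>
    (\<forall>p \<in> Obj (Poly C). \<forall>q \<in> Obj (Poly C). \<forall>q' \<in> Obj (Poly C). \<forall>r \<in> Obj (Poly C).
       \<forall>\<phi> \<in> Hom (Poly C) q q'. cartesian C \<phi> \<longrightarrow>
         square (tri_hom C p q r) (tri_hom C p q' r) (frown_hom C p q r) (frown_hom C p q' r)
           (\<lambda>g. tri_mor C \<phi> (Idn (Poly C) r) \<cdot>\<^bsub>Poly C\<^esub> g)
           (\<lambda>(f, h). (Pos \<phi> \<cdot>\<^bsub>C\<^esub> f, h \<cdot>\<^bsub>Poly C\<^esub> inv_arr (Poly C) (frown_can C p f \<phi>)))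
           (\<Theta> p q r) (\<Theta> p q' r))"
proof -
  interpret finlim C
    using assms by (simp add: finlim_def finlim_axioms_def)
  show ?thesis
  proof (intro exI [of _ transpose] conjI ballI impI)
    fix p q r f
    assume "p \<in> Obj (Poly C)" "q \<in> Obj (Poly C)" "f \<in> Hom C (Cod C p) (Cod C q)"
    then show "frown C p f q \<in> Obj (Poly C)"
      by (auto simp: Poly_simps Hom_def exponentiable_Arr intro!: exponentiable_frown)
  qed (simp_all add: Poly_simps(1) exponentiable_tri bij_betw_transpose square_left square_right square_mid)
qed

end
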